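(* Let $\mathbb{F}$ be a prime field and let $f \in \mathbb{F}[x_1,\ldots,x_n]$ be a degree four polynomial such that $\|f\|_{U^4}=\delta$. Then there exists a partition of a subspace $V\subseteq \mathbb{F}^{n}$, of dimension $\dim(V) \geq n-O(\log(1/\delta))$, into (affine) subspaces $\{ V_{\alpha}\}_{\alpha\in I}$, satisfying $\dim(V_\alpha) =\Omega\left(n/|\mathbb{F}|^{\log^2(1/\delta)}\right)$, such that for every $\alpha\in I$, $f|_{V_{\alpha}}$ is a cubic polynomial.
   Context: For $f:\mathbb{F}^n\to\mathbb{F}$ and $y\in\mathbb{F}^n$, $\Delta_y(f)(x)=f(x+y)-f(x)$. The $d$-th Gowers norm is $\|f\|_{U^d} = \left|\mathbb{E}_{x,y_1,\ldots,y_d\in\mathbb{F}^n}[\omega^{\Delta_{y_d}\cdots\Delta_{y_1}(f)(x)}]\right|^{1/2^d}$ with $\omega=e^{2\pi i/|\mathbb{F}|}$. Polynomials are identified with the functions $\mathbb{F}^n\to\mathbb{F}$ they define (one works modulo $x_i^{p}-x_i$, where $p=|\mathbb{F}|$). "$f|_{V_\alpha}$ is a cubic polynomial" means that $f$ agrees on $V_\alpha$ with a polynomial of degree at most $3$; this polynomial may depend on $\alpha$. *)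

theory Defs
  imports
    Complex_Main
    "HOL-Library.Disjoint_Sets"
    "HOL-Number_Theory.Number_Theory"
    "Jordan_Normal_Form.Missing_VectorSpace"
begin

text \<open>The prime field of order \<open>p\<close> is \<open>residue_ring p\<close>, whose carrier is the set of integers
  \<open>{0..p-1}\<close>; the dimensions and the field have to be terms rather than types, because the
  constants hidden in the asymptotic notation are uniform in both.\<close>

abbreviation Fp :: "nat \<Rightarrow> int ring" where
  "Fp p \<equiv> residue_ring (int p)"

definition Fn :: "nat \<Rightarrow> nat \<Rightarrow> (int, nat \<Rightarrow> int) module" where
  "Fn p n = ring.func_space (Fp p) {..<n}"

definition lin_subspace :: "nat \<Rightarrow> nat \<Rightarrow> (nat \<Rightarrow> int) set \<Rightarrow> bool" where
  "lin_subspace p n W \<longleftrightarrow> VectorSpace.subspace (Fp p) W (Fn p n)"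

definition lin_dim :: "nat \<Rightarrow> nat \<Rightarrow> (nat \<Rightarrow> int) set \<Rightarrow> nat" where
  "lin_dim p n W = vectorspace.dim (Fp p) ((Fn p n)\<lparr>carrier := W\<rparr>)"

definition affine_subspace :: "nat \<Rightarrow> nat \<Rightarrow> (nat \<Rightarrow> int) set \<Rightarrow> bool" where
  "affine_subspace p n A \<longleftrightarrow>
     (\<exists>a\<in>carrier (Fn p n). \<exists>W. lin_subspace p n W \<and> A = a <+\<^bsub>Fn p n\<^esub> W)"

definition direction :: "nat \<Rightarrow> nat \<Rightarrow> (nat \<Rightarrow> int) set \<Rightarrow> (nat \<Rightarrow> int) set" where
  "direction p n A = {x \<ominus>\<^bsub>Fn p n\<^esub> y | x y. x \<in> A \<and> y \<in> A}"

definition affine_dim :: "nat \<Rightarrow> nat \<Rightarrow> (nat \<Rightarrow> int) set \<Rightarrow> nat" where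
  "affine_dim p n A = lin_dim p n (direction p n A)"

text \<open>Exponent vectors of the monomials of total degree at most \<open>d\<close> in the variables
  \<open>x\<^sub>0, \<dots>, x\<^sub>n\<^sub>-\<^sub>1\<close>.\<close>

definition exponents :: "nat \<Rightarrow> nat \<Rightarrow> (nat \<Rightarrow> nat) set" where
  "exponents n d = {e \<in> {..<n} \<rightarrow>\<^sub>E UNIV. (\<Sum>i<n. e i) \<le> d}"

definition eval_poly ::
    "nat \<Rightarrow> nat \<Rightarrow> nat \<Rightarrow> ((nat \<Rightarrow> nat) \<Rightarrow> int) \<Rightarrow> (nat \<Rightarrow> int) \<Rightarrow> int" where
  "eval_poly p n d c x =
     (\<Oplus>\<^bsub>Fp p\<^esub>e\<in>exponents n d. c e \<otimes>\<^bsub>Fp p\<^esub> (\<Otimes>\<^bsub>Fp p\<^esub>i\<in>{..<n}. x i [^]\<^bsub>Fp p\<^esub> e i))"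

text \<open>\<open>f\<close> agrees on \<open>S\<close> with some polynomial of degree at most \<open>d\<close>.\<close>

definition poly_deg_le_on ::
    "nat \<Rightarrow> nat \<Rightarrow> nat \<Rightarrow> (nat \<Rightarrow> int) set \<Rightarrow> ((nat \<Rightarrow> int) \<Rightarrow> int) \<Rightarrow> bool" where
  "poly_deg_le_on p n d S f \<longleftrightarrow>
     (\<exists>c \<in> exponents n d \<rightarrow> carrier (Fp p). \<forall>x\<in>S. f x = eval_poly p n d c x)"

definition deriv_dir ::
    "nat \<Rightarrow> nat \<Rightarrow> (nat \<Rightarrow> int) \<Rightarrow> ((nat \<Rightarrow> int) \<Rightarrow> int) \<Rightarrow> (nat \<Rightarrow> int) \<Rightarrow> int" where
  "deriv_dir p n y f x = f (x \<oplus>\<^bsub>Fn p n\<^esub> y) \<ominus>\<^bsub>Fp p\<^esub> f x"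

text \<open>The list \<open>[y\<^sub>1, \<dots>, y\<^sub>d]\<close> ranges over all \<open>d\<close>-tuples of directions; \<open>fold\<close> applies
  \<open>y\<^sub>1\<close> first.\<close>

definition gowers_norm :: "nat \<Rightarrow> nat \<Rightarrow> nat \<Rightarrow> ((nat \<Rightarrow> int) \<Rightarrow> int) \<Rightarrow> real" where
  "gowers_norm p n d f =
     cmod ((\<Sum>x\<in>carrier (Fn p n). \<Sum>ys | set ys \<subseteq> carrier (Fn p n) \<and> length ys = d.
              exp (2 * pi * \<i> / p) powi (fold (deriv_dir p n) ys f x))
           / of_nat (card (carrier (Fn p n)) ^ (d + 1)))
       powr (1 / 2 ^ d)"

end

theory Submission
  imports Defs "HOL-Library.Function_Algebras"
begin

text \<open>
  The fourth derivative of a quartic \<open>f\<close> is a symmetric 4-linear form \<open>T\<close> that does not depend on the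
  base point, and \<open>f\<close> is cubic on every coset of \<open>W\<close> as soon as \<open>T\<close> vanishes on \<open>W\<close>. Hence \<open>V\<close> can be
  the whole space, partitioned into the cosets of a single isotropic subspace \<open>W\<close>. The number
  \<open>\<epsilon> = \<delta>\<^sup>1\<^sup>6\<close> is the density of the triples \<open>(a, b, c)\<close> with \<open>T a b c = 0\<close>, and this density does not
  drop when the space is replaced by a subspace.

  Because of the bias, many \<open>y\<close> have a biased trilinear form \<open>T y\<close>. Such a form has many slices of
  small rank; an iterated sumset of these slices is a subspace of slices of bounded rank, so that the
  form vanishes on a subspace of codimension polynomial in \<open>1/\<epsilon>\<close>. Choose such vectors successively,
  each in the subspace on which the forms of the previous ones vanish. The pigeonhole principle for
  the prefix sums yields a \<open>v\<close> for which also \<open>T v v\<close> vanishes on a subspace of small codimension, and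
  a 5-dimensional space of such vectors contains one with \<open>T v v v v = 0\<close> by the Chevalley-Warning
  theorem. Collecting these vectors gives \<open>W\<close> of dimension \<open>n / poly(1/\<epsilon>)\<close>. This suffices because
  \<open>96 x \<le> x\<^sup>2 ln p + O(1)\<close> for \<open>x = ln (1/\<delta>)\<close>; for small \<open>n\<close> a line suffices.
\<close>

section \<open>Finite abelian groups of prime exponent\<close>

text \<open>The obstacle is the diagonal. Adjoining \<open>v\<close> to an isotropic
  \<open>W\<close> requires that \<open>T\<close> vanish with \<open>v\<close> in one, two, three
  and four slots, whereas the bias only counts triples of independent arguments. Each condition has
  its own source. One slot is the trilinear theorem. For two slots \<open>T v v\<close> is compared
  with \<open>T w v\<close>, where \<open>w\<close> is fixed before \<open>v\<close>: the bias does
  control \<open>T w v\<close>, and the chains of prefix sums are designed so that its zeros are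
  passed on to \<open>T v v\<close>. Three slots are a single linear condition, of codimension at
  most one. Four slots are a quartic equation, hence the need for five dimensions of candidates. All
  losses are recorded as indices of subgroups bounded by powers of \<open>p\<close>, so that
  counting replaces bases and ranks. The density is exactly \<open>\<delta>^16\<close> because, with
  the first three directions fixed, the sum over the fourth is a complete character sum. Isotropy is
  asked of the 4-linear form and not of the polynomial: this serves all cosets at once and never
  divides by 4!, so that characteristics 2 and 3 are included.\<close>

primrec nsm :: "nat \<Rightarrow> 'a::ab_group_add \<Rightarrow> 'a" where
  "nsm 0 x = 0"
| "nsm (Suc n) x = x + nsm n x"

lemma nsm_add: "nsm (m + n) x = nsm m x + nsm n x"
  by (induction m) (auto simp: algebra_simps)

lemma nsm_mult: "nsm (m * n) x = nsm m (nsm n x)"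
  by (induction m) (auto simp: nsm_add)

lemma nsm_zero [simp]: "nsm n 0 = 0"
  by (induction n) auto

lemma nsm_mod_gen: assumes "nsm p x = 0" shows "nsm (k mod p) x = nsm k x"
proof -
  have "nsm k x = nsm (k div p * p + k mod p) x" by simp
  also have "\<dots> = nsm (k mod p) x" by (simp only: nsm_add nsm_mult assms) simp
  finally show ?thesis by simp
qed

lemma nsm_sum_left: "nsm (sum f A) x = (\<Sum>i\<in>A. nsm (f i) x)"
  by (induction A rule: infinite_finite_induct) (auto simp: nsm_add)

text \<open>Points with \<open>2 * E * f x < B\<close> contribute at most half of the guaranteed
  total \<open>B * card X / E\<close>, so the other points must carry the remaining half, each at
  most \<open>B\<close>.\<close>

lemma averaging:
  fixes f :: "'c \<Rightarrow> nat"
  assumes "finite X" "\<And>x. x \<in> X \<Longrightarrow> f x \<le> B" "B * card X \<le> E * sum f X" "B > 0"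
  shows "card X \<le> 2 * E * card {x \<in> X. B \<le> 2 * E * f x}"
proof -
  let ?G = "{x \<in> X. B \<le> 2 * E * f x}"
  have "2 * (B * card X) \<le> 2 * E * sum f X" using assms(3) by simp
  also have "\<dots> = (\<Sum>x\<in>X. 2 * E * f x)" by (simp add: sum_distrib_left)
  also have "\<dots> \<le> (\<Sum>x\<in>X. B + (if B \<le> 2 * E * f x then 2 * E * B else 0))"
  proof (rule sum_mono)
    fix x assume "x \<in> X"
    hence "f x \<le> B" using assms(2) by blast
    thus "2 * E * f x \<le> B + (if B \<le> 2 * E * f x then 2 * E * B else 0)"
      by (auto intro: trans_le_add2)
  qed
  also have "\<dots> = B * card X + (\<Sum>x\<in>X. if B \<le> 2 * E * f x then 2 * E * B else 0)"
    by (simp add: sum.distrib)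
  also have "(\<Sum>x\<in>X. if B \<le> 2 * E * f x then 2 * E * B else 0) = (\<Sum>x\<in>?G. 2 * E * B)"
    using assms(1) by (subst sum.inter_filter) auto
  also have "\<dots> = B * (2 * E * card ?G)" by simp
  finally have "B * card X \<le> B * (2 * E * card ?G)" by simp
  thus ?thesis using assms(4) by simp
qed

text \<open>In a group of exponent \<open>p\<close> the subspaces over the prime field are exactly
  the subgroups, with \<open>nsm\<close> as scalar multiplication, so \<open>p\<close> can stay a
  term. Negatives are \<open>nsm (p - 1)\<close>, which is why closure under addition suffices here
  and in \<open>sg\<close>.\<close>

locale pgroup =
  fixes p :: nat and V :: "'a::ab_group_add set"
  assumes prime_p: "prime p"
    and fin_V: "finite V"
    and zero_V: "0 \<in> V"
    and add_V: "\<And>x y. x \<in> V \<Longrightarrow> y \<in> V \<Longrightarrow> x + y \<in> V"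
    and exp_V: "\<And>x. x \<in> V \<Longrightarrow> nsm p x = 0"
begin

definition sg :: "'a set \<Rightarrow> bool" where
  "sg U \<longleftrightarrow> U \<subseteq> V \<and> 0 \<in> U \<and> (\<forall>x\<in>U. \<forall>y\<in>U. x + y \<in> U)"

lemma sg_V: "sg V"
  using zero_V add_V by (auto simp: sg_def)

lemma sg_subV: "sg U \<Longrightarrow> x \<in> U \<Longrightarrow> x \<in> V"
  by (auto simp: sg_def)

lemma sg_fin: "sg U \<Longrightarrow> finite U"
  using fin_V finite_subset by (auto simp: sg_def)

lemma sg_zero: "sg U \<Longrightarrow> 0 \<in> U"
  by (auto simp: sg_def)

lemma sg_card_pos: "sg U \<Longrightarrow> card U > 0"
  using sg_fin sg_zero card_gt_0_iff by fastforce

lemma sg_add: "sg U \<Longrightarrow> x \<in> U \<Longrightarrow> y \<in> U \<Longrightarrow> x + y \<in> U"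
  by (auto simp: sg_def)

lemma sg_nsm: "sg U \<Longrightarrow> x \<in> U \<Longrightarrow> nsm n x \<in> U"
  by (induction n) (auto simp: sg_def)

lemma p_pos: "p > 0" and p_gt1: "p > 1" and p_ge2: "p \<ge> 2"
  using prime_p prime_gt_0_nat prime_gt_1_nat prime_ge_2_nat by auto

lemma minus_eq_nsm: "x \<in> V \<Longrightarrow> - x = nsm (p - 1) x"
proof -
  assume "x \<in> V"
  hence "nsm (Suc (p - 1)) x = 0" using exp_V p_pos by simp
  thus ?thesis by (simp add: add_eq_0_iff2) (metis add.inverse_inverse add_eq_0_iff2)
qed

lemma sg_minus: "sg U \<Longrightarrow> x \<in> U \<Longrightarrow> - x \<in> U"
  by (metis sg_nsm sg_subV minus_eq_nsm)

lemma sg_diff: "sg U \<Longrightarrow> x \<in> U \<Longrightarrow> y \<in> U \<Longrightarrow> x - y \<in> U"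
  by (metis sg_add sg_minus diff_conv_add_uminus)

lemma sg_add_iff: "sg U \<Longrightarrow> x \<in> U \<Longrightarrow> x + y \<in> U \<longleftrightarrow> y \<in> U"
  by (metis sg_add sg_diff add_diff_cancel_left')

lemma sg_inter: "sg X \<Longrightarrow> sg Y \<Longrightarrow> sg (X \<inter> Y)"
  by (auto simp: sg_def)

lemma sg_zero_set: "sg {0}"
  using zero_V by (auto simp: sg_def)

lemma nsm_mod: "x \<in> V \<Longrightarrow> nsm (k mod p) x = nsm k x"
  by (rule nsm_mod_gen[OF exp_V])

lemma nsm_inverse:
  assumes "0 < c" "c < p"
  obtains d where "\<And>x. x \<in> V \<Longrightarrow> nsm d (nsm c x) = x"
proof -
  have "coprime c p" using assms prime_p
    by (metis coprime_commute nat_dvd_not_less prime_imp_coprime)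
  then obtain d where d: "[c * d = Suc 0] (mod p)"
    using cong_solve_coprime_nat by auto
  have "nsm d (nsm c x) = x" if x: "x \<in> V" for x
  proof -
    have "nsm d (nsm c x) = nsm ((c * d) mod p) x"
      by (simp only: nsm_mod x) (simp only: nsm_mult[symmetric] mult.commute)
    also have "(c * d) mod p = 1" using d p_gt1 by (simp add: cong_def)
    finally show ?thesis by simp
  qed
  thus ?thesis using that by blast
qed

lemma nsm_in_sg_iff:
  assumes "sg U" "x \<in> V" "0 < c" "c < p"
  shows "nsm c x \<in> U \<longleftrightarrow> x \<in> U"
  using nsm_inverse[OF assms(3,4)] assms(1,2) sg_nsm by metis

section \<open>Sums, intersections and indices of subgroups\<close>

definition ssum :: "'a set \<Rightarrow> 'a set \<Rightarrow> 'a set" where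
  "ssum X Y = {x + y | x y. x \<in> X \<and> y \<in> Y}"

lemma sg_ssum: assumes "sg X" "sg Y" shows "sg (ssum X Y)"
proof -
  have "x + y + (x' + y') \<in> ssum X Y" if "x \<in> X" "y \<in> Y" "x' \<in> X" "y' \<in> Y" for x y x' y'
  proof -
    have "x + y + (x' + y') = (x + x') + (y + y')" by (simp add: algebra_simps)
    moreover have "x + x' \<in> X" "y + y' \<in> Y" using that assms by (auto intro: sg_add)
    ultimately show ?thesis unfolding ssum_def by blast
  qed
  moreover have "0 \<in> ssum X Y" using assms[THEN sg_zero] by (force simp: ssum_def)
  ultimately show ?thesis using assms
    by (auto simp: sg_def ssum_def add_V subset_iff)
qed

text \<open>The dimension formula for sums. Each fibre of addition on \<open>X \<times> Y\<close> is
  a copy of \<open>X \<inter> Y\<close>, since a common vector \<open>t\<close> can be moved from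
  the second summand to the first.\<close>

lemma card_ssum:
  assumes X: "sg X" and Y: "sg Y"
  shows "card X * card Y = card (ssum X Y) * card (X \<inter> Y)"
proof -
  let ?f = "\<lambda>(x, y). x + y :: 'a"
  have fin: "finite (X \<times> Y)" using X Y sg_fin by auto
  have img: "?f ` (X \<times> Y) = ssum X Y" by (auto simp: ssum_def)
  have fib: "card {z \<in> X \<times> Y. ?f z = s} = card (X \<inter> Y)" if "s \<in> ssum X Y" for s
  proof -
    obtain x y where xy: "x \<in> X" "y \<in> Y" "s = x + y" using \<open>s \<in> ssum X Y\<close> by (auto simp: ssum_def)
    have "bij_betw (\<lambda>t. (x + t, y - t)) (X \<inter> Y) {z \<in> X \<times> Y. ?f z = s}"
    proof (rule bij_betw_byWitness[where f' = "\<lambda>z. fst z - x"])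
      show "\<forall>z\<in>{z \<in> X \<times> Y. ?f z = s}. (x + (fst z - x), y - (fst z - x)) = z"
        using xy by (auto simp: algebra_simps)
      show "(\<lambda>t. (x + t, y - t)) ` (X \<inter> Y) \<subseteq> {z \<in> X \<times> Y. ?f z = s}"
        using xy X Y sg_add sg_diff by auto
      show "(\<lambda>z. fst z - x) ` {z \<in> X \<times> Y. ?f z = s} \<subseteq> X \<inter> Y"
      proof
        fix t assume "t \<in> (\<lambda>z. fst z - x) ` {z \<in> X \<times> Y. ?f z = s}"
        then obtain a b where ab: "a \<in> X" "b \<in> Y" "a + b = s" "t = a - x" by auto
        hence "a - x \<in> X" "y - b \<in> Y" using xy X Y sg_diff by auto
        moreover have "a - x = y - b" using ab xy by (simp add: algebra_simps)
        ultimately show "t \<in> X \<inter> Y" using ab by auto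
      qed
    qed auto
    thus ?thesis by (simp add: bij_betw_same_card)
  qed
  have "card X * card Y = card (X \<times> Y)" by (simp add: card_cartesian_product)
  also have "\<dots> = (\<Sum>s\<in>?f ` (X \<times> Y). card {z \<in> X \<times> Y. ?f z = s})"
    using card_eq_sum sum.image_gen[OF fin, of "\<lambda>_. 1::nat" ?f] by (simp del: sum_constant add: card_eq_sum)
  also have "\<dots> = card (ssum X Y) * card (X \<inter> Y)" using fib img by simp
  finally show ?thesis .
qed

text \<open>Codimensions in \<open>U\<close> are subadditive under intersection; multiplied out, so
  that neither quotients nor logarithms appear.\<close>

lemma card_inter_ge:
  assumes "sg U" "sg X" "sg Y" "X \<subseteq> U" "Y \<subseteq> U"
  shows "card X * card Y \<le> card U * card (X \<inter> Y)"
proof -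
  have "ssum X Y \<subseteq> U" using assms by (auto simp: ssum_def intro!: sg_add)
  hence "card (ssum X Y) \<le> card U" using assms sg_fin card_mono by blast
  thus ?thesis using card_ssum[OF assms(2,3)] by simp
qed

definition adj :: "'a set \<Rightarrow> 'a \<Rightarrow> 'a set" where
  "adj U y = {u + nsm c y | u c. u \<in> U \<and> c < p}"

lemma adjI: "sg U \<Longrightarrow> y \<in> V \<Longrightarrow> u \<in> U \<Longrightarrow> u + nsm c y \<in> adj U y"
  unfolding adj_def using nsm_mod[of y c] p_pos by (smt (verit) mem_Collect_eq mod_less_divisor)

lemma sg_adj: assumes "sg U" "y \<in> V" shows "sg (adj U y)"
proof -
  have "u + nsm c y + (u' + nsm c' y) \<in> adj U y" if "u \<in> U" "u' \<in> U" for u u' c c'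
  proof -
    have "u + nsm c y + (u' + nsm c' y) = (u + u') + nsm (c + c') y"
      by (simp add: nsm_add algebra_simps)
    moreover have "u + u' \<in> U" using that assms by (auto intro: sg_add)
    ultimately show ?thesis using adjI[OF assms, of "u + u'" "c + c'"] by metis
  qed
  moreover have "0 \<in> adj U y" using adjI[OF assms, of 0 0] assms sg_zero by auto
  moreover have "adj U y \<subseteq> V" using assms sg_nsm[OF sg_V] by (auto simp: adj_def intro!: add_V intro: sg_subV[OF assms(1)])
  ultimately show ?thesis by (auto simp: sg_def) (auto simp: adj_def)
qed

lemma adj_sup: "sg U \<Longrightarrow> y \<in> V \<Longrightarrow> U \<subseteq> adj U y" and adj_mem: "sg U \<Longrightarrow> y \<in> V \<Longrightarrow> y \<in> adj U y"
  using adjI[of U y _ 0] adjI[of U y 0 1] sg_zero by auto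

lemma adj_least: "sg W \<Longrightarrow> U \<subseteq> W \<Longrightarrow> y \<in> W \<Longrightarrow> adj U y \<subseteq> W"
  by (auto simp: adj_def intro: sg_add sg_nsm)

lemma adj_inj:
  assumes "sg U" "y \<in> V" "y \<notin> U" "u \<in> U" "u' \<in> U" "c < p" "c' < p" "u + nsm c y = u' + nsm c' y"
  shows "u = u' \<and> c = c'"
proof -
  have *: "c' \<le> c" if "u \<in> U" "u' \<in> U" "c < p" "c' < p" "u + nsm c y = u' + nsm c' y" for u u' c c'
  proof (rule ccontr)
    assume "\<not> c' \<le> c"
    hence lt: "c < c'" by simp
    have "nsm c' y = nsm (c' - c) y + nsm c y" using lt by (metis nsm_add le_add_diff_inverse2 less_imp_le)
    hence "nsm (c' - c) y = u - u'" using that(5) by (simp add: algebra_simps)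
    hence "nsm (c' - c) y \<in> U" using that sg_diff[OF assms(1)] by simp
    hence "y \<in> U" using nsm_in_sg_iff[OF assms(1,2), of "c' - c"] lt that by auto
    thus False using assms by blast
  qed
  have "c = c'" using *[of u u' c c'] *[of u' u c' c] assms by simp
  thus ?thesis using assms(8) by simp
qed

lemma card_adj: assumes "sg U" "y \<in> V" "y \<notin> U" shows "card (adj U y) = p * card U"
proof -
  have "adj U y = (\<lambda>(u, c). u + nsm c y) ` (U \<times> {..<p})" by (auto simp: adj_def)
  moreover have "inj_on (\<lambda>(u, c). u + nsm c y) (U \<times> {..<p})"
    using adj_inj[OF assms] by (auto simp: inj_on_def)
  ultimately show ?thesis by (simp add: card_image card_cartesian_product)
qed

lemma card_adj_le: assumes "sg U" "y \<in> V" shows "card (adj U y) \<le> p * card U"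
proof -
  have "adj U y = (\<lambda>(u, c). u + nsm c y) ` (U \<times> {..<p})" by (auto simp: adj_def)
  thus ?thesis using card_image_le[of "U \<times> {..<p}"] sg_fin[OF assms(1)]
    by (simp add: card_cartesian_product mult.commute)
qed

section \<open>Maximal subgroups in place of bases\<close>

lemma exists_maximal_sg:
  assumes "sg U" "P U"
  obtains W where "sg W" "U \<subseteq> W" "P W" "\<And>W'. sg W' \<Longrightarrow> W \<subseteq> W' \<Longrightarrow> P W' \<Longrightarrow> W' = W"
proof -
  let ?F = "{W. sg W \<and> P W \<and> U \<subseteq> W}"
  have "finite ?F" using fin_V by (auto simp: sg_def intro!: finite_subset[of ?F "Pow V"])
  moreover have "U \<in> ?F" using assms by auto
  ultimately obtain W where W: "W \<in> ?F" "U \<subseteq> W" "\<forall>b\<in>?F. W \<subseteq> b \<longrightarrow> W = b"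
    using finite_has_maximal2[of ?F U] by metis
  show ?thesis
  proof (rule that[of W])
    fix W' assume "sg W'" "W \<subseteq> W'" "P W'"
    thus "W' = W" using W by blast
  qed (use W in auto)
qed

text \<open>This makes indices jump: an index above \<open>p ^ m\<close> is at least
  \<open>p ^ Suc m\<close>. A maximal subgroup of \<open>U\<close> of \<open>p\<close>-power order
  is \<open>U\<close> itself, as adjoining a missing vector multiplies the order by
  \<open>p\<close>.\<close>

lemma card_power: assumes "sg U" obtains k where "card U = p ^ k"
proof -
  have "sg {0}" by (rule sg_zero_set)
  obtain W where W: "sg W" "W \<subseteq> U \<and> (\<exists>k. card W = p ^ k)"
    "\<And>W'. sg W' \<Longrightarrow> W \<subseteq> W' \<Longrightarrow> W' \<subseteq> U \<and> (\<exists>k. card W' = p ^ k) \<Longrightarrow> W' = W"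
  proof (rule exists_maximal_sg[of "{0}" "\<lambda>W. W \<subseteq> U \<and> (\<exists>k. card W = p ^ k)"])
    show "{0} \<subseteq> U \<and> (\<exists>k. card {0::'a} = p ^ k)" using sg_zero[OF assms] by (auto intro: exI[of _ 0])
  qed (auto intro: sg_zero_set)
  have "W = U"
  proof (rule ccontr)
    assume "W \<noteq> U"
    then obtain y where y: "y \<in> U" "y \<notin> W" using W by blast
    have yV: "y \<in> V" using y assms sg_subV by blast
    obtain k where "card W = p ^ k" using W by blast
    hence "card (adj W y) = p ^ Suc k" using card_adj[OF W(1) yV y(2)] by simp
    hence "adj W y = W"
      using W(3)[of "adj W y"] sg_adj[OF W(1) yV] adj_sup[OF W(1) yV] adj_least[OF assms, of W y] W(2) y by blast
    thus False using adj_mem[OF W(1) yV] y by simp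
  qed
  thus ?thesis using W that by blast
qed

text \<open>Let \<open>W\<close> be maximal among the subgroups of \<open>U\<close> that avoid
  \<open>y\<close>. For \<open>u \<in> U - W\<close> the span of \<open>W\<close> and
  \<open>u\<close> contains \<open>y\<close>, and solving for \<open>u\<close> puts it into
  \<open>adj W y\<close>. The purpose is to keep a chosen vector out of the subspace from which
  later vectors are drawn.\<close>

lemma complement_vector:
  assumes "sg U" "y \<in> V" "y \<noteq> 0"
  obtains U' where "sg U'" "U' \<subseteq> U" "y \<notin> U'" "card U \<le> p * card U'"
proof -
  obtain W where W: "sg W" "W \<subseteq> U \<and> y \<notin> W"
    "\<And>W'. sg W' \<Longrightarrow> W \<subseteq> W' \<Longrightarrow> W' \<subseteq> U \<and> y \<notin> W' \<Longrightarrow> W' = W"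
  proof (rule exists_maximal_sg[of "{0}" "\<lambda>W. W \<subseteq> U \<and> y \<notin> W"])
    show "{0} \<subseteq> U \<and> y \<notin> {0}" using sg_zero[OF assms(1)] assms by auto
  qed (auto intro: sg_zero_set)
  have "U \<subseteq> adj W y"
  proof
    fix u assume u: "u \<in> U"
    show "u \<in> adj W y"
    proof (cases "u \<in> W")
      case True thus ?thesis using adj_sup[OF W(1) assms(2)] by blast
    next
      case False
      have uV: "u \<in> V" using u assms sg_subV by blast
      have "y \<in> adj W u"
        using W(3)[of "adj W u"] sg_adj[OF W(1) uV] adj_sup[OF W(1) uV] adj_least[OF assms(1), of W u] W(2) u
          adj_mem[OF W(1) uV] False by blast
      then obtain w c where wc: "w \<in> W" "c < p" "y = w + nsm c u" by (auto simp: adj_def)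
      have "c \<noteq> 0" using wc W(2) by (cases c) auto
      moreover have "nsm c u = - w + nsm 1 y" using wc by simp
      moreover have "- w + nsm 1 y \<in> adj W y" using adjI[OF W(1) assms(2)] sg_minus[OF W(1) wc(1)] by blast
      ultimately show ?thesis using nsm_in_sg_iff[OF sg_adj[OF W(1) assms(2)] uV, of c] wc by simp
    qed
  qed
  hence "card U \<le> p * card W" using card_adj_le[OF W(1) assms(2)] card_mono sg_fin sg_adj[OF W(1) assms(2)]
    by (metis order_trans)
  thus ?thesis using that W by blast
qed

lemma exists_complement:
  assumes "sg W"
  obtains C where "sg C" "C \<inter> W = {0}" "ssum C W = V"
proof -
  obtain C where C: "sg C" "C \<inter> W = {0}" "\<And>C'. sg C' \<Longrightarrow> C \<subseteq> C' \<Longrightarrow> C' \<inter> W = {0} \<Longrightarrow> C' = C"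
  proof (rule exists_maximal_sg[of "{0}" "\<lambda>C. C \<inter> W = {0}"])
    show "{0} \<inter> W = {0}" using sg_zero[OF assms(1)] by auto
  qed (auto intro: sg_zero_set)
  have "V \<subseteq> ssum C W"
  proof
    fix x assume x: "x \<in> V"
    show "x \<in> ssum C W"
    proof (cases "x \<in> C")
      case True thus ?thesis using sg_zero[OF assms] by (force simp: ssum_def)
    next
      case False
      hence "adj C x \<inter> W \<noteq> {0}" using C(3)[of "adj C x"] sg_adj[OF C(1) x] adj_sup[OF C(1) x] adj_mem[OF C(1) x] by blast
      then obtain w where w: "w \<in> adj C x" "w \<in> W" "w \<noteq> 0"
        using sg_zero[OF assms] sg_zero[OF sg_adj[OF C(1) x]] by blast
      then obtain c i where ci: "c \<in> C" "i < p" "w = c + nsm i x" by (auto simp: adj_def)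
      have "i \<noteq> 0" using ci w C(2) by (cases i) auto
      moreover have "nsm i x \<in> ssum C W"
      proof -
        have "nsm i x = - c + w" using ci by simp
        thus ?thesis using w sg_minus[OF C(1) ci(1)] unfolding ssum_def by blast
      qed
      ultimately show ?thesis using nsm_in_sg_iff[OF sg_ssum[OF C(1) assms] x, of i] ci by simp
    qed
  qed
  moreover have "ssum C W \<subseteq> V" using sg_ssum[OF C(1) assms] by (auto simp: sg_def)
  ultimately show ?thesis using that C by blast
qed

end

section \<open>Biased trilinear forms\<close>

text \<open>With \<open>F = 2 * E\<close>: a set of slices of density \<open>1 / F\<close> costs
  codimension \<open>F\<close>; sums of at most \<open>3 * F\<close> of them have rank at most
  \<open>m = F * (3 * F)\<close>, and bounded rank \<open>m\<close> costs
  \<open>m * m\<close>.\<close>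

definition tri_bound :: "nat \<Rightarrow> nat" where
  "tri_bound E = 2 * E + (12 * E * E) * (12 * E * E)"

text \<open>Averaging over the first slot doubles \<open>E\<close>; the extra 1 excludes the chosen
  vector itself.\<close>

definition step_bound :: "nat \<Rightarrow> nat" where
  "step_bound E = tri_bound (2 * E) + 1"

text \<open>\<open>2 * E\<close> blocks of \<open>4 * E\<close> vectors each; then
  \<open>8 * E\<close> for two radicals of density \<open>1 / (4 * E)\<close>, and 1 for the linear
  condition with three equal arguments.\<close>

definition self_bound :: "nat \<Rightarrow> nat" where
  "self_bound E = 2 * E * (4 * E * step_bound E) + (8 * E + 1)"

context pgroup
begin

text \<open>Turns a density \<open>1 / n\<close> into a codimension \<open>n\<close>. Such a
  generous exchange is affordable because the final bound need only be polynomial in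
  \<open>1 / \<delta>\<close>.\<close>

lemma nat_le_p_power: "n \<le> p ^ n"
proof -
  have "n \<le> 2 ^ n" using less_exp[of n] by simp
  also have "\<dots> \<le> p ^ n" using p_ge2 by (rule power_mono) simp
  finally show ?thesis .
qed

section \<open>Additive maps and iterated sumsets\<close>

definition addv :: "('a \<Rightarrow> 'b::ab_group_add) \<Rightarrow> bool" where
  "addv f \<longleftrightarrow> (\<forall>x\<in>V. \<forall>y\<in>V. f (x + y) = f x + f y)"

lemma addv_0: "addv f \<Longrightarrow> f 0 = 0"
  unfolding addv_def using zero_V by (metis add_cancel_right_right)

lemma addv_nsm: "addv f \<Longrightarrow> x \<in> V \<Longrightarrow> f (nsm n x) = nsm n (f x)"
  by (induction n) (auto simp: addv_0, simp add: addv_def sg_nsm sg_V)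

lemma addv_minus: "addv f \<Longrightarrow> x \<in> V \<Longrightarrow> f (- x) = - f x"
  using sg_minus[OF sg_V, of x] addv_0[of f] unfolding addv_def
  by (metis add.right_inverse add_eq_0_iff)

lemma addv_diff: "addv f \<Longrightarrow> x \<in> V \<Longrightarrow> y \<in> V \<Longrightarrow> f (x - y) = f x - f y"
  using addv_minus[of f y] sg_minus[OF sg_V, of y] unfolding addv_def
  by (metis diff_conv_add_uminus)

lemma sg_zeros:
  assumes "sg U" "\<And>d. d \<in> D \<Longrightarrow> addv (f d)"
  shows "sg {x \<in> U. \<forall>d\<in>D. f d x = 0}"
  using assms addv_0[OF assms(2)] sg_subV[OF assms(1)]
  by (auto simp: sg_def addv_def)

primrec sumn :: "'a set \<Rightarrow> nat \<Rightarrow> 'a set" where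
  "sumn A 0 = {0}"
| "sumn A (Suc k) = ssum (sumn A k) A"

lemma sumn_subset: "sg U \<Longrightarrow> A \<subseteq> U \<Longrightarrow> sumn A k \<subseteq> U"
  by (induction k) (auto simp: ssum_def sg_zero intro!: sg_add)

lemma sumn_mono: "0 \<in> A \<Longrightarrow> sumn A k \<subseteq> sumn A (Suc k)"
  unfolding sumn.simps(2) ssum_def by force

lemma sumn_mono_le: "0 \<in> A \<Longrightarrow> i \<le> j \<Longrightarrow> sumn A i \<subseteq> sumn A j"
  using lift_Suc_mono_le[of "sumn A"] sumn_mono by blast

text \<open>As long as the sumsets grow, every third step adds a translate of \<open>A\<close> disjoint from the
  earlier sums.\<close>

lemma sumn_stable:
  assumes U: "sg U" and A: "A \<subseteq> U" "0 \<in> A" "\<And>a. a \<in> A \<Longrightarrow> - a \<in> A"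
    and big: "card U \<le> F * card A"
  obtains k where "k \<le> 3 * F" "sumn A (Suc k) = sumn A k"
proof -
  have finA: "finite A" using A U sg_fin finite_subset by blast
  have fins: "finite (sumn A k)" for k using sumn_subset[OF U A(1)] sg_fin[OF U] finite_subset by blast
  have *: "(\<exists>k<3 * j. sumn A (Suc k) = sumn A k) \<or> (j + 1) * card A \<le> card (sumn A (3 * j + 1))" for j
  proof (induction j)
    case 0
    have "ssum {0} A = A" by (auto simp: ssum_def)
    thus ?case by simp
  next
    case (Suc j)
    show ?case
    proof (cases "\<exists>k<3 * Suc j. sumn A (Suc k) = sumn A k")
      case False
      moreover have "3 * j + 2 < 3 * Suc j" by simp
      ultimately have "sumn A (Suc (3 * j + 2)) \<noteq> sumn A (3 * j + 2)" by blast
      then obtain x where x: "x \<in> sumn A (Suc (3 * j + 2))" "x \<notin> sumn A (3 * j + 2)"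
        using sumn_mono[OF A(2)] by blast
      \<comment> \<open>\<open>x\<close> is not a sum of \<open>3 * j + 2\<close> terms, so
        \<open>x + a\<close> is not a sum of \<open>3 * j + 1\<close> terms: subtracting
        \<open>a\<close> costs only one more term, as \<open>A\<close> is symmetric.\<close>
      have disj: "(+) x ` A \<inter> sumn A (3 * j + 1) = {}"
      proof (rule ccontr)
        assume "(+) x ` A \<inter> sumn A (3 * j + 1) \<noteq> {}"
        then obtain a where a: "a \<in> A" "x + a \<in> sumn A (3 * j + 1)" by auto
        have "x = (x + a) + - a" by simp
        hence "x \<in> ssum (sumn A (3 * j + 1)) A" using a A(3) unfolding ssum_def by blast
        hence "x \<in> sumn A (3 * j + 2)" by (simp add: numeral_2_eq_2)
        thus False using x by blast
      qed
      have "(+) x ` A \<subseteq> sumn A (Suc (Suc (3 * j + 2)))"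
        unfolding sumn.simps(2)[of A "Suc (3 * j + 2)"] using x(1) unfolding ssum_def by blast
      moreover have "sumn A (3 * j + 1) \<subseteq> sumn A (Suc (Suc (3 * j + 2)))"
        using sumn_mono_le[OF A(2), of "3 * j + 1" "Suc (Suc (3 * j + 2))"] by linarith
      ultimately have "card ((+) x ` A \<union> sumn A (3 * j + 1)) \<le> card (sumn A (Suc (Suc (3 * j + 2))))"
        using fins card_mono by (metis Un_least)
      also have "card ((+) x ` A \<union> sumn A (3 * j + 1)) = card A + card (sumn A (3 * j + 1))"
        using disj fins finA by (subst card_Un_disjoint) (auto simp: card_image simp del: sumn.simps)
      finally have "card A + card (sumn A (3 * j + 1)) \<le> card (sumn A (3 * Suc j + 1))"
        by (simp add: eval_nat_numeral)
      moreover have "(j + 1) * card A \<le> card (sumn A (3 * j + 1))" using Suc False by auto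
      ultimately show ?thesis by simp
    qed auto
  qed
  have "card (sumn A (3 * F + 1)) \<le> card U" using sumn_subset[OF U A(1)] sg_fin[OF U] card_mono by blast
  moreover have "card A > 0" using finA A(2) card_gt_0_iff by blast
  ultimately have "\<not> (F + 1) * card A \<le> card (sumn A (3 * F + 1))" using big by simp
  thus ?thesis using *[of F] that less_imp_le by blast
qed

text \<open>Once one more summand from \<open>A\<close> adds nothing, further ones add nothing
  either, so the stable sumset absorbs itself.\<close>

lemma sumn_stable_sg:
  assumes "A \<subseteq> V" "0 \<in> A" "sumn A (Suc k) = sumn A k"
  shows "sg (sumn A k)"
proof -
  have "x + y \<in> sumn A k" if "x \<in> sumn A k" "y \<in> sumn A j" for x y j
    using that(2)
  proof (induction j arbitrary: y)
    case (Suc j)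
    then obtain y' a where y: "y' \<in> sumn A j" "a \<in> A" "y = y' + a" by (auto simp: ssum_def)
    have "(x + y') + a \<in> ssum (sumn A k) A" using Suc.IH[OF y(1)] y(2) unfolding ssum_def by blast
    thus ?case using assms(3) y(3) by (simp add: add.assoc)
  qed (use that(1) in simp)
  moreover have "0 \<in> sumn A k"
    using sumn_mono_le[OF assms(2), of 0 k] by simp
  ultimately show ?thesis using sumn_subset[OF sg_V assms(1)] unfolding sg_def by blast
qed

end

locale trilinear = pgroup +
  fixes S :: "'a \<Rightarrow> 'a \<Rightarrow> 'a \<Rightarrow> 'b::ab_group_add"
  assumes S_add: "\<And>x y u v. \<lbrakk>x \<in> V; y \<in> V; u \<in> V; v \<in> V\<rbrakk> \<Longrightarrow> S (x + y) u v = S x u v + S y u v"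
    and S_12: "\<And>x y z. \<lbrakk>x \<in> V; y \<in> V; z \<in> V\<rbrakk> \<Longrightarrow> S x y z = S y x z"
    and S_23: "\<And>x y z. \<lbrakk>x \<in> V; y \<in> V; z \<in> V\<rbrakk> \<Longrightarrow> S x y z = S x z y"
begin

section \<open>Radicals of the slices of a trilinear form\<close>

lemma S_addv1: "u \<in> V \<Longrightarrow> v \<in> V \<Longrightarrow> addv (\<lambda>x. S x u v)"
  by (auto simp: addv_def S_add)

lemma S_addv2: "x \<in> V \<Longrightarrow> v \<in> V \<Longrightarrow> addv (\<lambda>u. S x u v)"
  unfolding addv_def by (metis S_12 S_add add_V)

definition ker :: "'a \<Rightarrow> 'a set \<Rightarrow> 'a set" where
  "ker x U = {u \<in> U. \<forall>v\<in>U. S x u v = 0}"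

lemma sg_ker: "x \<in> V \<Longrightarrow> sg U \<Longrightarrow> sg (ker x U)"
  unfolding ker_def by (rule sg_zeros[where f = "\<lambda>v u. S x u v"]) (auto intro: S_addv2 sg_subV)

lemma ker_subset: "ker x U \<subseteq> U"
  by (auto simp: ker_def)

text \<open>Ranks are encoded by the index of the radical: \<open>q\<close> is \<open>p\<close> to the power of the maximal rank,
  which \<open>S x\<close> is assumed to attain already on \<open>K\<close>.\<close>

lemma full_rank_on_subspace:
  assumes U: "sg U" and K: "sg K" "K \<subseteq> U" and x: "x \<in> U"
    and le: "card U \<le> q * card (ker x U)" and ge: "q * card (ker x K) \<le> card K"
  shows "ssum K (ker x U) = U" "ker x K = K \<inter> ker x U"
proof -
  have xV: "x \<in> V" using x U sg_subV by blast
  let ?L = "ker x U"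
  have L: "sg ?L" using sg_ker xV U by blast
  have sub: "K \<inter> ?L \<subseteq> ker x K" using K by (auto simp: ker_def)
  have sub2: "ssum K ?L \<subseteq> U" using K U ker_subset by (auto simp: ssum_def intro!: sg_add)
  have finK: "finite (ker x K)" using sg_fin[OF sg_ker[OF xV K(1)]] .
  have c1: "card (K \<inter> ?L) \<le> card (ker x K)" using sub finK card_mono by blast
  have c2: "card (ssum K ?L) \<le> card U" using sub2 sg_fin[OF U] card_mono by blast
  have pos: "card U > 0" "card ?L > 0" "card (ker x K) > 0" "card (K \<inter> ?L) > 0"
    using sg_card_pos U L sg_ker[OF xV K(1)] sg_inter[OF K(1) L] by auto
  \<comment> \<open>The rank on \<open>K\<close> is not below the maximal rank on \<open>U\<close>.
    This leaves no slack in \<open>c1\<close> and \<open>c2\<close>, so both inclusions are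
    equalities.\<close>
  have "card U * card (ker x K) \<le> q * card ?L * card (ker x K)" using le by (rule mult_right_mono) simp
  also have "\<dots> = (q * card (ker x K)) * card ?L" by simp
  also have "\<dots> \<le> card K * card ?L" using ge by (rule mult_right_mono) simp
  also have "\<dots> = card (ssum K ?L) * card (K \<inter> ?L)" by (rule card_ssum[OF K(1) L])
  finally have main: "card U * card (ker x K) \<le> card (ssum K ?L) * card (K \<inter> ?L)" .
  have "card (ssum K ?L) * card (K \<inter> ?L) \<le> card (ssum K ?L) * card (ker x K)" using c1 by simp
  hence "card U * card (ker x K) \<le> card (ssum K ?L) * card (ker x K)" using main by linarith
  hence "card U \<le> card (ssum K ?L)" using pos by simp
  thus "ssum K ?L = U" using sub2 sg_fin[OF U] card_seteq by blast
  have "card (ssum K ?L) * card (K \<inter> ?L) \<le> card U * card (K \<inter> ?L)" using c2 by simp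
  hence "card U * card (ker x K) \<le> card U * card (K \<inter> ?L)" using main by linarith
  hence "card (ker x K) \<le> card (K \<inter> ?L)" using pos by simp
  thus "ker x K = K \<inter> ?L" using sub finK card_seteq by metis
qed

text \<open>If \<open>S x0\<close> has the maximal rank, then the ranks on its radical are strictly smaller: otherwise
  both \<open>S x\<close> and \<open>S (x + x0)\<close> attain the maximal rank on the radical, which forces \<open>S x0 = 0\<close>.\<close>

lemma bounded_rank_imp_vanishes:
  assumes "sg U" "\<And>x. x \<in> U \<Longrightarrow> card U \<le> p ^ m * card (ker x U)"
  shows "\<exists>U'. sg U' \<and> U' \<subseteq> U \<and> (\<forall>x\<in>U'. \<forall>y\<in>U'. \<forall>z\<in>U'. S x y z = 0) \<and> card U \<le> p ^ (m * m) * card U'"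
  using assms
proof (induction m arbitrary: U)
  case 0
  have "ker x U = U" if "x \<in> U" for x
    using 0(2)[OF that] ker_subset sg_fin[OF 0(1)] card_seteq by (metis mult_1 power_0)
  hence "\<forall>x\<in>U. \<forall>y\<in>U. \<forall>z\<in>U. S x y z = 0" unfolding ker_def by blast
  thus ?case using 0(1) by auto
next
  case (Suc m U)
  note U = Suc.prems(1)
  show ?case
  proof (cases "\<forall>x\<in>U. card U \<le> p ^ m * card (ker x U)")
    case True
    then obtain U' where "sg U'" "U' \<subseteq> U" "\<forall>x\<in>U'. \<forall>y\<in>U'. \<forall>z\<in>U'. S x y z = 0"
      "card U \<le> p ^ (m * m) * card U'" using Suc.IH[OF U] by blast
    moreover have "p ^ (m * m) * card U' \<le> p ^ (Suc m * Suc m) * card U'"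
      using p_pos by (intro mult_right_mono power_increasing) auto
    ultimately show ?thesis by (metis order_trans)
  next
    case False
    then obtain x0 where x0: "x0 \<in> U" "p ^ m * card (ker x0 U) < card U" by auto
    have x0V: "x0 \<in> V" using x0 U sg_subV by blast
    define K where "K = ker x0 U"
    have K: "sg K" "K \<subseteq> U" unfolding K_def using sg_ker[OF x0V U] ker_subset by auto
    have "card K \<le> p ^ m * card (ker x K)" if x: "x \<in> K" for x
    proof (rule ccontr)
      assume neg: "\<not> ?thesis"
      have xU: "x \<in> U" using x K by blast
      have xV: "x \<in> V" using xU U sg_subV by blast
      \<comment> \<open>\<open>S x0\<close> vanishes on its radical \<open>K\<close>, so
        \<open>x\<close> and \<open>x + x0\<close> induce the same form there and both attain the
        maximal rank.\<close>
      have ker_eq: "ker (x + x0) K = ker x K"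
      proof -
        have "S (x + x0) u v = S x u v" if "u \<in> K" "v \<in> K" for u v
        proof -
          have "S x0 u v = 0" using that K(2) by (auto simp: K_def ker_def)
          moreover have "u \<in> V" "v \<in> V" using that K sg_subV by blast+
          ultimately show ?thesis using S_add xV x0V by simp
        qed
        thus ?thesis by (auto simp: ker_def)
      qed
      obtain k where k: "card K = p ^ k" using card_power[OF K(1)] .
      obtain l where l: "card (ker x K) = p ^ l" using card_power[OF sg_ker[OF xV K(1)]] .
      have "p ^ (m + l) < p ^ k" using neg k l by (simp add: power_add)
      hence "m + l < k" using p_gt1 power_less_imp_less_exp by blast
      hence "p ^ (Suc m + l) \<le> p ^ k" using p_pos by (intro power_increasing) auto
      hence ge: "p ^ Suc m * card (ker x K) \<le> card K" using k l by (simp add: power_add)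
      have ge': "p ^ Suc m * card (ker (x + x0) K) \<le> card K" using ge ker_eq by simp
      have xx0: "x + x0 \<in> U" using xU x0 U sg_add by blast
      have xx0V: "x + x0 \<in> V" using xx0 U sg_subV by blast
      note r = full_rank_on_subspace[OF U K xU Suc.prems(2)[OF xU] ge]
      note r' = full_rank_on_subspace[OF U K xx0 Suc.prems(2)[OF xx0] ge']
      \<comment> \<open>Decompose \<open>u\<close> along \<open>K\<close> plus the radical of
        \<open>S x\<close>, and along \<open>K\<close> plus the radical of
        \<open>S (x + x0)\<close>. The two \<open>K\<close>-parts differ by an element of
        \<open>ker x K\<close>, which lies in \<open>ker x U\<close>. So \<open>l'\<close> is in
        both radicals and \<open>S x0 l'\<close> vanishes, while \<open>S x0 k'\<close> vanishes
        because \<open>k' \<in> K\<close>.\<close>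
      have S0: "S x0 u v = 0" if u: "u \<in> U" and v: "v \<in> U" for u v
      proof -
        obtain k l where kl: "k \<in> K" "l \<in> ker x U" "u = k + l" using r(1) u unfolding ssum_def by blast
        obtain k' l' where kl': "k' \<in> K" "l' \<in> ker (x + x0) U" "u = k' + l'"
          using r'(1) u unfolding ssum_def by blast
        have lU: "l \<in> U" "l' \<in> U" using kl kl' ker_subset by blast+
        have KV: "\<And>t. t \<in> K \<Longrightarrow> t \<in> V" and UV: "\<And>t. t \<in> U \<Longrightarrow> t \<in> V"
          using K U sg_subV by blast+
        have dec: "S x l' w = S (x + x0) l' w - S x0 l' w" if "w \<in> U" for w
          using S_add[of x x0 l' w] xV x0V UV lU that by simp
        have kk: "k - k' = l' - l" using kl kl' by (simp add: algebra_simps)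
        have "S x (k - k') w = 0" if w: "w \<in> K" for w
        proof -
          have wU: "w \<in> U" using w K by blast
          have "S x0 l' w = S x0 w l'" using S_23 x0V UV lU wU by blast
          also have "\<dots> = 0" using w lU by (auto simp: K_def ker_def)
          finally have "S x l' w = 0" using dec[OF wU] kl'(2) wU by (auto simp: ker_def)
          moreover have "S x l w = 0" using kl(2) wU by (auto simp: ker_def)
          ultimately show ?thesis
            unfolding kk using addv_diff[OF S_addv2[OF xV UV[OF wU]]] UV lU by simp
        qed
        moreover have "k - k' \<in> K" using kl kl' K sg_diff by blast
        ultimately have "k - k' \<in> ker x K" by (auto simp: ker_def)
        hence "k - k' \<in> ker x U" using r(2) by blast
        hence "l' - l \<in> ker x U" using kk by simp
        hence "l' - l + l \<in> ker x U" using kl(2) sg_add[OF sg_ker[OF xV U]] by blast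
        hence "S x l' v = 0" using v by (auto simp: ker_def)
        moreover have "S (x + x0) l' v = 0" using kl'(2) v by (auto simp: ker_def)
        ultimately have "S x0 l' v = 0" using dec[OF v] by simp
        moreover have "S x0 k' v = 0" using kl'(1) v by (auto simp: K_def ker_def)
        moreover have "S x0 u v = S x0 k' v + S x0 l' v"
          using S_addv2[OF x0V UV[OF v]] KV[OF kl'(1)] UV[OF lU(2)] kl'(3) by (simp add: addv_def)
        ultimately show ?thesis by simp
      qed
      hence "ker x0 U = U" by (auto simp: ker_def)
      hence "p ^ m * card U < card U" using x0 by simp
      thus False using p_pos by (simp add: mult_less_cancel2)
    qed
    then obtain U' where U': "sg U'" "U' \<subseteq> K" "\<forall>x\<in>U'. \<forall>y\<in>U'. \<forall>z\<in>U'. S x y z = 0"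
      "card K \<le> p ^ (m * m) * card U'" using Suc.IH[OF K(1)] by blast
    have "card U \<le> p ^ Suc m * card K" using Suc.prems(2)[OF x0(1)] by (simp add: K_def)
    also have "\<dots> \<le> p ^ Suc m * (p ^ (m * m) * card U')" using U'(4) by simp
    also have "\<dots> = p ^ (Suc m + m * m) * card U'" by (simp add: power_add)
    also have "\<dots> \<le> p ^ (Suc m * Suc m) * card U'"
      using p_pos by (intro mult_right_mono power_increasing) auto
    finally show ?thesis using U' K by blast
  qed
qed

text \<open>The vectors whose slice has a radical of density at least \<open>1 / (2 * E)\<close>
  form a dense symmetric set \<open>A\<close> containing 0. Density makes the sumsets of
  \<open>A\<close> stabilise after boundedly many steps, and since rank is subadditive, every slice
  in the resulting subgroup still has bounded rank.\<close>

theorem biased_trilinear_vanishes: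
  assumes U: "sg U" and E: "card U * card U \<le> E * (\<Sum>b\<in>U. card (ker b U))"
  shows "\<exists>U'. sg U' \<and> U' \<subseteq> U \<and> (\<forall>x\<in>U'. \<forall>y\<in>U'. \<forall>z\<in>U'. S x y z = 0) \<and> card U \<le> p ^ tri_bound E * card U'"
proof -
  define F where "F = 2 * E"
  define A where "A = {b \<in> U. card U \<le> F * card (ker b U)}"
  have UV: "\<And>t. t \<in> U \<Longrightarrow> t \<in> V" using U sg_subV by blast
  have cU: "card U > 0" using sg_card_pos U by blast
  have "card U \<le> F * card A"
    unfolding F_def A_def using E sg_fin[OF U] ker_subset cU
    by (intro averaging) (auto intro: card_mono)
  hence E0: "E > 0" using cU by (auto simp: F_def intro: Nat.gr0I)
  have AU: "A \<subseteq> U" by (auto simp: A_def)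
  have "ker 0 U = U" using addv_0[OF S_addv1] UV by (auto simp: ker_def)
  hence A0: "0 \<in> A" using sg_zero[OF U] E0 by (auto simp: A_def F_def)
  have Am: "- a \<in> A" if "a \<in> A" for a
  proof -
    have "ker (- a) U = ker a U"
      using that addv_minus[OF S_addv1, of _ _ a] UV by (auto simp: ker_def A_def)
    thus ?thesis using that sg_minus[OF U] by (auto simp: A_def)
  qed
  obtain k where k: "k \<le> 3 * F" "sumn A (Suc k) = sumn A k"
    using sumn_stable[OF U AU A0 Am \<open>card U \<le> F * card A\<close>] .
  define W where "W = sumn A k"
  have W: "sg W" "W \<subseteq> U" using sumn_stable_sg[of A k] AU UV A0 k(2) sumn_subset[OF U AU]
    unfolding W_def by blast+
  \<comment> \<open>Subadditivity of rank: the radical of a sum contains the intersection of the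
    radicals.\<close>
  have rank: "card U \<le> F ^ j * card (ker x U)" if "x \<in> sumn A j" for x j
    using that
  proof (induction j arbitrary: x)
    case 0
    thus ?case using \<open>ker 0 U = U\<close> by simp
  next
    case (Suc j)
    then obtain y a where ya: "y \<in> sumn A j" "a \<in> A" "x = y + a" by (auto simp: ssum_def)
    have yV: "y \<in> V" "a \<in> V" using ya sumn_subset[OF U AU] AU UV by blast+
    have "ker y U \<inter> ker a U \<subseteq> ker x U" using S_add yV UV ya by (auto simp: ker_def)
    hence c: "card (ker y U \<inter> ker a U) \<le> card (ker x U)"
      using sg_fin[OF sg_ker[OF _ U]] add_V yV ya card_mono by blast
    have "card U * card U \<le> (F ^ j * card (ker y U)) * (F * card (ker a U))"
      using Suc.IH[OF ya(1)] ya(2) by (intro mult_mono) (auto simp: A_def)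
    also have "\<dots> = F ^ Suc j * (card (ker y U) * card (ker a U))" by simp
    also have "\<dots> \<le> F ^ Suc j * (card U * card (ker y U \<inter> ker a U))"
      using card_inter_ge[OF U sg_ker[OF yV(1) U] sg_ker[OF yV(2) U] ker_subset ker_subset]
      by (rule mult_left_mono) simp
    also have "\<dots> \<le> F ^ Suc j * (card U * card (ker x U))" using c by (intro mult_left_mono) auto
    finally have "card U * card U \<le> card U * (F ^ Suc j * card (ker x U))" by (simp add: mult_ac)
    thus ?case using cU by simp
  qed
  \<comment> \<open>Restricting a slice from \<open>U\<close> to \<open>W\<close> does not increase
    its rank.\<close>
  have "card W \<le> p ^ (F * (3 * F)) * card (ker x W)" if x: "x \<in> W" for x
  proof -
    have xV: "x \<in> V" using x W UV by blast
    have c1: "card (ker x U \<inter> W) \<le> card (ker x W)"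
      using sg_fin[OF sg_ker[OF xV W(1)]] W by (intro card_mono) (auto simp: ker_def)
    have "card U * card W \<le> (F ^ k * card (ker x U)) * card W"
      using rank[of x k] x by (intro mult_right_mono) (auto simp: W_def)
    also have "\<dots> \<le> F ^ k * (card U * card (ker x U \<inter> W))"
      using card_inter_ge[OF U sg_ker[OF xV U] W(1) ker_subset W(2)] by simp
    also have "\<dots> \<le> F ^ k * (card U * card (ker x W))" using c1 by (intro mult_left_mono) auto
    finally have "card U * card W \<le> card U * (F ^ k * card (ker x W))" by (simp add: mult_ac)
    hence "card W \<le> F ^ k * card (ker x W)" using cU by simp
    moreover have "F ^ k \<le> p ^ (F * (3 * F))"
    proof -
      have "F ^ k \<le> F ^ (3 * F)" using k E0 by (intro power_increasing) (auto simp: F_def)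
      also have "\<dots> \<le> (p ^ F) ^ (3 * F)" using nat_le_p_power by (intro power_mono) auto
      finally show ?thesis by (simp add: power_mult)
    qed
    ultimately show ?thesis by (meson le_trans mult_le_mono1)
  qed
  then obtain U' where U': "sg U'" "U' \<subseteq> W" "\<forall>x\<in>U'. \<forall>y\<in>U'. \<forall>z\<in>U'. S x y z = 0"
      "card W \<le> p ^ ((F * (3 * F)) * (F * (3 * F))) * card U'" using bounded_rank_imp_vanishes[OF W(1)] by blast
  have "A \<subseteq> W"
  proof
    fix a assume "a \<in> A"
    moreover have "0 \<in> W" using W sg_zero by blast
    ultimately have "0 + a \<in> ssum (sumn A k) A" unfolding W_def ssum_def by blast
    thus "a \<in> W" using k(2) by (simp add: W_def)
  qed
  hence "card A \<le> card W" using card_mono sg_fin W by blast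
  hence "card U \<le> F * card W" using \<open>card U \<le> F * card A\<close> by (meson le_trans mult_le_mono2)
  also have "\<dots> \<le> p ^ F * (p ^ ((F * (3 * F)) * (F * (3 * F))) * card U')"
    using U'(4) nat_le_p_power by (intro mult_mono) auto
  also have "\<dots> = p ^ tri_bound E * card U'"
    by (simp add: power_add tri_bound_def F_def algebra_simps)
  finally show ?thesis using U' W by blast
qed

end

section \<open>Biased 4-linear forms\<close>

text \<open>The values lie in the cyclic group generated by \<open>g\<close>. Hence an additive map
  such as \<open>\<lambda>u. T v v v u\<close> has a kernel of index at most \<open>p\<close>, and
  \<open>T v v v v\<close> has coefficients modulo \<open>p\<close>, as the Chevalley-Warning
  theorem requires.\<close>

locale quadrilinear = pgroup +
  fixes T :: "'a \<Rightarrow> 'a \<Rightarrow> 'a \<Rightarrow> 'a \<Rightarrow> 'b::ab_group_add" and g :: 'b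
  assumes T_add1: "\<And>x y b c d. \<lbrakk>x \<in> V; y \<in> V; b \<in> V; c \<in> V; d \<in> V\<rbrakk> \<Longrightarrow> T (x + y) b c d = T x b c d + T y b c d"
    and T_12: "\<And>a b c d. \<lbrakk>a \<in> V; b \<in> V; c \<in> V; d \<in> V\<rbrakk> \<Longrightarrow> T a b c d = T b a c d"
    and T_23: "\<And>a b c d. \<lbrakk>a \<in> V; b \<in> V; c \<in> V; d \<in> V\<rbrakk> \<Longrightarrow> T a b c d = T a c b d"
    and T_34: "\<And>a b c d. \<lbrakk>a \<in> V; b \<in> V; c \<in> V; d \<in> V\<rbrakk> \<Longrightarrow> T a b c d = T a b d c"
    and exp_g: "nsm p g = 0"
    and T_range: "\<And>a b c d. \<lbrakk>a \<in> V; b \<in> V; c \<in> V; d \<in> V\<rbrakk> \<Longrightarrow> \<exists>k. T a b c d = nsm k g"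
begin

lemma T_add2: "\<lbrakk>x \<in> V; y \<in> V; a \<in> V; c \<in> V; d \<in> V\<rbrakk> \<Longrightarrow> T a (x + y) c d = T a x c d + T a y c d"
  using T_add1[of x y a c d] T_12[of a x c d] T_12[of a y c d] T_12[of a "x + y" c d] by (simp add: add_V)

lemma T_add3: "\<lbrakk>x \<in> V; y \<in> V; a \<in> V; b \<in> V; d \<in> V\<rbrakk> \<Longrightarrow> T a b (x + y) d = T a b x d + T a b y d"
  using T_add2[of x y a b d] T_23[of a b x d] T_23[of a b y d] T_23[of a b "x + y" d] by (simp add: add_V)

lemma T_add4: "\<lbrakk>x \<in> V; y \<in> V; a \<in> V; b \<in> V; c \<in> V\<rbrakk> \<Longrightarrow> T a b c (x + y) = T a b c x + T a b c y"
  using T_add3[of x y a b c] T_34[of a b c x] T_34[of a b c y] T_34[of a b c "x + y"] by (simp add: add_V)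

lemma T_addv1: "\<lbrakk>b \<in> V; c \<in> V; d \<in> V\<rbrakk> \<Longrightarrow> addv (\<lambda>a. T a b c d)"
  and T_addv2: "\<lbrakk>a \<in> V; c \<in> V; d \<in> V\<rbrakk> \<Longrightarrow> addv (\<lambda>b. T a b c d)"
  and T_addv3: "\<lbrakk>a \<in> V; b \<in> V; d \<in> V\<rbrakk> \<Longrightarrow> addv (\<lambda>c. T a b c d)"
  and T_addv4: "\<lbrakk>a \<in> V; b \<in> V; c \<in> V\<rbrakk> \<Longrightarrow> addv (\<lambda>d. T a b c d)"
  by (auto simp: addv_def T_add1 T_add2 T_add3 T_add4)

lemma trilinear_T: "y \<in> V \<Longrightarrow> trilinear p V (T y)"
  by unfold_locales (auto simp: T_add2 intro: T_23 T_34)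

section \<open>Bias on products of subgroups\<close>

definition zT :: "'a set \<Rightarrow> 'a \<Rightarrow> 'a \<Rightarrow> 'a \<Rightarrow> nat" where
  "zT D a b c = (if \<forall>d\<in>D. T a b c d = 0 then 1 else 0)"

abbreviation zeros :: "'a set \<Rightarrow> 'a set \<Rightarrow> 'a set \<Rightarrow> 'a set \<Rightarrow> nat" where
  "zeros A B C D \<equiv> \<Sum>a\<in>A. \<Sum>b\<in>B. \<Sum>c\<in>C. zT D a b c"

text \<open>There are four separate sets because they are shrunk one at a time and later take
  different values. The fourth slot enters as a universal condition, which is what remains after
  summing a character over it.\<close>

definition biased :: "nat \<Rightarrow> 'a set \<Rightarrow> 'a set \<Rightarrow> 'a set \<Rightarrow> 'a set \<Rightarrow> bool" where
  "biased E A B C D \<longleftrightarrow> card A * card B * card C \<le> E * zeros A B C D"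

lemma sum_zT: "finite C \<Longrightarrow> (\<Sum>c\<in>C. zT D a b c) = card {c \<in> C. \<forall>d\<in>D. T a b c d = 0}"
  by (simp add: zT_def sum.If_cases Int_def)

lemma biased_mono4: assumes "biased E A B C D" "D' \<subseteq> D" shows "biased E A B C D'"
proof -
  have "zT D a b c \<le> zT D' a b c" for a b c using assms(2) by (auto simp: zT_def)
  hence "zeros A B C D \<le> zeros A B C D'"
    by (intro sum_mono)
  thus ?thesis using assms(1) unfolding biased_def by (meson le_trans mult_le_mono2)
qed

text \<open>The zero set in any one coordinate is a subgroup, so its density does not drop on subgroups.\<close>

lemma biased_mono3:
  assumes "biased E A B C D" "sg C" "sg C'" "C' \<subseteq> C" "A \<subseteq> V" "B \<subseteq> V" "D \<subseteq> V"
  shows "biased E A B C' D"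
proof -
  have "(\<Sum>c\<in>C. zT D a b c) * card C' \<le> card C * (\<Sum>c\<in>C'. zT D a b c)" if "a \<in> A" "b \<in> B" for a b
  proof -
    let ?X = "{c \<in> C. \<forall>d\<in>D. T a b c d = 0}"
    have "sg ?X" using that assms by (intro sg_zeros[where f = "\<lambda>d c. T a b c d"]) (auto intro!: T_addv3)
    hence "card ?X * card C' \<le> card C * card (?X \<inter> C')"
      using card_inter_ge[OF assms(2) _ assms(3), of ?X] assms(4) by auto
    moreover have "?X \<inter> C' = {c \<in> C'. \<forall>d\<in>D. T a b c d = 0}" using assms(4) by auto
    ultimately show ?thesis using assms by (simp add: sum_zT sg_fin)
  qed
  hence "zeros A B C D * card C' \<le> card C * zeros A B C' D"
    by (simp add: sum_distrib_left sum_distrib_right sum_mono)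
  from mult_le_mono2[OF this, of E]
  have "E * zeros A B C D * card C'
      \<le> card C * (E * zeros A B C' D)"
    by (simp only: mult.assoc mult.left_commute[of E])
  moreover have "card A * card B * card C * card C' \<le> E * zeros A B C D * card C'"
    using assms(1) unfolding biased_def by (rule mult_right_mono) simp
  ultimately have "card A * card B * card C * card C' \<le> card C * (E * zeros A B C' D)"
    by linarith
  also have "card A * card B * card C * card C' = card C * (card A * card B * card C')"
    by (simp only: mult_ac)
  finally have "card C * (card A * card B * card C') \<le> card C * (E * zeros A B C' D)" .
  thus ?thesis using sg_card_pos[OF assms(2)] by (simp add: biased_def)
qed

lemma zT_12: "\<lbrakk>a \<in> V; b \<in> V; c \<in> V; D \<subseteq> V\<rbrakk> \<Longrightarrow> zT D a b c = zT D b a c"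
  and zT_23: "\<lbrakk>a \<in> V; b \<in> V; c \<in> V; D \<subseteq> V\<rbrakk> \<Longrightarrow> zT D a b c = zT D a c b"
  unfolding zT_def using T_12[of a b c] T_23[of a b c]
  by (metis (no_types, lifting) subset_iff)+

lemma biased_swap12:
  assumes "biased E A B C D" "A \<subseteq> V" "B \<subseteq> V" "C \<subseteq> V" "D \<subseteq> V"
  shows "biased E B A C D"
proof -
  have "zeros A B C D = (\<Sum>b\<in>B. \<Sum>a\<in>A. \<Sum>c\<in>C. zT D a b c)"
    by (rule sum.swap)
  also have "\<dots> = (\<Sum>b\<in>B. \<Sum>a\<in>A. \<Sum>c\<in>C. zT D b a c)"
    using assms by (intro sum.cong refl zT_12) auto
  finally show ?thesis using assms(1) by (simp add: biased_def mult_ac)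
qed

lemma biased_swap23:
  assumes "biased E A B C D" "A \<subseteq> V" "B \<subseteq> V" "C \<subseteq> V" "D \<subseteq> V"
  shows "biased E A C B D"
proof -
  have "zeros A B C D = (\<Sum>a\<in>A. \<Sum>c\<in>C. \<Sum>b\<in>B. zT D a b c)"
    by (intro sum.cong refl sum.swap)
  also have "\<dots> = (\<Sum>a\<in>A. \<Sum>c\<in>C. \<Sum>b\<in>B. zT D a c b)"
    using assms by (intro sum.cong refl zT_23) auto
  finally show ?thesis using assms(1) by (simp add: biased_def mult_ac)
qed

text \<open>\<open>D\<close> can be shrunk at once, as fewer conditions are imposed. Of the other
  slots only the third is shrunk directly; symmetry moves each of them there in turn.\<close>

lemma biased_restrict:
  assumes b: "biased E U U U U" and U: "sg U"
    and A: "sg A" "A \<subseteq> U" and B: "sg B" "B \<subseteq> U" and C: "sg C" "C \<subseteq> U" and D: "D \<subseteq> U"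
  shows "biased E A B C D"
proof -
  have UV: "U \<subseteq> V" using U by (auto simp: sg_def)
  have V: "A \<subseteq> V" "B \<subseteq> V" "C \<subseteq> V" "D \<subseteq> V" using UV A B C D by auto
  have "biased E U U U D" using biased_mono4[OF b D] .
  hence "biased E U U A D" using biased_mono3[OF _ U A] UV V by blast
  hence "biased E U A U D" using biased_swap23 UV V by blast
  hence "biased E A U U D" using biased_swap12 UV V by blast
  hence "biased E A U B D" using biased_mono3[OF _ U B] UV V by blast
  hence "biased E A B U D" using biased_swap23 UV V by blast
  thus ?thesis using biased_mono3[OF _ U C] UV V by blast
qed

text \<open>\<open>van3\<close>, \<open>van2\<close> and \<open>van1\<close> kill the mixed values
  of \<open>T\<close> with one, two and three copies of \<open>v\<close> that arise when
  \<open>v\<close> is adjoined to a subspace of \<open>U\<close>.\<close>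

definition van3 :: "'a \<Rightarrow> 'a set \<Rightarrow> bool" where
  "van3 v U \<longleftrightarrow> (\<forall>a\<in>U. \<forall>b\<in>U. \<forall>c\<in>U. T v a b c = 0)"

definition van2 :: "'a \<Rightarrow> 'a set \<Rightarrow> bool" where
  "van2 v U \<longleftrightarrow> (\<forall>b\<in>U. \<forall>c\<in>U. T v v b c = 0)"

definition van1 :: "'a \<Rightarrow> 'a set \<Rightarrow> bool" where
  "van1 v U \<longleftrightarrow> (\<forall>c\<in>U. T v v v c = 0)"

lemma van3_subset: "van3 v U \<Longrightarrow> W \<subseteq> U \<Longrightarrow> van3 v W"
  and van2_subset: "van2 v U \<Longrightarrow> W \<subseteq> U \<Longrightarrow> van2 v W"
  and van1_subset: "van1 v U \<Longrightarrow> W \<subseteq> U \<Longrightarrow> van1 v W"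
  unfolding van3_def van2_def van1_def by blast+

lemma van3_add: "\<lbrakk>van3 v U; van3 w U; v \<in> V; w \<in> V; U \<subseteq> V\<rbrakk> \<Longrightarrow> van3 (v + w) U"
  unfolding van3_def by (simp add: T_add1 subset_iff)

lemma van3_diff: "\<lbrakk>van3 v U; van3 w U; v \<in> V; w \<in> V; U \<subseteq> V\<rbrakk> \<Longrightarrow> van3 (v - w) U"
  unfolding van3_def by (simp add: addv_diff[OF T_addv1] subset_iff)

lemma van3_0: "U \<subseteq> V \<Longrightarrow> van3 0 U"
  unfolding van3_def using addv_0[OF T_addv1] by blast

text \<open>By averaging over the first slot, at least \<open>card U / (2 * E)\<close> vectors
  \<open>y\<close> have a trilinear form \<open>T y\<close> of bias \<open>1 / (2 * E)\<close>. The
  assumption \<open>big\<close> makes this more than one, so that \<open>y\<close> can be taken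
  nonzero.\<close>

lemma vector_step:
  assumes U: "sg U" and b: "biased E U U U U" and big: "2 * E < card U"
  obtains y U' where "y \<in> U" "sg U'" "U' \<subseteq> U" "y \<notin> U'" "van3 y U'" "card U \<le> p ^ step_bound E * card U'"
proof -
  let ?f = "\<lambda>a. \<Sum>b\<in>U. \<Sum>c\<in>U. zT U a b c"
  let ?G = "{a \<in> U. card U * card U \<le> 2 * E * ?f a}"
  have fin: "finite U" using sg_fin U by blast
  have "card U \<le> 2 * E * card ?G"
  proof (rule averaging[OF fin])
    fix a
    have "?f a \<le> (\<Sum>b\<in>U. \<Sum>c\<in>U. 1)" by (intro sum_mono) (auto simp: zT_def)
    thus "?f a \<le> card U * card U" by simp
  next
    show "card U * card U * card U \<le> E * sum ?f U" using b by (simp add: biased_def)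
  qed (use sg_card_pos[OF U] in auto)
  hence "\<not> card ?G \<le> 1" using big
    using mult_le_mono2[of "card ?G" 1 "2 * E"] by linarith
  hence "\<not> ?G \<subseteq> {0}" using card_mono[of "{0}" ?G] by auto
  then obtain y where y: "y \<in> U" "card U * card U \<le> 2 * E * ?f y" "y \<noteq> 0" by blast
  have yV: "y \<in> V" using y U sg_subV by blast
  interpret trilinear p V "T y" by (rule trilinear_T[OF yV])
  have "?f y = (\<Sum>b\<in>U. card (ker b U))"
    by (simp add: sum_zT fin ker_def)
  then obtain U1 where U1: "sg U1" "U1 \<subseteq> U" "\<forall>a\<in>U1. \<forall>b\<in>U1. \<forall>c\<in>U1. T y a b c = 0"
    "card U \<le> p ^ tri_bound (2 * E) * card U1"
    using biased_trilinear_vanishes[OF U, of "2 * E"] y by auto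
  obtain U' where U': "sg U'" "U' \<subseteq> U1" "y \<notin> U'" "card U1 \<le> p * card U'"
    using complement_vector[OF U1(1) yV y(3)] .
  have "card U \<le> p ^ tri_bound (2 * E) * (p * card U')" using U1 U' by (meson le_trans mult_le_mono2)
  hence "card U \<le> p ^ step_bound E * card U'" by (simp add: step_bound_def mult_ac)
  moreover have "van3 y U'" using U1 U' unfolding van3_def by blast
  ultimately show ?thesis using that[of y U'] y U1 U' by blast
qed

section \<open>Chains of vectors on which the form is diagonal in two slots\<close>

lemma step_bound_big: "2 * E < p ^ step_bound E"
proof -
  have "2 * E < step_bound E" by (simp add: step_bound_def tri_bound_def)
  also have "\<dots> \<le> p ^ step_bound E" by (rule nat_le_p_power)
  finally show ?thesis .
qed

lemma index_trans:
  "\<lbrakk>card U \<le> p ^ i * card U'; card U' \<le> p ^ j * card U''\<rbrakk> \<Longrightarrow> card U \<le> p ^ (i + j) * card U''"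
  unfolding power_add mult.assoc by (meson le_trans mult_le_mono2)

lemma index_big: "\<lbrakk>p ^ (i + j) \<le> card U; card U \<le> p ^ i * card U'\<rbrakk> \<Longrightarrow> p ^ j \<le> card U'"
proof -
  assume "p ^ (i + j) \<le> card U" "card U \<le> p ^ i * card U'"
  hence "p ^ i * p ^ j \<le> p ^ i * card U'" unfolding power_add by linarith
  thus ?thesis using p_pos by simp
qed

text \<open>For the increments of \<open>\<sigma>\<close>, mixed values of \<open>T\<close> in the
  first two slots vanish on \<open>U'\<close>, so \<open>T (\<sigma> l) (\<sigma> l')\<close> only
  sees the increments up to the smaller index. The last clause says this without naming the
  increments.\<close>

definition prefix_chain :: "nat \<Rightarrow> 'a set \<Rightarrow> (nat \<Rightarrow> 'a) \<Rightarrow> 'a set \<Rightarrow> bool" where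
  "prefix_chain m U \<sigma> U' \<longleftrightarrow> \<sigma> 0 = 0 \<and> (\<forall>l\<le>m. \<sigma> l \<in> U) \<and> (\<forall>l\<le>m. van3 (\<sigma> l) U') \<and>
    (\<forall>l l'. l < l' \<longrightarrow> l' \<le> m \<longrightarrow> \<sigma> l' - \<sigma> l \<notin> U') \<and>
    (\<forall>l l' u v. l \<le> l' \<longrightarrow> l' \<le> m \<longrightarrow> u \<in> U' \<longrightarrow> v \<in> U' \<longrightarrow> T (\<sigma> l) (\<sigma> l') u v = T (\<sigma> l) (\<sigma> l) u v)"

lemma prefix_chainD:
  assumes "prefix_chain m U \<sigma> U'"
  shows "\<sigma> 0 = 0" "\<And>l. l \<le> m \<Longrightarrow> \<sigma> l \<in> U" "\<And>l. l \<le> m \<Longrightarrow> van3 (\<sigma> l) U'"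
    "\<And>l l'. l < l' \<Longrightarrow> l' \<le> m \<Longrightarrow> \<sigma> l' - \<sigma> l \<notin> U'"
    "\<And>l l' u v. \<lbrakk>l \<le> l'; l' \<le> m; u \<in> U'; v \<in> U'\<rbrakk> \<Longrightarrow> T (\<sigma> l) (\<sigma> l') u v = T (\<sigma> l) (\<sigma> l) u v"
  using assms unfolding prefix_chain_def by blast+

text \<open>The implication trades \<open>T w v\<close>, which the bias controls, for
  \<open>T v v\<close>, which it does not control directly.\<close>

definition diagonal_differences :: "nat \<Rightarrow> 'a set \<Rightarrow> 'a set \<Rightarrow> 'a \<Rightarrow> (nat \<Rightarrow> 'a) \<Rightarrow> bool" where
  "diagonal_differences m U U' w \<sigma> \<longleftrightarrow> (\<forall>l\<le>m. \<sigma> l \<in> U) \<and>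
    (\<forall>l l'. l < l' \<longrightarrow> l' \<le> m \<longrightarrow> \<sigma> l' - \<sigma> l \<notin> U' \<and> van3 (\<sigma> l' - \<sigma> l) U' \<and>
      (\<forall>u\<in>U'. \<forall>v\<in>U'. T w (\<sigma> l' - \<sigma> l) u v = 0 \<longrightarrow> T (\<sigma> l' - \<sigma> l) (\<sigma> l' - \<sigma> l) u v = 0))"

text \<open>The \<open>\<sigma> l\<close> are the prefix sums of a sequence of vectors, each chosen in the subspace on which
  the previous ones vanish; hence \<open>T\<close> is diagonal in the first two arguments on the tail \<open>U'\<close>.\<close>

lemma vector_chain:
  assumes U: "sg U" and b: "biased E U U U U" and big: "p ^ (m * step_bound E) \<le> card U"
  shows "\<exists>\<sigma> U'. sg U' \<and> U' \<subseteq> U \<and> card U \<le> p ^ (m * step_bound E) * card U' \<and> prefix_chain m U \<sigma> U'"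
  using big
proof (induction m)
  case 0
  have "U \<subseteq> V" using U by (auto simp: sg_def)
  thus ?case using U van3_0 by (intro exI[of _ "\<lambda>_. 0"] exI[of _ U]) (auto simp: sg_zero prefix_chain_def)
next
  case (Suc m)
  let ?r = "step_bound E"
  have big': "p ^ (m * ?r + ?r) \<le> card U" using Suc.prems by (simp add: add.commute)
  have "p ^ (m * ?r) \<le> card U"
    using big' power_increasing[of "m * ?r" "m * ?r + ?r" p] p_pos by linarith
  from Suc.IH[OF this] obtain \<sigma> U1 where U1: "sg U1" "U1 \<subseteq> U" "card U \<le> p ^ (m * ?r) * card U1"
    and ch: "prefix_chain m U \<sigma> U1" by blast
  note s0 = prefix_chainD(1)[OF ch] and s1 = prefix_chainD(2)[OF ch] and s2 = prefix_chainD(3)[OF ch]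
    and s3 = prefix_chainD(4)[OF ch] and s4 = prefix_chainD(5)[OF ch]
  have "p ^ ?r \<le> card U1" using index_big[OF big' U1(3)] .
  hence "2 * E < card U1" using step_bound_big[of E] by linarith
  moreover have "biased E U1 U1 U1 U1" using biased_restrict[OF b U] U1 by blast
  ultimately obtain y U' where y: "y \<in> U1" and U': "sg U'" "U' \<subseteq> U1" "y \<notin> U'" "van3 y U'"
    "card U1 \<le> p ^ ?r * card U'" using vector_step[OF U1(1)] by metis
  have UV: "\<And>t. t \<in> U \<Longrightarrow> t \<in> V" using U sg_subV by blast
  have yV: "y \<in> V" "y \<in> U" using y U1 UV by blast+
  have U'V: "U' \<subseteq> V" "U' \<subseteq> U" using U' U1 UV by blast+
  define \<tau> where "\<tau> = \<sigma>(Suc m := \<sigma> m + y)"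
  have t_le: "\<tau> l = \<sigma> l" if "l \<le> m" for l using that by (simp add: \<tau>_def)
  have t_m: "\<tau> (Suc m) = \<sigma> m + y" by (simp add: \<tau>_def)
  have "\<tau> l \<in> U \<and> van3 (\<tau> l) U'" if "l \<le> Suc m" for l
  proof (cases "l = Suc m")
    case True
    have "van3 (\<sigma> m + y) U'"
      using van3_add[of "\<sigma> m" U' y] van3_subset[OF s2 U'(2)] U'(4) s1 UV yV U'V by blast
    thus ?thesis using True t_m s1 yV sg_add[OF U] by simp
  next
    case False
    thus ?thesis using that t_le s1 van3_subset[OF s2 U'(2)] by simp
  qed
  moreover have "\<tau> l' - \<tau> l \<notin> U'" if "l < l'" "l' \<le> Suc m" for l l'
  proof (cases "l' = Suc m")
    case False
    hence "l \<le> m" "l' \<le> m" using that by auto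
    thus ?thesis using that(1) t_le s3[of l l'] U'(2) by auto
  next
    case True
    hence l: "l \<le> m" using that by simp
    \<comment> \<open>A new difference is \<open>y\<close> plus an old one. For \<open>l < m\<close>
      the old one lies outside \<open>U1\<close> and \<open>y\<close> inside, so the sum is outside;
      for \<open>l = m\<close> only \<open>y\<close> is left, which \<open>U'\<close>
      avoids.\<close>
    have eq: "\<tau> l' - \<tau> l = y + (\<sigma> m - \<sigma> l)" using True t_m t_le[OF l] by (simp add: algebra_simps)
    show ?thesis
    proof (cases "l = m")
      case True thus ?thesis using eq U' by simp
    next
      case False
      hence "\<sigma> m - \<sigma> l \<notin> U1" using s3[of l m] l by simp
      hence "y + (\<sigma> m - \<sigma> l) \<notin> U1" using sg_add_iff[OF U1(1) y] by simp
      thus ?thesis using eq U' by auto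
    qed
  qed
  moreover have "T (\<tau> l) (\<tau> l') u v = T (\<tau> l) (\<tau> l) u v" if "l \<le> l'" "l' \<le> Suc m" "u \<in> U'" "v \<in> U'" for l l' u v
  proof (cases "l = Suc m \<or> l' \<le> m")
    case True
    have "u \<in> U1" "v \<in> U1" using that U' by auto
    thus ?thesis using True that t_le s4[of l l' u v] by (cases "l = Suc m") auto
  next
    case False
    hence l: "l \<le> m" "l' = Suc m" using that by auto
    have V: "\<sigma> l \<in> V" "\<sigma> m \<in> V" "u \<in> V" "v \<in> V" using l s1 UV that U'V by auto
    \<comment> \<open>The increment \<open>y\<close> was drawn from \<open>U1\<close>, on which the
      form of \<open>\<sigma> l\<close> vanishes.\<close>
    have "T (\<sigma> l) y u v = 0" using s2[OF l(1)] y that U'(2) unfolding van3_def by blast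
    moreover have "T (\<sigma> l) (\<sigma> m) u v = T (\<sigma> l) (\<sigma> l) u v" using s4[of l m u v] l that U'(2) by auto
    ultimately have "T (\<sigma> l) (\<sigma> m + y) u v = T (\<sigma> l) (\<sigma> l) u v" using V yV by (simp add: T_add2)
    thus ?thesis using t_le[OF l(1)] t_m l(2) by simp
  qed
  moreover have "card U \<le> p ^ (Suc m * ?r) * card U'"
    using index_trans[OF U1(3) U'(5)] by (simp add: add.commute)
  moreover have "\<tau> 0 = 0" using s0 t_le by simp
  ultimately show ?case using U'(1) U'V(2) unfolding prefix_chain_def
    by (intro exI[of _ \<tau>] exI[of _ U'] conjI allI impI) blast+
qed

text \<open>Every nonzero \<open>w \<in> Z\<close> has a nonzero multiple of some \<open>\<sigma> m\<close> as its leading term, whence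
  \<open>T w v\<close> is a nonzero multiple of \<open>T v v\<close> for the differences \<open>v\<close> of the corresponding prefix sums.\<close>

lemma block_chain:
  assumes m: "m > 0"
  shows "\<lbrakk>sg U; biased E U U U U; p ^ (b * (m * step_bound E)) \<le> card U\<rbrakk> \<Longrightarrow>
    \<exists>Z U'. sg Z \<and> Z \<subseteq> U \<and> card Z = p ^ b \<and> sg U' \<and> U' \<subseteq> U \<and>
      card U \<le> p ^ (b * (m * step_bound E)) * card U' \<and>
      (\<forall>w\<in>Z. w \<noteq> 0 \<longrightarrow> (\<exists>\<sigma>. diagonal_differences m U U' w \<sigma>))"
proof (induction b arbitrary: U)
  case 0
  thus ?case using sg_zero_set sg_zero[OF 0(1)] by (intro exI[of _ "{0}"] exI[of _ U]) auto
next
  case (Suc b U)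
  note U = Suc.prems(1)
  let ?R = "m * step_bound E"
  have UV: "\<And>t. t \<in> U \<Longrightarrow> t \<in> V" using U sg_subV by blast
  have big: "p ^ (?R + b * ?R) \<le> card U" using Suc.prems(3) by simp
  have "p ^ ?R \<le> card U"
    using big power_increasing[of ?R "?R + b * ?R" p] p_pos by linarith
  from vector_chain[OF U Suc.prems(2) this] obtain \<sigma> U1 where
    U1: "sg U1" "U1 \<subseteq> U" "card U \<le> p ^ ?R * card U1"
    and ch: "prefix_chain m U \<sigma> U1" by blast
  note s0 = prefix_chainD(1)[OF ch] and s1 = prefix_chainD(2)[OF ch] and s2 = prefix_chainD(3)[OF ch]
    and s3 = prefix_chainD(4)[OF ch] and s4 = prefix_chainD(5)[OF ch]
  have sV: "\<sigma> l \<in> V" if "l \<le> m" for l using s1 that UV by blast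
  have U1V: "U1 \<subseteq> V" using U1 UV by blast
  have "p ^ (b * ?R) \<le> card U1" using index_big[OF big U1(3)] .
  moreover have "biased E U1 U1 U1 U1" using biased_restrict[OF Suc.prems(2) U] U1 by blast
  ultimately obtain Z U' where Z: "sg Z" "Z \<subseteq> U1" "card Z = p ^ b" and U': "sg U'" "U' \<subseteq> U1"
    "card U1 \<le> p ^ (b * ?R) * card U'"
    and ZP: "\<And>w. w \<in> Z \<Longrightarrow> w \<noteq> 0 \<Longrightarrow> \<exists>\<sigma>. diagonal_differences m U1 U' w \<sigma>"
    using Suc.IH[OF U1(1)] by blast
  have smV: "\<sigma> m \<in> V" using sV by simp
  have "\<sigma> m \<notin> Z" using s3[of 0 m] m s0 Z by auto
  hence cZ: "card (adj Z (\<sigma> m)) = p ^ Suc b" using card_adj[OF Z(1) smV] Z by simp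
  have adjU: "adj Z (\<sigma> m) \<subseteq> U" using adj_least[OF U, of Z] Z U1 s1 by blast
  have "\<exists>\<sigma>. diagonal_differences m U U' w \<sigma>"
    if w: "w \<in> adj Z (\<sigma> m)" "w \<noteq> 0" for w
  proof -
    obtain z c where zc: "z \<in> Z" "c < p" "w = z + nsm c (\<sigma> m)" using w by (auto simp: adj_def)
    show ?thesis
    proof (cases "c = 0")
      case True
      hence "w \<in> Z" using zc by simp
      then obtain \<sigma>' where "diagonal_differences m U1 U' w \<sigma>'" using ZP w(2) by blast
      hence "diagonal_differences m U U' w \<sigma>'" using U1(2) unfolding diagonal_differences_def by blast
      thus ?thesis by blast
    next
      case False
      have zV: "z \<in> V" "z \<in> U1" using zc Z U1V by blast+
      have "\<sigma> l' - \<sigma> l \<notin> U' \<and> van3 (\<sigma> l' - \<sigma> l) U' \<and>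
           (\<forall>u\<in>U'. \<forall>v\<in>U'. T w (\<sigma> l' - \<sigma> l) u v = 0 \<longrightarrow> T (\<sigma> l' - \<sigma> l) (\<sigma> l' - \<sigma> l) u v = 0)"
        if l: "l < l'" "l' \<le> m" for l l'
      proof (intro conjI ballI impI)
        let ?v = "\<sigma> l' - \<sigma> l"
        have lV: "\<sigma> l \<in> V" "\<sigma> l' \<in> V" using sV l by auto
        show "?v \<notin> U'" using s3 l U' by blast
        have v3: "van3 ?v U1" using van3_diff s2 l lV U1V by simp
        thus "van3 ?v U'" using van3_subset U' by blast
        fix u v assume uv: "u \<in> U'" "v \<in> U'" and zero: "T w ?v u v = 0"
        have uv1: "u \<in> U1" "v \<in> U1" using uv U' by auto
        have uvV: "u \<in> V" "v \<in> V" using uv1 U1V by auto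
        have dV: "?v \<in> V" using lV sg_diff[OF sg_V] by blast
        \<comment> \<open>By diagonality the Gram matrix of the prefix sums is
          \<open>t (min i j)\<close>, as for a walk with orthogonal increments. Therefore
          \<open>T (\<sigma> m) ?v\<close> and \<open>T ?v ?v\<close> both equal
          \<open>t l' - t l\<close>.\<close>
        define t where "t k = T (\<sigma> k) (\<sigma> k) u v" for k
        have T1: "T (\<sigma> i) (\<sigma> j) u v = t (min i j)" if "i \<le> m" "j \<le> m" for i j
        proof (cases "i \<le> j")
          case True
          thus ?thesis using s4[OF True that(2) uv1] by (simp add: t_def min_def)
        next
          case False
          hence "T (\<sigma> j) (\<sigma> i) u v = t j" using s4[of j i u v] that(1) uv1 by (simp add: t_def)
          thus ?thesis using T_12[OF sV[OF that(1)] sV[OF that(2)] uvV] False by (simp add: min_def)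
        qed
        have "T (\<sigma> m) ?v u v = t l' - t l"
          using addv_diff[OF T_addv2[OF smV uvV] lV(2) lV(1)] T1[of m l'] T1[of m l] l by simp
        moreover have "T ?v ?v u v = t l' - t l"
          using addv_diff[OF T_addv2[OF dV uvV] lV(2) lV(1)] addv_diff[OF T_addv1[OF lV(1) uvV] lV(2) lV(1)]
            addv_diff[OF T_addv1[OF lV(2) uvV] lV(2) lV(1)] T1[of l l'] T1[of l' l] T1[of l l] T1[of l' l'] l
          by simp
        \<comment> \<open>The rest \<open>z\<close> of \<open>w\<close> comes from later blocks,
          inside \<open>U1\<close>, where the form of \<open>?v\<close> vanishes.\<close>
        moreover have "T z ?v u v = 0"
          using v3 zV(2) uv1 T_12[OF zV(1) dV uvV] unfolding van3_def by simp
        moreover have nV: "nsm c (\<sigma> m) \<in> V" using smV sg_nsm[OF sg_V] by blast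
        have "T w ?v u v = T z ?v u v + nsm c (T (\<sigma> m) ?v u v)"
          unfolding zc(3) using T_add1[OF zV(1) nV dV uvV] addv_nsm[OF T_addv1[OF dV uvV] smV] by simp
        ultimately have "nsm c (T ?v ?v u v) = 0" using zero by simp
        hence z: "T (nsm c ?v) ?v u v = 0"
          using addv_nsm[OF T_addv1[OF dV uvV] dV] by simp
        obtain d where d: "\<And>x. x \<in> V \<Longrightarrow> nsm d (nsm c x) = x"
          using nsm_inverse[of c] False zc by blast
        have "T ?v ?v u v
            = nsm d (T (nsm c ?v) ?v u v)"
          using addv_nsm[OF T_addv1[OF dV uvV] sg_nsm[OF sg_V dV], of d c] d[OF dV] by simp
        thus "T ?v ?v u v = 0" unfolding z by simp
      qed
      hence "diagonal_differences m U U' w \<sigma>" using s1 unfolding diagonal_differences_def by simp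
      thus ?thesis by blast
    qed
  qed
  moreover have "card U \<le> p ^ (Suc b * ?R) * card U'" using index_trans[OF U1(3) U'(3)] by simp
  moreover have "U' \<subseteq> U" using U' U1 by blast
  ultimately show ?case using sg_adj[OF Z(1) smV] adjU cZ U'(1)
    by (intro exI[of _ "adj Z (\<sigma> m)"] exI[of _ U'] conjI ballI impI; assumption?)
qed

end

section \<open>Integer polynomials and finite differences\<close>

definition mono_eval :: "nat \<Rightarrow> (nat \<Rightarrow> nat) \<Rightarrow> (nat \<Rightarrow> int) \<Rightarrow> int" where
  "mono_eval n e x = (\<Prod>i<n. x i ^ e i)"

abbreviation poly_fun :: "nat \<Rightarrow> nat \<Rightarrow> ((nat \<Rightarrow> nat) \<Rightarrow> int) \<Rightarrow> (nat \<Rightarrow> int) \<Rightarrow> int" where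
  "poly_fun n d c \<equiv> \<lambda>x. \<Sum>e\<in>exponents n d. c e * mono_eval n e x"

text \<open>Integer polynomials read modulo \<open>p\<close> stand for polynomials over the prime
  field, so that ordinary integer arithmetic and congruences apply.\<close>

definition intpoly :: "nat \<Rightarrow> nat \<Rightarrow> ((nat \<Rightarrow> int) \<Rightarrow> int) \<Rightarrow> bool" where
  "intpoly n d F \<longleftrightarrow> (\<exists>c. \<forall>x. F x = poly_fun n d c x)"

lemma intpoly_iff: "intpoly n d F \<longleftrightarrow> (\<exists>c. F = poly_fun n d c)"
  unfolding intpoly_def fun_eq_iff by (rule refl)

lemma finite_exponents: "finite (exponents n d)"
proof (rule finite_subset)
  show "exponents n d \<subseteq> {..<n} \<rightarrow>\<^sub>E {..d}"
  proof
    fix e assume e: "e \<in> exponents n d"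
    have "e i \<le> d" if "i < n" for i
    proof -
      have "e i \<le> (\<Sum>i<n. e i)" using that by (intro member_le_sum) auto
      thus ?thesis using e by (simp add: exponents_def)
    qed
    thus "e \<in> {..<n} \<rightarrow>\<^sub>E {..d}" using e by (auto simp: exponents_def PiE_iff)
  qed
qed (auto intro: finite_PiE)

lemma intpoly_zero: "intpoly n d (\<lambda>x. 0)"
  unfolding intpoly_def by (rule exI[of _ "\<lambda>_. 0"]) simp

lemma intpoly_mono_eval:
  assumes "e \<in> exponents n d" shows "intpoly n d (mono_eval n e)"
proof -
  have "mono_eval n e x = (\<Sum>e'\<in>exponents n d. (if e' = e then 1 else 0) * mono_eval n e' x)" for x
  proof -
    have "(\<Sum>e'\<in>exponents n d. (if e' = e then 1 else 0) * mono_eval n e' x)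
        = (\<Sum>e'\<in>exponents n d. if e' = e then mono_eval n e' x else 0)"
      by (intro sum.cong) auto
    also have "\<dots> = mono_eval n e x" using assms finite_exponents by simp
    finally show ?thesis by (rule sym)
  qed
  thus ?thesis unfolding intpoly_def by (intro exI[of _ "\<lambda>e'. if e' = e then 1 else 0"] allI)
qed

lemma intpoly_add: assumes "intpoly n d F" "intpoly n d G" shows "intpoly n d (\<lambda>x. F x + G x)"
proof -
  obtain c where c: "F = poly_fun n d c" using assms(1) unfolding intpoly_iff by blast
  obtain c' where c': "G = poly_fun n d c'" using assms(2) unfolding intpoly_iff by blast
  show ?thesis unfolding intpoly_def c c'
    by (intro exI[of _ "\<lambda>e. c e + c' e"]) (simp add: sum.distrib algebra_simps)
qed

lemma intpoly_cmult: assumes "intpoly n d F" shows "intpoly n d (\<lambda>x. a * F x)"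
proof -
  obtain c where c: "F = poly_fun n d c" using assms unfolding intpoly_iff by blast
  show ?thesis unfolding intpoly_def c
    by (intro exI[of _ "\<lambda>e. a * c e"]) (simp add: sum_distrib_left mult_ac)
qed

lemma intpoly_sum: "(\<And>i. i \<in> I \<Longrightarrow> intpoly n d (F i)) \<Longrightarrow> intpoly n d (\<lambda>x. \<Sum>i\<in>I. F i x)"
proof (induction I rule: infinite_finite_induct)
  case (insert i I)
  have "intpoly n d (\<lambda>x. F i x + (\<Sum>i\<in>I. F i x))" by (rule intpoly_add) (use insert in auto)
  thus ?case using insert.hyps by simp
qed (simp_all add: intpoly_zero)

lemma intpoly_mult: assumes "intpoly n d F" "intpoly n d' G" shows "intpoly n (d + d') (\<lambda>x. F x * G x)"
proof -
  obtain c where c: "F = poly_fun n d c" using assms(1) unfolding intpoly_iff by blast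
  obtain c' where c': "G = poly_fun n d' c'" using assms(2) unfolding intpoly_iff by blast
  define s :: "(nat \<Rightarrow> nat) \<Rightarrow> (nat \<Rightarrow> nat) \<Rightarrow> nat \<Rightarrow> nat" where "s e e' = (\<lambda>i\<in>{..<n}. e i + e' i)" for e e'
  have s: "s e e' \<in> exponents n (d + d')" if "e \<in> exponents n d" "e' \<in> exponents n d'" for e e'
    using that by (auto simp: s_def exponents_def sum.distrib)
  have m: "mono_eval n e x * mono_eval n e' x = mono_eval n (s e e') x" for e e' x
    by (simp add: mono_eval_def s_def prod.distrib[symmetric] power_add)
  have re: "(a * b) * (a' * b') = (a * a') * (b * b')" for a b a' b' :: int by (simp add: algebra_simps)
  have "intpoly n (d + d') (\<lambda>x. \<Sum>e\<in>exponents n d. \<Sum>e'\<in>exponents n d'. (c e * c' e') * mono_eval n (s e e') x)"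
    by (rule intpoly_sum, rule intpoly_sum, rule intpoly_cmult, rule intpoly_mono_eval, rule s)
  moreover have "(\<lambda>x. F x * G x) = (\<lambda>x. \<Sum>e\<in>exponents n d. \<Sum>e'\<in>exponents n d'. (c e * c' e') * mono_eval n (s e e') x)"
    unfolding c c' sum_product m[symmetric] by (intro ext sum.cong refl re)
  ultimately show ?thesis by (simp only:)
qed

lemma intpoly_const: "intpoly n d (\<lambda>x. a)"
proof -
  have e: "(\<lambda>i\<in>{..<n}. 0) \<in> exponents n d" by (auto simp: exponents_def)
  have "mono_eval n (\<lambda>i\<in>{..<n}. 0) x = 1" for x by (simp add: mono_eval_def)
  thus ?thesis using intpoly_cmult[OF intpoly_mono_eval[OF e], of a] by simp
qed

lemma intpoly_coord: assumes "i < n" "1 \<le> d" shows "intpoly n d (\<lambda>x. x i)"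
proof -
  define e :: "nat \<Rightarrow> nat" where "e = (\<lambda>j\<in>{..<n}. if j = i then 1 else 0)"
  have e: "e \<in> exponents n d" using assms by (auto simp: exponents_def e_def)
  have "mono_eval n e = (\<lambda>x. x i)"
  proof
    fix x
    have "mono_eval n e x = (\<Prod>j<n. if j = i then x i else 1)"
      unfolding mono_eval_def by (intro prod.cong) (auto simp: e_def)
    thus "mono_eval n e x = x i" using assms by simp
  qed
  thus ?thesis using intpoly_mono_eval[OF e] by simp
qed

lemma intpoly_power: "intpoly n d F \<Longrightarrow> intpoly n (k * d) (\<lambda>x. F x ^ k)"
proof (induction k)
  case 0 thus ?case using intpoly_const[of n 0 1] by simp
next
  case (Suc k) thus ?case using intpoly_mult[of n d F "k * d" "\<lambda>x. F x ^ k"] by simp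
qed

lemma intpoly_set_zero: assumes "intpoly n d F" "k < n" shows "intpoly n d (\<lambda>x. F (x(k := 0)))"
proof -
  obtain c where c: "F = poly_fun n d c" using assms unfolding intpoly_iff by blast
  have m: "mono_eval n e (x(k := 0)) = (if e k = 0 then 1 else 0) * mono_eval n e x" for e x
  proof (cases "e k = 0")
    case True
    thus ?thesis by (auto simp: mono_eval_def intro!: prod.cong)
  next
    case False
    hence "mono_eval n e (x(k := 0)) = 0" unfolding mono_eval_def using assms(2)
      by (intro prod_zero) (auto intro!: bexI[of _ k])
    thus ?thesis using False by simp
  qed
  have "intpoly n d (\<lambda>x. \<Sum>e\<in>exponents n d. c e * ((if e k = 0 then 1 else 0) * mono_eval n e x))"
    by (intro intpoly_sum intpoly_cmult intpoly_mono_eval)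
  thus ?thesis unfolding c m .
qed

text \<open>These are the functions on integer vectors that descend to the n-dimensional space over
  the prime field.\<close>

definition class_fun :: "nat \<Rightarrow> nat \<Rightarrow> ((nat \<Rightarrow> int) \<Rightarrow> int) \<Rightarrow> bool" where
  "class_fun p n F \<longleftrightarrow> (\<forall>x y. (\<forall>i<n. [x i = y i] (mod int p)) \<longrightarrow> [F x = F y] (mod int p))"

lemma intpoly_class_fun: assumes "intpoly n d F" shows "class_fun p n F"
proof -
  obtain c where c: "F = poly_fun n d c" using assms unfolding intpoly_iff by blast
  show ?thesis unfolding class_fun_def c mono_eval_def
    by (auto intro!: cong_sum cong_mult cong_prod cong_pow)
qed

section \<open>Finite differences modulo \<open>p\<close>\<close>

definition delta :: "(nat \<Rightarrow> int) \<Rightarrow> ((nat \<Rightarrow> int) \<Rightarrow> int) \<Rightarrow> (nat \<Rightarrow> int) \<Rightarrow> int" where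
  "delta y F x = F (x + y) - F x"

text \<open>Degree below \<open>k\<close> as measured by differences. This notion can be checked
  direction by direction, which suits subspaces; \<open>intpoly_dd\<close> and
  \<open>dd_imp_intpoly\<close> translate to and from coefficients.\<close>

primrec dd :: "nat \<Rightarrow> nat \<Rightarrow> ((nat \<Rightarrow> int) \<Rightarrow> int) \<Rightarrow> bool" where
  "dd p 0 F \<longleftrightarrow> (\<forall>x. [F x = 0] (mod int p))"
| "dd p (Suc k) F \<longleftrightarrow> (\<forall>y. dd p k (delta y F))"

lemma dd_cong: "dd p k F \<Longrightarrow> (\<And>x. [F x = G x] (mod int p)) \<Longrightarrow> dd p k G"
proof (induction k arbitrary: F G)
  case 0 thus ?case by (meson cong_sym cong_trans dd.simps(1))
next
  case (Suc k)
  have "dd p k (delta y G)" for y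
  proof (rule Suc.IH)
    show "dd p k (delta y F)" using Suc.prems(1) by simp
    show "[delta y F x = delta y G x] (mod int p)" for x
      unfolding delta_def by (intro cong_diff Suc.prems(2))
  qed
  thus ?case by simp
qed

lemma dd_shift: "dd p k F \<Longrightarrow> dd p k (\<lambda>x. F (x + z))"
proof (induction k arbitrary: F)
  case (Suc k)
  have eq: "delta y (\<lambda>x. F (x + z)) = (\<lambda>x. delta y F (x + z))" for y
    unfolding delta_def by (simp only: add_ac)
  have "dd p k (\<lambda>x. delta y F (x + z))" for y
    by (rule Suc.IH) (use Suc.prems in simp)
  thus ?case by (simp only: dd.simps eq simp_thms)
qed simp

lemma dd_add: "dd p k F \<Longrightarrow> dd p k G \<Longrightarrow> dd p k (\<lambda>x. F x + G x)"
proof (induction k arbitrary: F G)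
  case 0 thus ?case using cong_add by fastforce
next
  case (Suc k)
  have "delta y (\<lambda>x. F x + G x) = (\<lambda>x. delta y F x + delta y G x)" for y by (auto simp: delta_def)
  thus ?case using Suc by simp
qed

lemma dd_zero: "(\<And>x. [F x = 0] (mod int p)) \<Longrightarrow> dd p k F"
proof (induction k arbitrary: F)
  case (Suc k)
  have "[delta y F x = 0] (mod int p)" for x y using cong_diff[OF Suc.prems Suc.prems] by (simp add: delta_def)
  thus ?case using Suc.IH by simp
qed simp

lemma dd_mult: "\<lbrakk>dd p (Suc a) F; dd p (Suc b) G\<rbrakk> \<Longrightarrow> dd p (Suc (a + b)) (\<lambda>x. F x * G x)"
proof (induction "a + b" arbitrary: a b F G rule: less_induct)
  case less
  have "dd p (a + b) (delta y (\<lambda>x. F x * G x))" for y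
  proof -
    \<comment> \<open>Leibniz rule for differences: each summand has one factor of lower degree, and
      the other factor is at most translated.\<close>
    have "delta y (\<lambda>x. F x * G x) = (\<lambda>x. delta y F x * G (x + y) + F x * delta y G x)"
      by (auto simp: delta_def algebra_simps)
    moreover have "dd p (a + b) (\<lambda>x. delta y F x * G (x + y))"
    proof (cases a)
      case 0
      hence "[delta y F x = 0] (mod int p)" for x using less.prems(1) by simp
      from cong_mult[OF this cong_refl] have "[delta y F x * G (x + y) = 0] (mod int p)" for x by simp
      thus ?thesis by (rule dd_zero)
    next
      case (Suc a')
      have "dd p (Suc (a' + b)) (\<lambda>x. delta y F x * G (x + y))"
        using less.prems Suc by (intro less.hyps dd_shift) auto
      thus ?thesis using Suc by simp
    qed
    moreover have "dd p (a + b) (\<lambda>x. F x * delta y G x)"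
    proof (cases b)
      case 0
      hence "[delta y G x = 0] (mod int p)" for x using less.prems(2) by simp
      from cong_mult[OF cong_refl this] have "[F x * delta y G x = 0] (mod int p)" for x by simp
      thus ?thesis by (rule dd_zero)
    next
      case (Suc b')
      have "dd p (Suc (a + b')) (\<lambda>x. F x * delta y G x)"
        using less.prems Suc by (intro less.hyps) auto
      thus ?thesis using Suc by simp
    qed
    ultimately show ?thesis using dd_add[of p "a + b"] by simp
  qed
  thus ?case by simp
qed

lemma dd_const: "dd p (Suc k) (\<lambda>x. a)"
  by (auto simp: delta_def intro: dd_zero)

lemma dd_le: "dd p k F \<Longrightarrow> k \<le> k' \<Longrightarrow> dd p k' F"
proof (induction k arbitrary: k' F)
  case 0 thus ?case by (intro dd_zero) auto
next
  case (Suc k)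
  then obtain k'' where "k' = Suc k''" by (cases k') auto
  thus ?case using Suc by auto
qed

lemma dd_coord: "dd p (Suc 1) (\<lambda>x. x i)"
  by (simp add: delta_def)

lemma dd_mono_eval: "dd p (Suc (\<Sum>i<n. e i)) (mono_eval n e)"
proof (induction n)
  case 0 thus ?case using dd_const[of p 0 1] by (simp add: mono_eval_def)
next
  case (Suc n)
  have pw: "dd p (Suc m) (\<lambda>x. x n ^ m)" for m
  proof (induction m)
    case 0 thus ?case using dd_const[of p 0 1] by simp
  next
    case (Suc m) thus ?case using dd_mult[OF dd_coord[of p n] Suc] by simp
  qed
  have "mono_eval (Suc n) e = (\<lambda>x. mono_eval n e x * x n ^ e n)" by (auto simp: mono_eval_def)
  thus ?case using dd_mult[OF Suc pw[of "e n"]] by simp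
qed

lemma intpoly_dd: assumes "intpoly n d F" shows "dd p (Suc d) F"
proof -
  obtain c where c: "F = poly_fun n d c" using assms unfolding intpoly_iff by blast
  have tm: "dd p (Suc d) (\<lambda>x. c e * mono_eval n e x)" if "e \<in> exponents n d" for e
  proof -
    have "dd p (Suc (0 + (\<Sum>i<n. e i))) (\<lambda>x. c e * mono_eval n e x)"
      by (rule dd_mult[OF dd_const dd_mono_eval])
    moreover have "Suc (0 + (\<Sum>i<n. e i)) \<le> Suc d" using that by (simp add: exponents_def)
    ultimately show ?thesis by (rule dd_le)
  qed
  have "dd p (Suc d) (\<lambda>x. \<Sum>e\<in>I. c e * mono_eval n e x)" if "I \<subseteq> exponents n d" "finite I" for I
    using that(2,1)
  proof (induction I rule: finite_induct)
    case empty thus ?case by (intro dd_zero) auto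
  next
    case (insert e I)
    have "dd p (Suc d) (\<lambda>x. c e * mono_eval n e x + (\<Sum>e\<in>I. c e * mono_eval n e x))"
      using insert.prems by (intro dd_add tm insert.IH) auto
    thus ?case using insert.hyps by simp
  qed
  thus ?thesis unfolding c using finite_exponents by blast
qed

section \<open>Newton interpolation modulo \<open>p\<close>\<close>

lemma newton_forward:
  "F (\<lambda>i. x i + int t * u i) = (\<Sum>j\<le>t. int (t choose j) * ((delta u ^^ j) F) x)"
proof (induction t arbitrary: F)
  case (Suc t)
  have "(\<lambda>i. x i + int (Suc t) * u i) = (\<lambda>i. x i + int t * u i) + u" by (auto simp: algebra_simps)
  hence "F (\<lambda>i. x i + int (Suc t) * u i) = F (\<lambda>i. x i + int t * u i) + delta u F (\<lambda>i. x i + int t * u i)"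
    by (simp add: delta_def)
  also have "\<dots> = (\<Sum>j\<le>t. int (t choose j) * ((delta u ^^ j) F) x)
      + (\<Sum>j\<le>t. int (t choose j) * ((delta u ^^ Suc j) F) x)"
    using Suc[of F] Suc[of "delta u F"] by (simp add: funpow_swap1)
  also have "(\<Sum>j\<le>t. int (t choose j) * ((delta u ^^ j) F) x)
      = (\<Sum>j\<le>Suc t. int (t choose j) * ((delta u ^^ j) F) x)" by simp
  also have "\<dots> = F x + (\<Sum>j\<le>t. int (t choose Suc j) * ((delta u ^^ Suc j) F) x)"
    by (subst sum.atMost_Suc_shift) simp
  also have "\<dots> + (\<Sum>j\<le>t. int (t choose j) * ((delta u ^^ Suc j) F) x)
      = F x + (\<Sum>j\<le>t. int (Suc t choose Suc j) * ((delta u ^^ Suc j) F) x)"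
    by (simp add: sum.distrib[symmetric] algebra_simps)
  also have "\<dots> = (\<Sum>j\<le>Suc t. int (Suc t choose j) * ((delta u ^^ j) F) x)"
    by (subst sum.atMost_Suc_shift) simp
  finally show ?case .
qed simp

text \<open>The truncated subtraction is intended: from the \<open>k\<close>-th difference on,
  everything vanishes modulo \<open>p\<close>.\<close>

lemma dd_funpow: "dd p k F \<Longrightarrow> dd p (k - j) ((delta u ^^ j) F)"
proof (induction j)
  case (Suc j)
  show ?case
  proof (cases "k - j")
    case 0
    hence "dd p 1 ((delta u ^^ j) F)" using dd_le Suc by fastforce
    thus ?thesis using 0 by simp
  next
    case (Suc m)
    hence "dd p m (delta u ((delta u ^^ j) F))" using Suc.IH Suc.prems by simp
    moreover have "k - Suc j = m" using Suc by simp
    ultimately show ?thesis by simp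
  qed
qed simp

lemma binomial_falling: "int (fact j) * int (t choose j) = (\<Prod>i<j. int t - int i)"
proof -
  have "(fact j :: real) * real (t choose j) = (\<Prod>i = 0..<j. real t - real i)"
    unfolding binomial_gbinomial by (rule gbinomial_mult_fact)
  hence "real_of_int (int (fact j) * int (t choose j)) = real_of_int (\<Prod>i<j. int t - int i)"
    by (simp add: lessThan_atLeast0)
  thus ?thesis by (simp only: of_int_eq_iff)
qed

text \<open>For \<open>j < p\<close> the factorial of \<open>j\<close> is invertible modulo
  \<open>p\<close>, so the binomial coefficient becomes a polynomial of degree \<open>j\<close> in
  the coordinate.\<close>

lemma binomial_intpoly:
  assumes "prime p" "j < p" "k < n"
  obtains B where "intpoly n j B" "\<And>x t. x k = int t \<Longrightarrow> [B x = int (t choose j)] (mod int p)"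
proof -
  have "coprime (int (fact j)) (int p)"
    using assms by (simp add: coprime_commute prime_imp_coprime prime_dvd_fact_iff coprime_int_iff del: of_nat_fact)
  then obtain a where a: "[int (fact j) * a = 1] (mod int p)" using cong_solve_coprime_int by blast
  define B where "B = (\<lambda>x. a * (\<Prod>i<j. x k - int i))"
  have "intpoly n j (\<lambda>x. \<Prod>i<j. x k - int i)"
  proof (induction j)
    case (Suc j)
    have "intpoly n 1 (\<lambda>x. x k + - int j)" using assms by (intro intpoly_add intpoly_coord intpoly_const) auto
    thus ?case using intpoly_mult[OF Suc, of 1] by simp
  qed (simp add: intpoly_const)
  hence "intpoly n j B" unfolding B_def by (rule intpoly_cmult)
  moreover have "[B x = int (t choose j)] (mod int p)" if "x k = int t" for x t
  proof -
    have "B x = (int (fact j) * a) * int (t choose j)" unfolding B_def that binomial_falling[symmetric] by simp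
    thus ?thesis using cong_scalar_right[OF a, of "int (t choose j)"] by simp
  qed
  ultimately show ?thesis using that by blast
qed

lemma class_fun_delta: "class_fun p n F \<Longrightarrow> class_fun p n (delta y F)"
proof -
  assume F: "class_fun p n F"
  have "[F (x + y) - F x = F (x' + y) - F x'] (mod int p)" if "\<forall>i<n. [x i = x' i] (mod int p)" for x x'
  proof (rule cong_diff)
    have "\<forall>i<n. [(x + y) i = (x' + y) i] (mod int p)" using that by (simp add: cong_add)
    thus "[F (x + y) = F (x' + y)] (mod int p)" using F unfolding class_fun_def by blast
    show "[F x = F x'] (mod int p)" using F that unfolding class_fun_def by blast
  qed
  thus ?thesis unfolding class_fun_def delta_def by blast
qed

abbreviation reduced :: "nat \<Rightarrow> nat \<Rightarrow> (nat \<Rightarrow> int) \<Rightarrow> bool" where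
  "reduced p n x \<equiv> \<forall>i<n. 0 \<le> x i \<and> x i < int p"

text \<open>Newton interpolation, one coordinate at a time: the coordinates from \<open>k\<close> on are zero.\<close>

lemma dd_imp_intpoly_aux:
  assumes p: "prime p"
  shows "k \<le> n \<Longrightarrow> dd p (Suc d) F \<Longrightarrow> \<exists>H. intpoly n d H \<and>
    (\<forall>x. reduced p n x \<longrightarrow> (\<forall>i\<ge>k. x i = 0) \<longrightarrow> [F x = H x] (mod int p))"
proof (induction k arbitrary: d F)
  case 0
  have "x = (\<lambda>_. 0)" if "\<forall>i\<ge>0. x i = 0" for x :: "nat \<Rightarrow> int" using that by auto
  hence "[F x = F (\<lambda>_. 0)] (mod int p)" if "\<forall>i\<ge>0. x i = 0" for x using that by (metis cong_refl)
  thus ?case using intpoly_const[of n d "F (\<lambda>_. 0)"] by blast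
next
  case (Suc k)
  define u :: "nat \<Rightarrow> int" where "u = (\<lambda>i. if i = k then 1 else 0)"
  \<comment> \<open>Differences of order above \<open>d\<close> vanish, and orders from
    \<open>p\<close> on never occur, since a reduced coordinate is below \<open>p\<close>. Within
    \<open>J\<close> the binomial coefficients are polynomials modulo \<open>p\<close>.\<close>
  define J where "J = {j. j \<le> d \<and> j < p}"
  have kn: "k < n" "k \<le> n" using Suc.prems by auto
  have "\<forall>j\<in>J. \<exists>H. intpoly n (d - j) H \<and> (\<forall>x. reduced p n x \<longrightarrow> (\<forall>i\<ge>k. x i = 0) \<longrightarrow>
      [(delta u ^^ j) F x = H x] (mod int p))"
  proof
    fix j assume that: "j \<in> J"
    have "dd p (Suc (d - j)) ((delta u ^^ j) F)"
      using dd_funpow[OF Suc.prems(2), of j u] that by (simp add: J_def Suc_diff_le)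
    thus "\<exists>H. intpoly n (d - j) H \<and> (\<forall>x. reduced p n x \<longrightarrow> (\<forall>i\<ge>k. x i = 0) \<longrightarrow>
      [(delta u ^^ j) F x = H x] (mod int p))" by (rule Suc.IH[OF kn(2)])
  qed
  from bchoice[OF this] obtain H where H': "\<forall>j\<in>J. intpoly n (d - j) (H j) \<and> (\<forall>x. reduced p n x \<longrightarrow>
      (\<forall>i\<ge>k. x i = 0) \<longrightarrow> [(delta u ^^ j) F x = H j x] (mod int p))" by (elim exE)
  have H: "\<And>j. j \<in> J \<Longrightarrow> intpoly n (d - j) (H j)"
    "\<And>j x. j \<in> J \<Longrightarrow> reduced p n x \<Longrightarrow> (\<forall>i\<ge>k. x i = 0) \<Longrightarrow>
      [(delta u ^^ j) F x = H j x] (mod int p)" using H' by blast+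
  have "\<forall>j\<in>J. \<exists>B. intpoly n j B \<and> (\<forall>x t. x k = int t \<longrightarrow> [B x = int (t choose j)] (mod int p))"
  proof
    fix j assume "j \<in> J"
    hence "j < p" by (simp add: J_def)
    thus "\<exists>B. intpoly n j B \<and> (\<forall>x t. x k = int t \<longrightarrow> [B x = int (t choose j)] (mod int p))"
      by (rule binomial_intpoly[OF p _ kn(1)]) blast
  qed
  from bchoice[OF this] obtain B where B': "\<forall>j\<in>J. intpoly n j (B j) \<and>
      (\<forall>x t. x k = int t \<longrightarrow> [B j x = int (t choose j)] (mod int p))" by (elim exE)
  have B: "\<And>j. j \<in> J \<Longrightarrow> intpoly n j (B j)"
    "\<And>j x t. j \<in> J \<Longrightarrow> x k = int t \<Longrightarrow> [B j x = int (t choose j)] (mod int p)" using B' by blast+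
  \<comment> \<open>\<open>H j\<close> is reliable only where coordinate \<open>k\<close> vanishes,
    hence the substitution. The degree is \<open>j\<close> from the binomial coefficient plus
    \<open>d - j\<close> from the difference.\<close>
  define G where "G = (\<lambda>x. \<Sum>j\<in>J. B j x * H j (x(k := 0)))"
  have "intpoly n d (\<lambda>x. B j x * H j (x(k := 0)))" if "j \<in> J" for j
  proof -
    have "intpoly n (j + (d - j)) (\<lambda>x. B j x * H j (x(k := 0)))"
      by (intro intpoly_mult B intpoly_set_zero H that kn)
    thus ?thesis using that by (simp add: J_def)
  qed
  hence "intpoly n d G" unfolding G_def by (rule intpoly_sum)
  moreover have "[F x = G x] (mod int p)" if x: "reduced p n x" "\<forall>i\<ge>Suc k. x i = 0" for x
  proof -
    define t where "t = nat (x k)"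
    have t: "x k = int t" "t < p" using x kn by (auto simp: t_def)
    define x' where "x' = x(k := 0)"
    have x': "reduced p n x'" using x(1) t by (auto simp: x'_def)
    have x'0: "\<forall>i\<ge>k. x' i = 0"
    proof (intro allI impI)
      fix i assume "i \<ge> k"
      show "x' i = 0"
      proof (cases "i = k")
        case False
        hence "Suc k \<le> i" using \<open>i \<ge> k\<close> by simp
        thus ?thesis using x(2) False by (simp add: x'_def)
      qed (simp add: x'_def)
    qed
    let ?a = "\<lambda>j. int (t choose j) * ((delta u ^^ j) F) x'"
    have "x = (\<lambda>i. x' i + int t * u i)"
    proof
      fix i show "x i = x' i + int t * u i" using t(1) by (cases "i = k") (simp_all add: x'_def u_def)
    qed
    hence "F x = (\<Sum>j\<le>t. ?a j)" using newton_forward[of F x' t u] by simp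
    also have "\<dots> = (\<Sum>j\<in>{..t} \<union> J. ?a j)"
      by (intro sum.mono_neutral_left) (auto simp: J_def)
    also have "[\<dots> = (\<Sum>j\<in>J. ?a j)] (mod int p)"
    proof -
      have fJ: "finite J" by (simp add: J_def)
      have "[?a j = 0] (mod int p)" if "j \<in> {..t} - J" for j
      proof -
        have "Suc d - j = 0" using that t by (auto simp: J_def)
        hence "[((delta u ^^ j) F) x' = 0] (mod int p)" using dd_funpow[OF Suc.prems(2), of j u] by simp
        from cong_mult[OF cong_refl this] show ?thesis by simp
      qed
      hence "[(\<Sum>j\<in>{..t} - J. ?a j) = (\<Sum>j\<in>{..t} - J. 0)] (mod int p)"
        by (rule cong_sum)
      hence "[(\<Sum>j\<in>J. ?a j) + (\<Sum>j\<in>{..t} - J. ?a j)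
        = (\<Sum>j\<in>J. ?a j) + 0] (mod int p)"
        unfolding sum.neutral_const by (rule cong_add[OF cong_refl])
      moreover have "(\<Sum>j\<in>{..t} \<union> J. ?a j)
        = (\<Sum>j\<in>J. ?a j) + (\<Sum>j\<in>{..t} - J. ?a j)"
      proof -
        have "{..t} \<union> J = J \<union> ({..t} - J)" by blast
        thus ?thesis by (simp only:) (rule sum.union_disjoint, use fJ in auto)
      qed
      ultimately show ?thesis by (simp only: add_0_right)
    qed
    also have "[(\<Sum>j\<in>J. ?a j) = G x] (mod int p)"
      unfolding G_def x'_def[symmetric]
      by (rule cong_sum, rule cong_mult) (rule cong_sym, rule B(2)[where x = x and t = t], assumption, rule t(1), rule H(2)[OF _ x' x'0])
    finally show ?thesis .
  qed
  ultimately show ?case by blast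
qed

theorem dd_imp_intpoly:
  assumes "prime p" "class_fun p n F" "dd p (Suc d) F"
  obtains H where "intpoly n d H" "\<And>x. reduced p n x \<Longrightarrow> [F x = H x] (mod int p)"
proof -
  from dd_imp_intpoly_aux[of p n n d F, OF assms(1) order_refl assms(3)]
  obtain H where H': "intpoly n d H \<and> (\<forall>x. reduced p n x \<longrightarrow> (\<forall>i\<ge>n. x i = 0) \<longrightarrow> [F x = H x] (mod int p))"
    by (elim exE)
  have H: "intpoly n d H"
    "\<And>x. reduced p n x \<Longrightarrow> (\<forall>i\<ge>n. x i = 0) \<Longrightarrow> [F x = H x] (mod int p)"
    using H' by blast+
  show ?thesis
  proof (rule that[OF H(1)])
    fix x assume x: "reduced p n x"
    define x' where "x' = (\<lambda>i. if i < n then x i else 0)"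
    have "\<forall>i<n. [x i = x' i] (mod int p)" by (simp add: x'_def)
    hence 1: "[F x = F x'] (mod int p)" "[H x = H x'] (mod int p)"
      using assms(2) intpoly_class_fun[OF H(1), of p] unfolding class_fun_def by blast+
    have "[F x' = H x'] (mod int p)" by (rule H(2)) (use x in \<open>auto simp: x'_def\<close>)
    thus "[F x = H x] (mod int p)" using 1 by (meson cong_sym cong_trans)
  qed
qed

section \<open>The Chevalley-Warning theorem\<close>

text \<open>Telescoping \<open>(a + 1) ^ Suc e - a ^ Suc e\<close> over a full period gives
  \<open>p ^ Suc e\<close>. By induction all lower power sums drop out modulo \<open>p\<close>,
  which leaves \<open>Suc e\<close> times the sum in question, and \<open>Suc e < p\<close> is
  invertible.\<close>

lemma sum_powers_cong_0:
  assumes p: "prime p"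
  shows "e < p - 1 \<Longrightarrow> [(\<Sum>a<p. int a ^ e) = 0] (mod int p)"
proof (induction e rule: less_induct)
  case (less e)
  have step: "(int a + 1) ^ Suc e - int a ^ Suc e = (\<Sum>j\<le>e. int (Suc e choose j) * int a ^ j)" for a
    by (simp add: binomial_ring[of "int a" 1 "Suc e"] del: power_Suc binomial_Suc_Suc)
  have "int p ^ Suc e = (\<Sum>a<p. int (Suc a) ^ Suc e - int a ^ Suc e)"
    by (subst sum_lessThan_telescope) simp
  also have "\<dots> = (\<Sum>a<p. \<Sum>j\<le>e. int (Suc e choose j) * int a ^ j)"
    by (intro sum.cong refl) (simp only: step[symmetric] of_nat_Suc add.commute)
  also have "\<dots> = (\<Sum>j\<le>e. int (Suc e choose j) * (\<Sum>a<p. int a ^ j))"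
    by (subst sum.swap) (simp only: sum_distrib_left)
  also have "\<dots> = (\<Sum>j<e. int (Suc e choose j) * (\<Sum>a<p. int a ^ j)) + int (Suc e) * (\<Sum>a<p. int a ^ e)"
    by (simp only: lessThan_Suc_atMost[symmetric] sum.lessThan_Suc binomial_Suc_n)
  finally have eq: "int (Suc e) * (\<Sum>a<p. int a ^ e)
      = int p ^ Suc e - (\<Sum>j<e. int (Suc e choose j) * (\<Sum>a<p. int a ^ j))" by linarith
  have "int p dvd (\<Sum>j<e. int (Suc e choose j) * (\<Sum>a<p. int a ^ j))"
  proof (rule dvd_sum)
    fix j assume "j \<in> {..<e}"
    hence "[(\<Sum>a<p. int a ^ j) = 0] (mod int p)" using less.prems by (intro less.IH) auto
    thus "int p dvd int (Suc e choose j) * (\<Sum>a<p. int a ^ j)" by (intro dvd_mult) (simp only: cong_0_iff)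
  qed
  hence "int p dvd int (Suc e) * (\<Sum>a<p. int a ^ e)" unfolding eq by (intro dvd_diff) simp_all
  moreover have "\<not> int p dvd int (Suc e)" using less.prems by (simp only: int_dvd_int_iff) (auto dest: dvd_imp_le)
  ultimately show ?case using p prime_dvd_multD[of "int p"] by (auto simp: cong_0_iff)
qed

definition box :: "nat \<Rightarrow> nat \<Rightarrow> (nat \<Rightarrow> int) set" where
  "box p n = {..<n} \<rightarrow>\<^sub>E int ` {..<p}"

text \<open>The sum of a monomial over the box is a product of power sums. A degree below
  \<open>n * (p - 1)\<close> forces some exponent below \<open>p - 1\<close>, whose power sum
  vanishes modulo \<open>p\<close>.\<close>

lemma sum_box_cong_0:
  assumes p: "prime p" and F: "intpoly n d F" and d: "d < n * (p - 1)"
  shows "[(\<Sum>z\<in>box p n. F z) = 0] (mod int p)"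
proof -
  obtain c where c: "F = poly_fun n d c" using F unfolding intpoly_iff by blast
  have m: "int p dvd (\<Sum>z\<in>box p n. mono_eval n e z)" if e: "e \<in> exponents n d" for e
  proof -
    have "(\<Sum>z\<in>box p n. mono_eval n e z) = (\<Prod>i<n. \<Sum>a\<in>int ` {..<p}. a ^ e i)"
      unfolding box_def mono_eval_def by (subst prod_sum_PiE) auto
    also have "\<dots> = (\<Prod>i<n. \<Sum>a<p. int a ^ e i)" by (simp add: sum.reindex)
    finally have eq: "(\<Sum>z\<in>box p n. mono_eval n e z) = (\<Prod>i<n. \<Sum>a<p. int a ^ e i)" .
    have "\<exists>i<n. e i < p - 1"
    proof (rule ccontr)
      assume "\<not> ?thesis"
      hence "(\<Sum>i<n. p - 1) \<le> (\<Sum>i<n. e i)" by (intro sum_mono) (meson lessThan_iff not_less)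
      thus False using e d by (simp add: exponents_def)
    qed
    then obtain i where i: "i < n" "e i < p - 1" by blast
    have "int p dvd (\<Sum>a<p. int a ^ e i)" using sum_powers_cong_0[OF p i(2)] by (simp add: cong_0_iff)
    moreover have "(\<Sum>a<p. int a ^ e i) dvd (\<Prod>i<n. \<Sum>a<p. int a ^ e i)"
      using i(1) by (intro dvd_prodI) auto
    ultimately show ?thesis unfolding eq by (rule dvd_trans)
  qed
  have "(\<Sum>z\<in>box p n. F z) = (\<Sum>e\<in>exponents n d. c e * (\<Sum>z\<in>box p n. mono_eval n e z))"
    unfolding c by (subst sum.swap) (simp only: sum_distrib_left)
  moreover have "int p dvd \<dots>" by (intro dvd_sum dvd_mult m)
  ultimately show ?thesis by (simp add: cong_0_iff)
qed

lemma fermat_int: assumes "prime p" "\<not> int p dvd a" shows "[a ^ (p - 1) = 1] (mod int p)"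
proof -
  define m where "m = nat (a mod int p)"
  have p0: "int p > 0" using assms(1) prime_gt_0_nat by simp
  have am: "[a = int m] (mod int p)" using p0 by (simp add: m_def cong_def)
  have "\<not> p dvd m" using am assms(2) by (metis cong_dvd_iff cong_sym int_dvd_int_iff)
  hence "[m ^ (p - 1) = 1] (mod p)" by (rule fermat_theorem[OF assms(1)])
  hence "[int (m ^ (p - 1)) = int 1] (mod int p)" by (simp only: cong_int_iff)
  hence "[int m ^ (p - 1) = 1] (mod int p)" by simp
  thus ?thesis using cong_trans[OF cong_pow[OF am]] by blast
qed

text \<open>By Fermat, \<open>1 - F ^ (p - 1)\<close> is modulo \<open>p\<close> the indicator of
  the zeros of \<open>F\<close>, and its degree is below \<open>n * (p - 1)\<close>, so it sums to
  0. If the origin were the only zero, the sum would be 1.\<close>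

lemma chevalley_warning:
  assumes p: "prime p" and F: "intpoly n d F" and d: "d < n" and F0: "int p dvd F (\<lambda>i\<in>{..<n}. 0)"
  shows "\<exists>z\<in>box p n. z \<noteq> (\<lambda>i\<in>{..<n}. 0) \<and> int p dvd F z"
proof (rule ccontr)
  assume neg: "\<not> ?thesis"
  let ?o = "\<lambda>i\<in>{..<n}. 0 :: int"
  have p1: "p > 1" using p prime_gt_1_nat by blast
  have o: "?o \<in> box p n" using p1 by (auto simp: box_def intro: image_eqI[of _ _ 0])
  have fin: "finite (box p n)" unfolding box_def by (intro finite_PiE) auto
  have "intpoly n (0 + (p - 1) * d) (\<lambda>x. 1 + (-1) * F x ^ (p - 1))"
    by (intro intpoly_add intpoly_const) (use intpoly_cmult[OF intpoly_power[OF F, of "p - 1"], of "- 1"] in simp)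
  hence "[(\<Sum>z\<in>box p n. 1 + (-1) * F z ^ (p - 1)) = 0] (mod int p)"
    using d p1 by (intro sum_box_cong_0[OF p]) (auto simp: mult.commute)
  moreover have "[(\<Sum>z\<in>box p n. 1 + (-1) * F z ^ (p - 1)) = (\<Sum>z\<in>box p n. if z = ?o then 1 else 0)] (mod int p)"
  proof (rule cong_sum)
    fix z assume z: "z \<in> box p n"
    show "[1 + (-1) * F z ^ (p - 1) = (if z = ?o then 1 else 0)] (mod int p)"
    proof (cases "z = ?o")
      case True
      have "int p dvd F z ^ (p - 1)" using F0 p1 True by (intro dvd_power_le[where n = 1, simplified] dvd_power_iff) (auto intro: dvd_power_le dvd_trans[OF _ dvd_power])
      thus ?thesis using True by (simp add: cong_iff_dvd_diff)
    next
      case False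
      hence "\<not> int p dvd F z" using neg z by blast
      hence "[1 + (-1) * F z ^ (p - 1) = 1 + (-1) * 1] (mod int p)"
        by (intro cong_add cong_mult cong_refl fermat_int[OF p])
      thus ?thesis using False by simp
    qed
  qed
  moreover have "(\<Sum>z\<in>box p n. if z = ?o then 1 else 0 :: int) = 1" using o fin by simp
  ultimately have "[1 = 0] (mod int p)" by (metis cong_sym cong_trans)
  thus False using p1 by (simp add: cong_0_iff)
qed

abbreviation quartic5 :: "(nat \<Rightarrow> nat \<Rightarrow> nat \<Rightarrow> nat \<Rightarrow> nat) \<Rightarrow> (nat \<Rightarrow> nat) \<Rightarrow> nat" where
  "quartic5 c z \<equiv> \<Sum>i<5. \<Sum>j<5. \<Sum>k<5. \<Sum>l<5. c i j k l * (z i * z j * z k * z l)"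

text \<open>Degree four against five variables. Coefficients and solution are natural numbers
  because they are to act through \<open>nsm\<close>.\<close>

lemma quartic_form_zero:
  fixes c :: "nat \<Rightarrow> nat \<Rightarrow> nat \<Rightarrow> nat \<Rightarrow> nat"
  assumes p: "prime p"
  shows "\<exists>z :: nat \<Rightarrow> nat. (\<forall>i<5. z i < p) \<and> (\<exists>i<5. z i \<noteq> 0) \<and>
    p dvd quartic5 c z"
proof -
  define F :: "(nat \<Rightarrow> int) \<Rightarrow> int" where
    "F x = (\<Sum>i<5. \<Sum>j<5. \<Sum>k<5. \<Sum>l<5. int (c i j k l) * (x i * x j * x k * x l))" for x
  have mon: "intpoly 5 4 (\<lambda>x. x i * x j * x k * x l)" if "i < 5" "j < 5" "k < 5" "l < 5" for i j k l
  proof -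
    have co: "intpoly 5 1 (\<lambda>x. x m)" if "m < 5" for m using intpoly_coord[OF that] by simp
    have "intpoly 5 (1 + 1 + 1 + 1) (\<lambda>x. x i * x j * x k * x l)"
      by (intro intpoly_mult co that)
    moreover have "1 + 1 + 1 + 1 = (4 :: nat)" by simp
    ultimately show ?thesis by (simp only:)
  qed
  have "intpoly 5 4 F" unfolding F_def
    by (rule intpoly_sum, rule intpoly_sum, rule intpoly_sum, rule intpoly_sum, rule intpoly_cmult, rule mon) auto
  moreover have "F (\<lambda>i\<in>{..<5}. 0) = 0" by (simp add: F_def)
  ultimately obtain z where z: "z \<in> box p 5" "z \<noteq> (\<lambda>i\<in>{..<5}. 0)" "int p dvd F z"
    using chevalley_warning[OF p, of 5 4 F] by auto
  define w where "w i = nat (z i)" for i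
  have zi: "z i = int (w i)" "w i < p" if "i < 5" for i
  proof -
    have "z i \<in> int ` {..<p}" using z(1) that by (auto simp: box_def PiE_iff)
    thus "z i = int (w i)" "w i < p" by (auto simp: w_def)
  qed
  have "\<exists>i<5. w i \<noteq> 0"
  proof (rule ccontr)
    assume neg: "\<not> ?thesis"
    have "z = (\<lambda>i\<in>{..<5}. 0)"
    proof
      fix i show "z i = (\<lambda>i\<in>{..<5}. 0) i"
        using neg zi(1)[of i] z(1) by (cases "i < 5") (auto simp: box_def PiE_iff extensional_def)
    qed
    thus False using z(2) by blast
  qed
  moreover have "F z = int (quartic5 c w)"
    unfolding F_def of_nat_sum by (intro sum.cong refl) (simp add: zi)
  hence "p dvd quartic5 c w"
    using z(3) by (simp only: int_dvd_int_iff)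
  ultimately show ?thesis using zi(2) by blast
qed

section \<open>Isotropic subspaces\<close>

context quadrilinear
begin

text \<open>The image lies among the at most \<open>p\<close> multiples of \<open>g\<close>, and no
  fibre is larger than the kernel.\<close>

lemma kernel_index:
  assumes K: "sg K" and f: "addv f" and r: "\<And>u. u \<in> K \<Longrightarrow> \<exists>k. f u = nsm k g"
  shows "card K \<le> p * card {u \<in> K. f u = 0}"
proof -
  have finK: "finite K" using sg_fin K by blast
  have KV: "\<And>t. t \<in> K \<Longrightarrow> t \<in> V" using K sg_subV by blast
  have "f ` K \<subseteq> (\<lambda>k. nsm k g) ` {..<p}"
  proof
    fix t assume "t \<in> f ` K"
    then obtain u where "u \<in> K" "t = f u" by blast
    then obtain k where "t = nsm k g" using r by blast
    hence "t = nsm (k mod p) g" using nsm_mod_gen[OF exp_g, of k] by metis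
    moreover have "k mod p \<in> {..<p}" using p_pos by simp
    ultimately show "t \<in> (\<lambda>k. nsm k g) ` {..<p}" by blast
  qed
  hence "card (f ` K) \<le> card ((\<lambda>k. nsm k g) ` {..<p})" by (intro card_mono) auto
  also have "\<dots> \<le> p" using card_image_le[of "{..<p}" "\<lambda>k. nsm k g"] by simp
  finally have c: "card (f ` K) \<le> p" .
  have fib: "card {u \<in> K. f u = t} \<le> card {u \<in> K. f u = 0}" if t: "t \<in> f ` K" for t
  proof -
    obtain y where y: "y \<in> K" "f y = t" using t by auto
    have "u - y \<in> K \<and> f (u - y) = 0" if "u \<in> K" "f u = t" for u
      using that y sg_diff[OF K] addv_diff[OF f] KV by simp
    hence "(\<lambda>u. u - y) ` {u \<in> K. f u = t} \<subseteq> {u \<in> K. f u = 0}" by blast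
    moreover have "inj_on (\<lambda>u. u - y) {u \<in> K. f u = t}" by (auto simp: inj_on_def)
    moreover have "finite {u \<in> K. f u = 0}" using finK by simp
    ultimately show ?thesis using card_inj_on_le by blast
  qed
  have "card K = (\<Sum>t\<in>f ` K. card {u \<in> K. f u = t})"
    using sum.image_gen[OF finK, of "\<lambda>_. 1" f] unfolding card_eq_sum .
  also have "\<dots> \<le> (\<Sum>t\<in>f ` K. card {u \<in> K. f u = 0})" by (intro sum_mono fib)
  also have "\<dots> \<le> p * card {u \<in> K. f u = 0}" using c by simp
  finally show ?thesis .
qed

definition self_van :: "'a \<Rightarrow> 'a set \<Rightarrow> bool" where
  "self_van v U \<longleftrightarrow> van3 v U \<and> van2 v U \<and> van1 v U"

text \<open>\<open>m + 1\<close> translates of a set of density at least \<open>1 / m\<close> cannot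
  be pairwise disjoint.\<close>

lemma translates_meet:
  assumes U: "sg U" and G: "G \<subseteq> U" "card U \<le> m * card G" and s: "\<And>l. l \<le> m \<Longrightarrow> \<sigma> l \<in> U"
  obtains l l' x x' where "l < l'" "l' \<le> m" "x \<in> G" "x' \<in> G" "\<sigma> l' - \<sigma> l = x - x'"
proof -
  let ?f = "\<lambda>(l, x). \<sigma> l + x"
  have finU: "finite U" using sg_fin U by blast
  have finG: "finite G" using G finU finite_subset by blast
  have "\<not> inj_on ?f ({..m} \<times> G)"
  proof
    assume "inj_on ?f ({..m} \<times> G)"
    moreover have "?f ` ({..m} \<times> G) \<subseteq> U" using s G sg_add[OF U] by auto
    ultimately have "card ({..m} \<times> G) \<le> card U" using finU card_inj_on_le by blast
    hence "Suc m * card G \<le> m * card G" using G by (simp add: card_cartesian_product)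
    hence "card G = 0" by simp
    thus False using G sg_card_pos[OF U] by simp
  qed
  then obtain l l' x x' where *: "l \<le> m" "l' \<le> m" "x \<in> G" "x' \<in> G" "\<sigma> l + x = \<sigma> l' + x'" "(l, x) \<noteq> (l', x')"
    unfolding inj_on_def by auto
  have "l \<noteq> l'" using * by auto
  moreover have "\<sigma> l' - \<sigma> l = x - x'" "\<sigma> l - \<sigma> l' = x' - x" using *(5) by (simp_all add: algebra_simps)
  ultimately show ?thesis using that[of l l' x x'] that[of l' l x' x] * by (cases "l < l'") auto
qed

text \<open>A good \<open>w\<close> has a dense set of \<open>x\<close> for which
  \<open>T w x\<close> has a large radical on \<open>U1\<close>. Two of the prefix sums attached to
  \<open>w\<close> differ by some \<open>x - x'\<close> from this set, so for this difference
  \<open>v\<close> the radical of \<open>T w v\<close> is large, and \<open>block_chain\<close>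
  passes this on to \<open>T v v\<close>. As the good \<open>w\<close> is not known in advance, all
  nonzero vectors of a whole space \<open>Z\<close> are prepared.\<close>

lemma self_vanishing_step:
  assumes U: "sg U" and b: "biased E U U U U" and E: "E > 0" and big: "p ^ self_bound E \<le> card U"
  obtains v U' where "v \<in> U" "sg U'" "U' \<subseteq> U" "v \<notin> U'" "self_van v U'" "card U \<le> p ^ self_bound E * card U'"
proof -
  let ?K = "2 * E * (4 * E * step_bound E)"
  have "p ^ ?K \<le> card U"
    using big power_increasing[of ?K "self_bound E" p] p_pos unfolding self_bound_def by linarith
  moreover have m4: "0 < 4 * E" using E by simp
  ultimately obtain Z U1 where Z: "sg Z" "Z \<subseteq> U" "card Z = p ^ (2 * E)" and U1: "sg U1" "U1 \<subseteq> U"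
      "card U \<le> p ^ ?K * card U1"
    and ZP: "\<And>w. w \<in> Z \<Longrightarrow> w \<noteq> 0 \<Longrightarrow> \<exists>\<sigma>. diagonal_differences (4 * E) U U1 w \<sigma>"
    using block_chain[OF m4 U b, of "2 * E"] by blast
  have UV: "\<And>t. t \<in> U \<Longrightarrow> t \<in> V" using U sg_subV by blast
  have U1V: "\<And>t. t \<in> U1 \<Longrightarrow> t \<in> V" using U1 UV by blast
  have fin: "finite U" "finite U1" "finite Z" using sg_fin U U1 Z by auto
  have pos: "card U > 0" "card U1 > 0" using sg_card_pos U U1 by auto
  \<comment> \<open>The slots get different spaces: \<open>Z\<close> supplies \<open>w\<close>, the
    pigeonhole needs \<open>x\<close> from all of \<open>U\<close>, and the last two arguments are
    only wanted in the tail \<open>U1\<close>.\<close>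
  have bias: "biased E Z U U1 U1" using biased_restrict[OF b U] Z U U1 by blast
  let ?f = "\<lambda>w. \<Sum>x\<in>U. \<Sum>u\<in>U1. zT U1 w x u"
  let ?G = "{w \<in> Z. card U * card U1 \<le> 2 * E * ?f w}"
  have "card Z \<le> 2 * E * card ?G"
  proof (rule averaging[OF fin(3)])
    fix w
    have "?f w \<le> (\<Sum>x\<in>U. \<Sum>u\<in>U1. 1)" by (intro sum_mono) (auto simp: zT_def)
    thus "?f w \<le> card U * card U1" by simp
  next
    show "card U * card U1 * card Z \<le> E * sum ?f Z" using bias by (simp add: biased_def mult_ac)
  qed (use pos in auto)
  \<comment> \<open>The reason for \<open>2 * E\<close> blocks: a fraction
    \<open>1 / (2 * E)\<close> of \<open>Z\<close> then contains a nonzero vector.\<close>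
  moreover have "2 * E < card Z"
  proof -
    have "2 * E < 2 ^ (2 * E)" by (rule less_exp)
    also have "\<dots> \<le> p ^ (2 * E)" using p_ge2 by (rule power_mono) simp
    finally show ?thesis using Z by simp
  qed
  ultimately have "\<not> card ?G \<le> 1" using mult_le_mono2[of "card ?G" 1 "2 * E"] by linarith
  hence "\<not> ?G \<subseteq> {0}" using card_mono[of "{0}" ?G] by auto
  then obtain w where w: "w \<in> Z" "card U * card U1 \<le> 2 * E * ?f w" "w \<noteq> 0" by blast
  have wV: "w \<in> V" using w Z UV by blast
  define N where "N x = {u \<in> U1. \<forall>d\<in>U1. T w x u d = 0}" for x
  let ?G2 = "{x \<in> U. card U1 \<le> 2 * (2 * E) * card (N x)}"
  have "card U \<le> 2 * (2 * E) * card ?G2"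
  proof (rule averaging[OF fin(1)])
    fix x
    show "card (N x) \<le> card U1" using fin by (intro card_mono) (auto simp: N_def)
  next
    show "card U1 * card U \<le> 2 * E * (\<Sum>x\<in>U. card (N x))"
      using w(2) fin by (simp add: sum_zT N_def mult_ac)
  qed (use pos in auto)
  hence cG2: "card U \<le> (4 * E) * card ?G2" by simp
  obtain \<sigma> where \<sigma>: "diagonal_differences (4 * E) U U1 w \<sigma>" using ZP w by blast
  have sU: "\<And>l. l \<le> 4 * E \<Longrightarrow> \<sigma> l \<in> U" using \<sigma> unfolding diagonal_differences_def by blast
  \<comment> \<open>There are \<open>4 * E + 1\<close> prefix sums against a density of
    \<open>1 / (4 * E)\<close>, which fixes the length of a block.\<close>
  obtain l l' x x' where l: "l < l'" "l' \<le> 4 * E" and x: "x \<in> ?G2" "x' \<in> ?G2" "\<sigma> l' - \<sigma> l = x - x'"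
    using translates_meet[OF U _ cG2, of \<sigma>] sU by blast
  define v where "v = \<sigma> l' - \<sigma> l"
  have v: "v \<in> U" "v \<notin> U1" "van3 v U1"
    and v2: "\<And>u d. u \<in> U1 \<Longrightarrow> d \<in> U1 \<Longrightarrow> T w v u d = 0 \<Longrightarrow> T v v u d = 0"
    using \<sigma> l sg_diff[OF U sU sU, of l' l] unfolding diagonal_differences_def v_def by simp_all
  have vV: "v \<in> V" "x \<in> V" "x' \<in> V" using v x UV by auto
  have sgN: "sg (N y)" if "y \<in> V" for y
    unfolding N_def using that wV U1V
    by (intro sg_zeros[OF U1(1), where f = "\<lambda>d u. T w y u d"]) (auto intro!: T_addv3)
  define K where "K = {u \<in> U1. \<forall>d\<in>U1. T v v u d = 0}"
  have sgK: "sg K" unfolding K_def using vV U1V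
    by (intro sg_zeros[OF U1(1), where f = "\<lambda>d u. T v v u d"]) (auto intro!: T_addv3)
  have "N x \<inter> N x' \<subseteq> K"
  proof
    fix u assume u: "u \<in> N x \<inter> N x'"
    have "T w v u d = 0" if "d \<in> U1" for d
    proof -
      have "T w v u d = T w x u d - T w x' u d"
        unfolding v_def x(3) using u that U1V by (intro addv_diff[OF T_addv2]) (auto simp: wV vV N_def)
      thus ?thesis using u that by (simp add: N_def)
    qed
    thus "u \<in> K" using u v2 by (auto simp: K_def N_def)
  qed
  hence cNK: "card (N x \<inter> N x') \<le> card K" using sg_fin[OF sgK] card_mono by blast
  have "card U1 * card U1 \<le> (4 * E * card (N x)) * (4 * E * card (N x'))"
    using x by (intro mult_mono) auto
  also have "\<dots> = (4 * E) * (4 * E) * (card (N x) * card (N x'))" by simp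
  also have "\<dots> \<le> (4 * E) * (4 * E) * (card U1 * card (N x \<inter> N x'))"
    using card_inter_ge[OF U1(1) sgN sgN] vV by (intro mult_le_mono2) (auto simp: N_def)
  also have "\<dots> \<le> (4 * E) * (4 * E) * (card U1 * card K)" using cNK by (intro mult_le_mono2)
  finally have "card U1 * card U1 \<le> card U1 * ((4 * E) * (4 * E) * card K)" by (simp only: mult_ac)
  hence "card U1 \<le> (4 * E) * (4 * E) * card K" using pos by simp
  also have "\<dots> \<le> (p ^ (4 * E) * p ^ (4 * E)) * card K"
    using nat_le_p_power by (intro mult_le_mono) auto
  also have "p ^ (4 * E) * p ^ (4 * E) = p ^ (8 * E)" by (simp flip: power_add)
  finally have c1: "card U1 \<le> p ^ (8 * E) * card K" .
  \<comment> \<open>With \<open>v\<close> fixed in three slots a single linear condition remains, of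
    index at most \<open>p\<close>.\<close>
  define U' where "U' = {u \<in> K. T v v v u = 0}"
  have c2: "card K \<le> p * card U'" unfolding U'_def
    using vV sg_subV[OF sgK] by (intro kernel_index[OF sgK] T_addv4 T_range) auto
  have sgU': "sg U'" using sg_zeros[OF sgK, of UNIV "\<lambda>_ u. T v v v u"] T_addv4 vV by (simp add: U'_def)
  have sub: "U' \<subseteq> U1" by (auto simp: U'_def K_def)
  have "card U \<le> p ^ ?K * (p ^ (8 * E) * (p * card U'))"
    using U1(3) c1 c2 by (meson le_trans mult_le_mono2)
  also have "\<dots> = p ^ self_bound E * card U'" by (simp add: self_bound_def power_add mult_ac)
  finally have "card U \<le> p ^ self_bound E * card U'" .
  moreover have "van3 v U'" using van3_subset[OF v(3) sub] .
  moreover have "van2 v U'" "van1 v U'" using sub by (auto simp: van2_def van1_def U'_def K_def)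
  ultimately show ?thesis using that[of v U'] v sub sgU' U1 unfolding self_van_def by blast
qed

section \<open>Spaces of self-vanishing vectors\<close>

lemma self_van_nsm:
  assumes "self_van v U" "v \<in> V" "U \<subseteq> V" shows "self_van (nsm c v) U"
proof -
  have n: "nsm c v \<in> V" using sg_nsm[OF sg_V assms(2)] .
  have 1: "T (nsm c v) a b d = nsm c (T v a b d)" if "a \<in> V" "b \<in> V" "d \<in> V" for a b d
    using addv_nsm[OF T_addv1[OF that] assms(2)] .
  have 2: "T v (nsm c v) b d = nsm c (T v v b d)" if "b \<in> V" "d \<in> V" for b d
    using addv_nsm[OF T_addv2[OF assms(2) that] assms(2)] .
  have 3: "T v v (nsm c v) d = nsm c (T v v v d)" if "d \<in> V" for d
    using addv_nsm[OF T_addv3[OF assms(2) assms(2) that] assms(2)] .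
  show ?thesis using assms n unfolding self_van_def van3_def van2_def van1_def
    by (simp add: 1 2 3 subset_iff)
qed

text \<open>In the expansions every term containing \<open>v\<close> has its remaining arguments in
  \<open>U\<close> or again equal to \<open>v\<close>, and symmetry brings the copies of
  \<open>v\<close> to the front. This is where \<open>x \<in> U\<close> enters.\<close>

lemma self_van_add:
  assumes x: "self_van x U'" "x \<in> U" and v: "self_van v U" "v \<in> V" and sub: "U' \<subseteq> U" "U \<subseteq> V"
  shows "self_van (x + v) U'"
proof -
  have xV: "x \<in> V" using x sub by blast
  have V: "\<And>t. t \<in> U' \<Longrightarrow> t \<in> V" "\<And>t. t \<in> U' \<Longrightarrow> t \<in> U" using sub by auto
  have 3: "\<And>a b c. \<lbrakk>a \<in> U; b \<in> U; c \<in> U\<rbrakk> \<Longrightarrow> T v a b c = 0" "\<And>b c. \<lbrakk>b \<in> U; c \<in> U\<rbrakk> \<Longrightarrow> T v v b c = 0"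
    "\<And>c. \<lbrakk>c \<in> U\<rbrakk> \<Longrightarrow> T v v v c = 0"
    using v(1) by (auto simp: self_van_def van3_def van2_def van1_def)
  have x0: "\<And>a b c. \<lbrakk>a \<in> U'; b \<in> U'; c \<in> U'\<rbrakk> \<Longrightarrow> T x a b c = 0" "\<And>b c. \<lbrakk>b \<in> U'; c \<in> U'\<rbrakk> \<Longrightarrow> T x x b c = 0"
    "\<And>c. \<lbrakk>c \<in> U'\<rbrakk> \<Longrightarrow> T x x x c = 0"
    using x(1) by (auto simp: self_van_def van3_def van2_def van1_def)
  have xv: "T x v b c = T v x b c" if "b \<in> V" "c \<in> V" for b c using T_12 xV v(2) that by blast
  have xxv: "T x x v c = T v x x c" if "c \<in> V" for c
    using T_23[OF xV xV v(2) that] T_12[OF xV v(2) xV that] by simp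
  have vxv: "T v x v c = T v v x c" if "c \<in> V" for c
    using T_23[OF v(2) xV v(2) that] by simp
  have add: "x + v \<in> V" using xV v(2) add_V by blast
  have "van3 (x + v) U'" unfolding van3_def using V xV v(2) by (simp add: T_add1 3 x0)
  moreover have "van2 (x + v) U'" unfolding van2_def
    using V xV v(2) add x(2) by (simp add: T_add1 T_add2 3 x0 xv)
  moreover have "van1 (x + v) U'" unfolding van1_def
    using V xV v(2) add x(2) by (simp add: T_add1 T_add2 T_add3 3 x0 xv xxv vxv)
  ultimately show ?thesis by (simp add: self_van_def)
qed

text \<open>\<open>v\<close> is chosen before \<open>X\<close>, which is then built inside the space
  where the forms of \<open>v\<close> vanish, as \<open>self_van_add\<close> requires. The trivial
  intersection with \<open>U'\<close> later ensures that a nonzero vector of \<open>X\<close> is not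
  already in the isotropic subspace.\<close>

lemma self_vanishing_space:
  assumes E: "E > 0"
  shows "\<lbrakk>sg U; biased E U U U U; p ^ (j * self_bound E) \<le> card U\<rbrakk> \<Longrightarrow>
    \<exists>X U'. sg X \<and> X \<subseteq> U \<and> card X = p ^ j \<and> sg U' \<and> U' \<subseteq> U \<and> X \<inter> U' = {0} \<and> (\<forall>x\<in>X. self_van x U') \<and>
      card U \<le> p ^ (j * self_bound E) * card U'"
proof (induction j arbitrary: U)
  case 0
  have "U \<subseteq> V" using 0 by (auto simp: sg_def)
  hence "self_van 0 U" using addv_0[OF T_addv1] zero_V
    unfolding self_van_def van3_def van2_def van1_def by blast
  thus ?case using 0 sg_zero_set sg_zero[OF 0(1)] by (intro exI[of _ "{0}"] exI[of _ U]) auto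
next
  case (Suc j U)
  let ?B = "self_bound E"
  note U = Suc.prems(1)
  have UV: "U \<subseteq> V" using U by (auto simp: sg_def)
  have big: "p ^ (?B + j * ?B) \<le> card U" using Suc.prems(3) by simp
  have "p ^ ?B \<le> card U"
    using big power_increasing[of ?B "?B + j * ?B" p] p_pos by linarith
  then obtain v U1 where v: "v \<in> U" "v \<notin> U1" "self_van v U1" and U1: "sg U1" "U1 \<subseteq> U"
    "card U \<le> p ^ ?B * card U1" using self_vanishing_step[OF U Suc.prems(2) E] by metis
  have "p ^ (j * ?B) \<le> card U1" using index_big[OF big U1(3)] .
  moreover have "biased E U1 U1 U1 U1" using biased_restrict[OF Suc.prems(2) U] U1 by blast
  ultimately obtain X U' where X: "sg X" "X \<subseteq> U1" "card X = p ^ j" "X \<inter> U' = {0}" "\<forall>x\<in>X. self_van x U'"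
    and U': "sg U'" "U' \<subseteq> U1" "card U1 \<le> p ^ (j * ?B) * card U'"
    using Suc.IH[OF U1(1)] by blast
  have vV: "v \<in> V" using v UV by blast
  have U1V: "U1 \<subseteq> V" using U1 UV by blast
  have "self_van (x + nsm c v) U'" if "x \<in> X" for x c
    using self_van_add[of x U' U1 "nsm c v"] self_van_nsm[OF v(3) vV U1V] sg_nsm[OF sg_V vV] that X U' U1V by blast
  hence "\<forall>x\<in>adj X v. self_van x U'" by (auto simp: adj_def)
  moreover have "adj X v \<inter> U' = {0}"
  proof -
    have "t = 0" if t: "t \<in> adj X v" "t \<in> U'" for t
    proof -
      obtain x c where xc: "x \<in> X" "c < p" "t = x + nsm c v" using t by (auto simp: adj_def)
      have "x \<in> U1" "t \<in> U1" using xc X t U' by auto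
      hence "nsm c v \<in> U1" using sg_add_iff[OF U1(1), of x] xc by simp
      hence "c = 0" using nsm_in_sg_iff[OF U1(1) vV, of c] xc v by auto
      thus "t = 0" using xc t X by auto
    qed
    moreover have "0 \<in> adj X v" "0 \<in> U'" using sg_zero sg_adj[OF X(1) vV] U' by auto
    ultimately show ?thesis by blast
  qed
  moreover have "card (adj X v) = p ^ Suc j" using card_adj[OF X(1) vV] v X by auto
  moreover have "adj X v \<subseteq> U" using adj_least[OF U] X U1 v by blast
  moreover have "card U \<le> p ^ (Suc j * ?B) * card U'" using index_trans[OF U1(3) U'(3)] by simp
  moreover have "U' \<subseteq> U" using U' U1 by blast
  ultimately show ?case using sg_adj[OF X(1) vV] U'(1) by blast
qed

lemma addv_sum:
  assumes "addv f" "finite I" "\<And>i. i \<in> I \<Longrightarrow> x i \<in> V"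
  shows "f (\<Sum>i\<in>I. x i) = (\<Sum>i\<in>I. f (x i))" "(\<Sum>i\<in>I. x i) \<in> V"
proof -
  have "f (\<Sum>i\<in>I. x i) = (\<Sum>i\<in>I. f (x i)) \<and> (\<Sum>i\<in>I. x i) \<in> V"
    using assms(2,3)
  proof (induction I rule: finite_induct)
    case empty thus ?case using addv_0[OF assms(1)] zero_V by simp
  next
    case (insert i I)
    thus ?case using assms(1) add_V by (simp add: addv_def)
  qed
  thus "f (\<Sum>i\<in>I. x i) = (\<Sum>i\<in>I. f (x i))" "(\<Sum>i\<in>I. x i) \<in> V" by auto
qed

section \<open>Zeros of the quartic form on a subspace\<close>

definition independent :: "nat \<Rightarrow> (nat \<Rightarrow> 'a) \<Rightarrow> 'a set \<Rightarrow> bool" where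
  "independent j w Y \<longleftrightarrow> (\<forall>i<j. w i \<in> Y) \<and> (\<forall>z. (\<forall>i<j. z i < p) \<longrightarrow>
    (\<Sum>i<j. nsm (z i) (w i)) \<in> Y \<and> ((\<Sum>i<j. nsm (z i) (w i)) = 0 \<longrightarrow> (\<forall>i<j. z i = 0)))"

lemma independent_vectors:
  assumes X: "sg X"
  shows "p ^ j \<le> card X \<Longrightarrow> \<exists>w Y. sg Y \<and> Y \<subseteq> X \<and> card Y = p ^ j \<and> independent j w Y"
proof (induction j)
  case 0
  thus ?case using sg_zero_set sg_zero[OF X] by (intro exI[of _ "\<lambda>_. 0"] exI[of _ "{0}"]) (auto simp: independent_def)
next
  case (Suc j)
  have lt: "p ^ j < p ^ Suc j" using p_gt1 by simp
  hence "p ^ j \<le> card X" using Suc.prems by linarith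
  then obtain w Y where Y: "sg Y" "Y \<subseteq> X" "card Y = p ^ j" and ind: "independent j w Y"
    using Suc.IH by blast
  have w: "\<And>i. i < j \<Longrightarrow> w i \<in> Y"
    and wY: "\<And>z. \<forall>i<j. z i < p \<Longrightarrow> (\<Sum>i<j. nsm (z i) (w i)) \<in> Y"
    and w0: "\<And>z. \<forall>i<j. z i < p \<Longrightarrow> (\<Sum>i<j. nsm (z i) (w i)) = 0 \<Longrightarrow> \<forall>i<j. z i = 0"
    using ind unfolding independent_def by blast+
  have "card Y < card X" using Y lt Suc.prems by linarith
  then obtain y where y: "y \<in> X" "y \<notin> Y" using Y(2) by (metis less_irrefl subset_antisym subsetI)
  have yV: "y \<in> V" using y X sg_subV by blast
  define w' where "w' = w(j := y)"
  have eq: "(\<Sum>i<Suc j. nsm (z i) (w' i)) = (\<Sum>i<j. nsm (z i) (w i)) + nsm (z j) y" for z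
    by (simp add: w'_def)
  have "(\<Sum>i<Suc j. nsm (z i) (w' i)) \<in> adj Y y \<and>
       ((\<Sum>i<Suc j. nsm (z i) (w' i)) = 0 \<longrightarrow> (\<forall>i<Suc j. z i = 0))" if z: "\<forall>i<Suc j. z i < p" for z
  proof (intro conjI impI)
    have Yz: "(\<Sum>i<j. nsm (z i) (w i)) \<in> Y" using wY z by simp
    show "(\<Sum>i<Suc j. nsm (z i) (w' i)) \<in> adj Y y" unfolding eq using adjI[OF Y(1) yV Yz] .
    assume "(\<Sum>i<Suc j. nsm (z i) (w' i)) = 0"
    hence e: "(\<Sum>i<j. nsm (z i) (w i)) + nsm (z j) y = 0 + nsm 0 y" unfolding eq nsm.simps(1) add_0_left .
    have "z j < p" using z by blast
    from adj_inj[OF Y(1) yV y(2) Yz sg_zero[OF Y(1)] this p_pos e]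
    have "(\<Sum>i<j. nsm (z i) (w i)) = 0" "z j = 0" by blast+
    moreover have "\<forall>i<j. z i < p" using z less_SucI by blast
    ultimately have "\<forall>i<j. z i = 0" "z j = 0" using w0[of z] by blast+
    thus "\<forall>i<Suc j. z i = 0" unfolding less_Suc_eq by blast
  qed
  moreover have "\<forall>i<Suc j. w' i \<in> adj Y y"
    using w adj_sup[OF Y(1) yV] adj_mem[OF Y(1) yV] by (auto simp: w'_def less_Suc_eq)
  moreover have cY: "card (adj Y y) = p ^ Suc j" using card_adj[OF Y(1) yV y(2)] Y by simp
  ultimately have "independent (Suc j) w' (adj Y y)" unfolding independent_def by blast
  thus ?case using sg_adj[OF Y(1) yV] adj_least[OF X Y(2) y(1)] cY by blast
qed

text \<open>In the coordinates of five independent vectors \<open>T v v v v\<close> is a quartic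
  form in five variables, and independence turns its nontrivial zero into a nonzero vector.\<close>

lemma quartic_zero_vector:
  assumes X: "sg X" and c: "p ^ 5 \<le> card X"
  obtains v where "v \<in> X" "v \<noteq> 0" "T v v v v = 0"
proof -
  obtain w Y where Y: "Y \<subseteq> X" and ind: "independent 5 w Y"
    using independent_vectors[OF X c] by blast
  have w: "\<And>i. i < 5 \<Longrightarrow> w i \<in> X"
    and wY: "\<And>z. \<forall>i<5. z i < p \<Longrightarrow> (\<Sum>i<5. nsm (z i) (w i)) \<in> X"
    and w0: "\<And>z. \<forall>i<5. z i < p \<Longrightarrow> (\<Sum>i<5. nsm (z i) (w i)) = 0 \<Longrightarrow> \<forall>i<5. z i = 0"
  proof -
    note i = ind[unfolded independent_def]
    show "w i \<in> X" if "i < 5" for i using i that Y by blast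
    have j: "(\<Sum>i<5. nsm (z i) (w i)) \<in> Y \<and> ((\<Sum>i<5. nsm (z i) (w i)) = 0 \<longrightarrow> (\<forall>i<5. z i = 0))"
      if "\<forall>i<5. z i < p" for z
      by (rule mp[OF spec[OF conjunct2[OF i]] that])
    show "(\<Sum>i<5. nsm (z i) (w i)) \<in> X" if "\<forall>i<5. z i < p" for z
      by (rule subsetD[OF Y conjunct1[OF j[OF that]]])
    show "\<forall>i<5. z i = 0" if "\<forall>i<5. z i < p" "(\<Sum>i<5. nsm (z i) (w i)) = 0" for z
      by (rule mp[OF conjunct2[OF j[OF that(1)]] that(2)])
  qed
  have wV: "w i \<in> V" if "i < 5" for i using w[OF that] X sg_subV by blast
  \<comment> \<open>Discrete logarithms to the base \<open>g\<close>; any choice will do, as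
    \<open>nsm p g = 0\<close>.\<close>
  define cf where "cf i j k l = (SOME c. T (w i) (w j) (w k) (w l) = nsm c g)" for i j k l
  have cf: "T (w i) (w j) (w k) (w l) = nsm (cf i j k l) g" if "i < 5" "j < 5" "k < 5" "l < 5" for i j k l
    unfolding cf_def by (rule someI_ex[OF T_range]) (use that wV in auto)
  obtain z where z: "\<forall>i<5. z i < p" "\<exists>i<5. z i \<noteq> 0"
    "p dvd quartic5 cf z"
    using quartic_form_zero[OF prime_p, of cf] by blast
  define x where "x i = nsm (z i) (w i)" for i
  define v where "v = (\<Sum>i<5. x i)"
  have xV: "x i \<in> V" if "i < 5" for i using wV[OF that] sg_nsm[OF sg_V] by (simp add: x_def)
  have vX: "v \<in> X" unfolding v_def x_def by (rule wY[OF z(1)])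
  have vV: "v \<in> V" using vX X sg_subV by blast
  have v0: "v \<noteq> 0"
  proof
    assume "v = 0"
    hence "(\<Sum>i<5. nsm (z i) (w i)) = 0" unfolding v_def x_def .
    note all = w0[OF z(1) this]
    from z(2) show False
    proof (elim exE conjE)
      fix i assume "i < 5" "z i \<noteq> 0"
      with all show False by simp
    qed
  qed
  have tm: "T (x i) (x j) (x k) (x l) = nsm (cf i j k l * (z i * z j * z k * z l)) g"
    if "i < 5" "j < 5" "k < 5" "l < 5" for i j k l
  proof -
    have "T (x i) (x j) (x k) (x l) = nsm (z i) (T (w i) (x j) (x k) (x l))"
      unfolding x_def[of i] by (rule addv_nsm[OF T_addv1]) (use that xV wV in auto)
    also have "T (w i) (x j) (x k) (x l) = nsm (z j) (T (w i) (w j) (x k) (x l))"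
      unfolding x_def[of j] by (rule addv_nsm[OF T_addv2]) (use that xV wV in auto)
    also have "T (w i) (w j) (x k) (x l) = nsm (z k) (T (w i) (w j) (w k) (x l))"
      unfolding x_def[of k] by (rule addv_nsm[OF T_addv3]) (use that xV wV in auto)
    also have "T (w i) (w j) (w k) (x l) = nsm (z l) (T (w i) (w j) (w k) (w l))"
      unfolding x_def[of l] by (rule addv_nsm[OF T_addv4]) (use that wV in auto)
    also have "nsm (z i) (nsm (z j) (nsm (z k) (nsm (z l) (T (w i) (w j) (w k) (w l)))))
        = nsm (z i * (z j * (z k * (z l * cf i j k l)))) g"
      unfolding cf[OF that] nsm_mult ..
    finally show ?thesis by (simp only: mult_ac)
  qed
  have s1: "T v b c d = (\<Sum>i<5. T (x i) b c d)" if "b \<in> V" "c \<in> V" "d \<in> V" for b c d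
    unfolding v_def by (rule addv_sum(1)[OF T_addv1]) (use that xV in auto)
  have s2: "T a v c d = (\<Sum>i<5. T a (x i) c d)" if "a \<in> V" "c \<in> V" "d \<in> V" for a c d
    unfolding v_def by (rule addv_sum(1)[OF T_addv2]) (use that xV in auto)
  have s3: "T a b v d = (\<Sum>i<5. T a b (x i) d)" if "a \<in> V" "b \<in> V" "d \<in> V" for a b d
    unfolding v_def by (rule addv_sum(1)[OF T_addv3]) (use that xV in auto)
  have s4: "T a b c v = (\<Sum>i<5. T a b c (x i))" if "a \<in> V" "b \<in> V" "c \<in> V" for a b c
    unfolding v_def by (rule addv_sum(1)[OF T_addv4]) (use that xV in auto)
  have "T v v v v = (\<Sum>i<5. T (x i) v v v)" by (rule s1[OF vV vV vV])
  also have "\<dots> = (\<Sum>i<5. \<Sum>j<5. T (x i) (x j) v v)"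
    by (intro sum.cong refl s2) (use vV xV in auto)
  also have "\<dots> = (\<Sum>i<5. \<Sum>j<5. \<Sum>k<5. T (x i) (x j) (x k) v)"
    by (intro sum.cong refl s3) (use vV xV in auto)
  also have "\<dots> = (\<Sum>i<5. \<Sum>j<5. \<Sum>k<5. \<Sum>l<5. T (x i) (x j) (x k) (x l))"
    by (intro sum.cong refl s4) (use vV xV in auto)
  also have "\<dots> = nsm (quartic5 cf z) g"
    unfolding nsm_sum_left by (intro sum.cong refl tm) auto
  also have "\<dots> = nsm 0 g"
    using nsm_mod_gen[OF exp_g, symmetric] unfolding dvd_imp_mod_0[OF z(3), symmetric] .
  finally have "T v v v v = 0" unfolding nsm.simps(1) .
  from that[OF vX v0 this] show ?thesis .
qed

section \<open>Growing an isotropic subspace\<close>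

definition isotropic :: "'a set \<Rightarrow> bool" where
  "isotropic W \<longleftrightarrow> sg W \<and> (\<forall>a\<in>W. \<forall>b\<in>W. \<forall>c\<in>W. \<forall>d\<in>W. T a b c d = 0)"

lemma adj_zero:
  assumes "addv f" "f v = 0" "\<forall>w\<in>W. f w = 0" "sg W" "v \<in> V"
  shows "\<forall>a\<in>adj W v. f a = 0"
proof
  fix a assume "a \<in> adj W v"
  then obtain w c where "w \<in> W" "a = w + nsm c v" by (auto simp: adj_def)
  thus "f a = 0" using assms(1) addv_nsm[OF assms(1,5)] assms sg_subV[OF assms(4)] sg_nsm[OF sg_V assms(5)]
    by (simp add: addv_def)
qed

lemma isotropic_adj:
  assumes W: "isotropic W" and v: "self_van v W" "T v v v v = 0" "v \<in> V"
  shows "isotropic (adj W v)"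
proof -
  have sgW: "sg W" using W by (simp add: isotropic_def)
  have WV: "\<And>w. w \<in> W \<Longrightarrow> w \<in> V" using sg_subV[OF sgW] .
  have adjV: "\<And>w. w \<in> adj W v \<Longrightarrow> w \<in> V" using sg_subV[OF sg_adj[OF sgW v(3)]] .
  \<comment> \<open>Vanishing is checked on the generators \<open>insert v W\<close>, where symmetry
    sorts the copies of \<open>v\<close> to the front, and is then extended additively to
    \<open>adj W v\<close>, one slot at a time.\<close>
  define Y where "Y = insert v W"
  have YV: "\<And>y. y \<in> Y \<Longrightarrow> y \<in> V" using WV v by (auto simp: Y_def)
  have v3: "\<And>a b c. \<lbrakk>a \<in> W; b \<in> W; c \<in> W\<rbrakk> \<Longrightarrow> T v a b c = 0" "\<And>b c. \<lbrakk>b \<in> W; c \<in> W\<rbrakk> \<Longrightarrow> T v v b c = 0"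
    "\<And>c. \<lbrakk>c \<in> W\<rbrakk> \<Longrightarrow> T v v v c = 0"
    using v(1) by (auto simp: self_van_def van3_def van2_def van1_def)
  have w4: "\<And>a b c d. \<lbrakk>a \<in> W; b \<in> W; c \<in> W; d \<in> W\<rbrakk> \<Longrightarrow> T a b c d = 0" using W by (simp add: isotropic_def)
  have s1: "T w v b c = T v w b c" if "w \<in> W" "b \<in> Y" "c \<in> Y" for w b c
    using T_12 WV YV v(3) that by blast
  have s2: "T a w v c = T a v w c" if "w \<in> W" "a \<in> Y" "c \<in> Y" for w a c
    using T_23 WV YV v(3) that by blast
  have s3: "T a b w v = T a b v w" if "w \<in> W" "a \<in> Y" "b \<in> Y" for w a b
    using T_34 WV YV v(3) that by blast
  have vY: "v \<in> Y" and WY: "\<And>w. w \<in> W \<Longrightarrow> w \<in> Y" by (auto simp: Y_def)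
  have base: "T a b c d = 0" if "a \<in> Y" "b \<in> Y" "c \<in> Y" "d \<in> Y" for a b c d
    using that[unfolded Y_def]
    by (elim insertE) (simp_all add: v3 w4 v(2) s1 s2 s3 vY WY)
  let ?A = "adj W v"
  have 4: "T a b c d = 0" if "a \<in> Y" "b \<in> Y" "c \<in> Y" "d \<in> ?A" for a b c d
    using adj_zero[OF T_addv4, of a b c v W] base that YV sgW v(3) vY WY by blast
  have 3: "T a b c d = 0" if "a \<in> Y" "b \<in> Y" "c \<in> ?A" "d \<in> ?A" for a b c d
    using adj_zero[OF T_addv3, of a b d v W] 4 that YV adjV sgW v(3) vY WY by blast
  have 2: "T a b c d = 0" if "a \<in> Y" "b \<in> ?A" "c \<in> ?A" "d \<in> ?A" for a b c d
    using adj_zero[OF T_addv2, of a c d v W] 3 that YV adjV sgW v(3) vY WY by blast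
  have 1: "T a b c d = 0" if "a \<in> ?A" "b \<in> ?A" "c \<in> ?A" "d \<in> ?A" for a b c d
    using adj_zero[OF T_addv1, of b c d v W] 2 that YV adjV sgW v(3) vY WY by blast
  show ?thesis using 1 sg_adj[OF sgW v(3)] by (simp add: isotropic_def)
qed

text \<open>Each dimension costs five self-vanishing ones, among which the quartic equation selects
  \<open>v\<close>. The rest of the isotropic subspace is built inside the tail \<open>U'\<close>,
  where the forms of every such vector vanish.\<close>

lemma isotropic_subspace:
  assumes E: "E > 0"
  shows "\<lbrakk>sg U; biased E U U U U; p ^ (k * (5 * self_bound E)) \<le> card U\<rbrakk> \<Longrightarrow>
    \<exists>W. isotropic W \<and> W \<subseteq> U \<and> card W = p ^ k"
proof (induction k arbitrary: U)
  case 0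
  have "T 0 0 0 0 = 0" using addv_0[OF T_addv1] zero_V by blast
  thus ?case using sg_zero_set sg_zero[OF 0(1)]
    by (intro exI[of _ "{0}"]) (simp add: isotropic_def)
next
  case (Suc k U)
  let ?B = "5 * self_bound E"
  note U = Suc.prems(1)
  have big: "p ^ (?B + k * ?B) \<le> card U" using Suc.prems(3) by simp
  have "p ^ ?B \<le> card U"
    using big power_increasing[of ?B "?B + k * ?B" p] p_pos by linarith
  then obtain X U' where X: "sg X" "X \<subseteq> U" "card X = p ^ 5" "X \<inter> U' = {0}" "\<forall>x\<in>X. self_van x U'"
    and U': "sg U'" "U' \<subseteq> U" "card U \<le> p ^ ?B * card U'"
    using self_vanishing_space[OF E U Suc.prems(2), of 5] by blast
  obtain v where v: "v \<in> X" "v \<noteq> 0" "T v v v v = 0" using quartic_zero_vector[OF X(1)] X(3) by (metis order_refl)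
  have vV: "v \<in> V" using v X sg_subV by blast
  have "p ^ (k * ?B) \<le> card U'" using index_big[OF big U'(3)] .
  moreover have "biased E U' U' U' U'" using biased_restrict[OF Suc.prems(2) U] U' by blast
  ultimately obtain W where W: "isotropic W" "W \<subseteq> U'" "card W = p ^ k" using Suc.IH[OF U'(1)] by blast
  have "self_van v U'" using v(1) X(5) by blast
  hence "self_van v W" using van3_subset[OF _ W(2)] van2_subset[OF _ W(2)] van1_subset[OF _ W(2)]
    unfolding self_van_def by blast
  hence "isotropic (adj W v)" using isotropic_adj[OF W(1) _ v(3) vV] by blast
  moreover have "adj W v \<subseteq> U" using adj_least[OF U] W U' v X by blast
  moreover have "v \<notin> W" using v X W by blast
  hence "card (adj W v) = p ^ Suc k" using card_adj[OF _ vV] W by (simp add: isotropic_def)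
  ultimately show ?case by blast
qed

text \<open>This serves \<open>n\<close> from 5 up to the cost of one inductive step: the required
  dimension bound is positive there, so the zero subspace would not do.\<close>

lemma isotropic_line:
  assumes U: "sg U" and c: "p ^ 5 \<le> card U"
  shows "\<exists>W. isotropic W \<and> W \<subseteq> U \<and> card W = p"
proof -
  obtain v where v: "v \<in> U" "v \<noteq> 0" "T v v v v = 0" using quartic_zero_vector[OF U c] .
  have vV: "v \<in> V" using v U sg_subV by blast
  have z: "isotropic {0}" using sg_zero_set addv_0[OF T_addv1] zero_V by (auto simp: isotropic_def)
  have "T v 0 0 0 = 0" "T v v 0 0 = 0" "T v v v 0 = 0"
    using addv_0[OF T_addv4] vV zero_V by auto
  hence "self_van v {0}" by (simp add: self_van_def van3_def van2_def van1_def)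
  hence "isotropic (adj {0} v)" using isotropic_adj[OF z] v vV by blast
  moreover have "card (adj {0} v) = p" using card_adj[OF sg_zero_set vV] v by simp
  moreover have "adj {0} v \<subseteq> U" using adj_least[OF U] v sg_zero[OF U] by simp
  ultimately show ?thesis by blast
qed

end

section \<open>The form attached to a quartic polynomial\<close>

text \<open>\<open>\<real>/\<int>\<close> is one type that contains a copy of \<open>\<int>/p\<close> for every \<open>p\<close>, so that the spaces
  \<open>\<F>\<^sub>p\<^sup>n\<close> become subgroups of the single type \<open>nat \<Rightarrow> circ\<close>.\<close>

quotient_type circ = real / "\<lambda>x y :: real. x - y \<in> \<int>"
proof (rule equivpI)
  show "reflp (\<lambda>x y :: real. x - y \<in> \<int>)" by (simp add: reflp_def)
  show "symp (\<lambda>x y :: real. x - y \<in> \<int>)" unfolding symp_def using Ints_minus by fastforce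
  show "transp (\<lambda>x y :: real. x - y \<in> \<int>)" unfolding transp_def using Ints_add by fastforce
qed

instantiation circ :: ab_group_add
begin

lift_definition zero_circ :: circ is 0 .

lift_definition plus_circ :: "circ \<Rightarrow> circ \<Rightarrow> circ" is "(+)"
  using Ints_add by (metis add_diff_add)

lift_definition uminus_circ :: "circ \<Rightarrow> circ" is uminus
  using Ints_minus by fastforce

lift_definition minus_circ :: "circ \<Rightarrow> circ \<Rightarrow> circ" is "(-)"
  using Ints_diff by (smt (verit))

instance
  by standard (transfer; simp)+

end

lift_definition frac_circ :: "nat \<Rightarrow> int \<Rightarrow> circ" is "\<lambda>p a. real_of_int a / real p" .

lemma frac_circ_add: "frac_circ p (a + b) = frac_circ p a + frac_circ p b"
  by transfer (simp add: add_divide_distrib)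

lemma frac_circ_0 [simp]: "frac_circ p 0 = 0"
  by transfer simp

lemma nsm_frac_circ: "nsm k (frac_circ p a) = frac_circ p (int k * a)"
  by (induction k) (simp_all add: frac_circ_add[symmetric] algebra_simps)

lemma frac_circ_eq_iff: assumes "p > 0" shows "frac_circ p a = frac_circ p b \<longleftrightarrow> [a = b] (mod int p)"
proof -
  have "frac_circ p a = frac_circ p b \<longleftrightarrow> real_of_int a / real p - real_of_int b / real p \<in> \<int>"
    by transfer simp
  also have "\<dots> \<longleftrightarrow> int p dvd a - b"
  proof
    assume "real_of_int a / real p - real_of_int b / real p \<in> \<int>"
    then obtain k where "real_of_int a / real p - real_of_int b / real p = real_of_int k" by (auto elim: Ints_cases)
    hence "real_of_int (a - b) = real_of_int (int p * k)" using assms by (simp add: field_simps)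
    hence "a - b = int p * k" by (simp only: of_int_eq_iff)
    thus "int p dvd a - b" by simp
  next
    assume "int p dvd a - b"
    then obtain k where "a - b = int p * k" by blast
    hence "real_of_int a - real_of_int b = real p * real_of_int k" by (metis of_int_diff of_int_mult of_int_of_nat_eq)
    hence "real_of_int a / real p - real_of_int b / real p = real_of_int k"
      using assms by (simp add: diff_divide_distrib[symmetric])
    thus "real_of_int a / real p - real_of_int b / real p \<in> \<int>" by simp
  qed
  finally show ?thesis by (simp add: cong_iff_dvd_diff)
qed

lemma frac_circ_eq_0_iff: "p > 0 \<Longrightarrow> frac_circ p a = 0 \<longleftrightarrow> int p dvd a"
  using frac_circ_eq_iff[of p a 0] by (simp add: cong_0_iff)

section \<open>The vector space as a subgroup of a power of the circle group\<close>

definition emb :: "nat \<Rightarrow> nat \<Rightarrow> (nat \<Rightarrow> int) \<Rightarrow> nat \<Rightarrow> circ" where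
  "emb p n x = (\<lambda>i. if i < n then frac_circ p (x i) else 0)"

lemma emb_add: "emb p n (x + y) = emb p n x + emb p n y"
  by (rule ext) (simp add: emb_def frac_circ_add)

lemma emb_eq_iff: "p > 0 \<Longrightarrow> emb p n x = emb p n y \<longleftrightarrow> (\<forall>i<n. [x i = y i] (mod int p))"
  unfolding emb_def fun_eq_iff using frac_circ_eq_iff[of p] by (metis (no_types, lifting))

definition vecs :: "nat \<Rightarrow> nat \<Rightarrow> (nat \<Rightarrow> circ) set" where
  "vecs p n = range (emb p n)"

definition red :: "nat \<Rightarrow> nat \<Rightarrow> (nat \<Rightarrow> int) \<Rightarrow> nat \<Rightarrow> int" where
  "red p n x = (\<lambda>i\<in>{..<n}. x i mod int p)"

lemma box_iff: "x \<in> box p n \<longleftrightarrow> x \<in> extensional {..<n} \<and> reduced p n x"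
proof -
  have "a \<in> int ` {..<p} \<longleftrightarrow> 0 \<le> a \<and> a < int p" for a
  proof
    assume "0 \<le> a \<and> a < int p"
    hence "a = int (nat a)" "nat a \<in> {..<p}" by auto
    thus "a \<in> int ` {..<p}" by blast
  qed auto
  thus ?thesis unfolding box_def PiE_iff by blast
qed

lemma red_box: "p > 0 \<Longrightarrow> red p n x \<in> box p n"
  by (simp add: box_iff red_def)

lemma red_cong: "i < n \<Longrightarrow> [red p n x i = x i] (mod int p)"
  by (simp add: red_def cong_def)

lemma emb_red: "p > 0 \<Longrightarrow> emb p n (red p n x) = emb p n x"
  by (simp add: emb_eq_iff red_cong)

lemma emb_inj: assumes "p > 0" shows "inj_on (emb p n) (box p n)"
proof (rule inj_onI)
  fix x y assume xy: "x \<in> box p n" "y \<in> box p n" "emb p n x = emb p n y"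
  have "x i = y i" if "i < n" for i
  proof -
    have "[x i = y i] (mod int p)" using xy(3) that emb_eq_iff[OF assms] by blast
    moreover have "0 \<le> x i" "x i < int p" "0 \<le> y i" "y i < int p" using xy(1,2) that unfolding box_iff by blast+
    ultimately show ?thesis by (rule cong_less_imp_eq_int[rotated -1])
  qed
  thus "x = y" using xy(1,2) unfolding box_iff by (intro extensionalityI[of x "{..<n}" y]) auto
qed

lemma vecs_eq_image: assumes "p > 0" shows "vecs p n = emb p n ` box p n"
proof
  show "vecs p n \<subseteq> emb p n ` box p n"
    unfolding vecs_def using emb_red[OF assms] red_box[OF assms] by (metis image_subsetI imageI)
qed (auto simp: vecs_def)

lemma card_box: "card (box p n) = p ^ n"
  unfolding box_def by (subst card_PiE) (simp_all add: card_image)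

lemma card_vecs: "p > 0 \<Longrightarrow> card (vecs p n) = p ^ n"
  using vecs_eq_image card_image[OF emb_inj] card_box by metis

lemma pgroup_vecs: assumes p: "prime p" shows "pgroup p (vecs p n)"
proof
  note p0 = prime_gt_0_nat[OF p]
  show "prime p" by (rule p)
  show "finite (vecs p n)" using card_vecs[OF p0, of n] p0 by (metis card.infinite power_eq_0_iff less_irrefl)
  have "emb p n 0 = 0" by (rule ext) (simp add: emb_def)
  thus "0 \<in> vecs p n" unfolding vecs_def by (metis rangeI)
  fix x y assume "x \<in> vecs p n" "y \<in> vecs p n"
  then obtain u v where "x = emb p n u" "y = emb p n v" unfolding vecs_def by blast
  thus "x + y \<in> vecs p n" unfolding vecs_def using emb_add by (metis rangeI)
next
  note p0 = prime_gt_0_nat[OF p]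
  have nsm_fun: "nsm k f i = nsm k (f i)" for k and f :: "nat \<Rightarrow> circ" and i by (induction k) simp_all
  fix x assume "x \<in> vecs p n"
  then obtain u where u: "x = emb p n u" unfolding vecs_def by blast
  have "nsm p (frac_circ p a) = 0" for a using frac_circ_eq_0_iff[OF p0] by (simp add: nsm_frac_circ)
  thus "nsm p x = 0" unfolding u by (intro ext) (simp add: nsm_fun emb_def)
qed

section \<open>The fourth derivative as a symmetric 4-linear form\<close>

definition dform :: "((nat \<Rightarrow> int) \<Rightarrow> int) \<Rightarrow> (nat \<Rightarrow> int) \<Rightarrow> (nat \<Rightarrow> int) \<Rightarrow> (nat \<Rightarrow> int) \<Rightarrow> (nat \<Rightarrow> int) \<Rightarrow> int" where
  "dform F a b c d = delta a (delta b (delta c (delta d F))) 0"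

lemma delta_commute: "delta a (delta b F) = delta b (delta a F)"
  unfolding delta_def by (rule ext) (simp add: add_ac)

lemma dform_12: "dform F a b c d = dform F b a c d"
  unfolding dform_def by (subst delta_commute) (rule refl)

lemma dform_23: "dform F a b c d = dform F a c b d"
  unfolding dform_def by (subst delta_commute[of b c]) (rule refl)

lemma dform_34: "dform F a b c d = dform F a b d c"
  unfolding dform_def by (subst delta_commute[of c d]) (rule refl)

text \<open>The defect of additivity is a fifth difference: \<open>G (x + y) - G 0\<close> is
  \<open>delta x G 0 + delta y G 0\<close> plus \<open>delta y (delta x G) 0\<close>, where
  \<open>G\<close> is already a third difference.\<close>

lemma dform_add:
  assumes F: "dd p 5 F"
  shows "[dform F (x + y) b c d = dform F x b c d + dform F y b c d] (mod int p)"
proof -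
  define G where "G = delta b (delta c (delta d F))"
  have "(5 :: nat) = Suc (Suc (Suc (Suc (Suc 0))))" by simp
  hence "dd p (Suc (Suc (Suc (Suc (Suc 0))))) F" using F by (simp only:)
  hence "dd p (Suc 0) (delta x G)" unfolding G_def by (simp only: dd.simps simp_thms)
  hence "[delta y (delta x G) 0 = 0] (mod int p)" by (simp only: dd.simps simp_thms)
  hence "[(dform F x b c d + dform F y b c d) + delta y (delta x G) 0
      = (dform F x b c d + dform F y b c d) + 0] (mod int p)" by (rule cong_add[OF cong_refl])
  moreover have "dform F (x + y) b c d = (dform F x b c d + dform F y b c d) + delta y (delta x G) 0"
    unfolding dform_def G_def[symmetric] by (simp add: delta_def[of _ G] delta_def[of _ "delta x G"] add_ac)
  ultimately show ?thesis by (simp only: add_0_right)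
qed

lemma dform_cong1:
  assumes F: "class_fun p n F" and ab: "\<forall>i<n. [a i = a' i] (mod int p)"
  shows "[dform F a b c d = dform F a' b c d] (mod int p)"
proof -
  have G: "class_fun p n (delta b (delta c (delta d F)))" by (intro class_fun_delta F)
  have "\<forall>i<n. [(0 + a) i = (0 + a') i] (mod int p)" using ab by simp
  thus ?thesis unfolding dform_def delta_def[of _ "delta b (delta c (delta d F))"]
    using G unfolding class_fun_def by (intro cong_diff cong_refl) blast
qed

lemma dform_cong:
  assumes F: "class_fun p n F" and "\<forall>i<n. [a i = a' i] (mod int p)" "\<forall>i<n. [b i = b' i] (mod int p)"
    "\<forall>i<n. [c i = c' i] (mod int p)" "\<forall>i<n. [d i = d' i] (mod int p)"
  shows "[dform F a b c d = dform F a' b' c' d'] (mod int p)"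
proof -
  have "[dform F a b c d = dform F a' b c d] (mod int p)" by (rule dform_cong1[OF F assms(2)])
  also have "dform F a' b c d = dform F b a' c d" by (rule dform_12)
  also have "[\<dots> = dform F b' a' c d] (mod int p)" by (rule dform_cong1[OF F assms(3)])
  also have "dform F b' a' c d = dform F c b' a' d" by (metis dform_12 dform_23)
  also have "[\<dots> = dform F c' b' a' d] (mod int p)" by (rule dform_cong1[OF F assms(4)])
  also have "dform F c' b' a' d = dform F d c' b' a'" by (metis dform_12 dform_23 dform_34)
  also have "[\<dots> = dform F d' c' b' a'] (mod int p)" by (rule dform_cong1[OF F assms(5)])
  also have "dform F d' c' b' a' = dform F a' b' c' d'" by (metis dform_12 dform_23 dform_34)
  finally show ?thesis .
qed

definition rep :: "nat \<Rightarrow> nat \<Rightarrow> (nat \<Rightarrow> circ) \<Rightarrow> nat \<Rightarrow> int" where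
  "rep p n v = inv_into (box p n) (emb p n) v"

lemma emb_rep: "p > 0 \<Longrightarrow> v \<in> vecs p n \<Longrightarrow> emb p n (rep p n v) = v"
  unfolding rep_def by (simp add: vecs_eq_image f_inv_into_f)

lemma rep_emb_cong: assumes "p > 0" shows "\<forall>i<n. [rep p n (emb p n x) i = x i] (mod int p)"
  using emb_rep[OF assms, of "emb p n x" n] emb_eq_iff[OF assms] unfolding vecs_def by blast

text \<open>The representatives are arbitrary; \<open>cform_emb\<close> shows that for class
  functions the choice does not matter.\<close>

definition cform :: "nat \<Rightarrow> nat \<Rightarrow> ((nat \<Rightarrow> int) \<Rightarrow> int) \<Rightarrow> (nat \<Rightarrow> circ) \<Rightarrow> (nat \<Rightarrow> circ) \<Rightarrow> (nat \<Rightarrow> circ) \<Rightarrow> (nat \<Rightarrow> circ) \<Rightarrow> circ" where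
  "cform p n F a b c d = frac_circ p (dform F (rep p n a) (rep p n b) (rep p n c) (rep p n d))"

lemma cform_emb:
  assumes "p > 0" "class_fun p n F"
  shows "cform p n F (emb p n a) (emb p n b) (emb p n c) (emb p n d) = frac_circ p (dform F a b c d)"
  unfolding cform_def frac_circ_eq_iff[OF assms(1)]
  by (rule dform_cong[OF assms(2)]) (rule rep_emb_cong[OF assms(1)])+

lemma quadrilinear_cform:
  assumes p: "prime p" and F: "class_fun p n F" "dd p 5 F"
  shows "quadrilinear p (vecs p n) (cform p n F) (frac_circ p 1)"
proof -
  note p0 = prime_gt_0_nat[OF p]
  interpret pgroup p "vecs p n" by (rule pgroup_vecs[OF p])
  show ?thesis
  proof
    fix x y b c d assume v: "x \<in> vecs p n" "y \<in> vecs p n" "b \<in> vecs p n" "c \<in> vecs p n" "d \<in> vecs p n"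
    obtain x' where x: "x = emb p n x'" using v(1) unfolding vecs_def by blast
    obtain y' where y: "y = emb p n y'" using v(2) unfolding vecs_def by blast
    obtain b' where b: "b = emb p n b'" using v(3) unfolding vecs_def by blast
    obtain c' where c: "c = emb p n c'" using v(4) unfolding vecs_def by blast
    obtain d' where d: "d = emb p n d'" using v(5) unfolding vecs_def by blast
    show "cform p n F (x + y) b c d = cform p n F x b c d + cform p n F y b c d"
      unfolding x y b c d emb_add[symmetric] cform_emb[OF p0 F(1)] frac_circ_add[symmetric] frac_circ_eq_iff[OF p0]
      by (rule dform_add[OF F(2)])
  next
    fix a b c d
    show "cform p n F a b c d = cform p n F b a c d" unfolding cform_def by (subst dform_12) (rule refl)
    show "cform p n F a b c d = cform p n F a c b d" unfolding cform_def by (subst dform_23) (rule refl)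
    show "cform p n F a b c d = cform p n F a b d c" unfolding cform_def by (subst dform_34) (rule refl)
    show "\<exists>k. cform p n F a b c d = nsm k (frac_circ p 1)"
    proof -
      have "frac_circ p m = nsm (nat (m mod int p)) (frac_circ p 1)" for m
        using p0 by (simp add: nsm_frac_circ frac_circ_eq_iff[OF p0] cong_def)
      thus ?thesis unfolding cform_def by blast
    qed
  next
    show "nsm p (frac_circ p 1) = 0" by (simp add: nsm_frac_circ frac_circ_eq_0_iff[OF p0])
  qed
qed

section \<open>Linear algebra over the prime field\<close>

lemma Fp_vectorspace:
  assumes p: "prime p" shows "vectorspace (Fp p) (Fn p n)"
proof -
  interpret residues_prime p "Fp p" by unfold_locales (rule p)
  show ?thesis unfolding vectorspace_def Fn_def using func_space_is_module is_field by blast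
qed

lemma Fn_simps:
  assumes p: "prime p"
  shows "carrier (Fn p n) = box p n"
    and "x \<oplus>\<^bsub>Fn p n\<^esub> y = red p n (x + y)"
    and "\<zero>\<^bsub>Fn p n\<^esub> = red p n 0"
    and "c \<odot>\<^bsub>Fn p n\<^esub> x = red p n (\<lambda>i. c * x i)"
proof -
  interpret residues_prime p "Fp p" by unfold_locales (rule p)
  note d = Fn_def func_space_def
  have "{0..int p - 1} = int ` {..<p}"
  proof
    show "{0..int p - 1} \<subseteq> int ` {..<p}"
    proof
      fix a assume "a \<in> {0..int p - 1}"
      hence "a = int (nat a)" "nat a \<in> {..<p}" by auto
      thus "a \<in> int ` {..<p}" by blast
    qed
  qed auto
  thus "carrier (Fn p n) = box p n" unfolding d box_def by (simp add: residue_ring_def)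
  show "x \<oplus>\<^bsub>Fn p n\<^esub> y = red p n (x + y)" unfolding d red_def by (simp add: residue_ring_def)
  show "\<zero>\<^bsub>Fn p n\<^esub> = red p n 0" unfolding d red_def by (simp add: residue_ring_def)
  show "c \<odot>\<^bsub>Fn p n\<^esub> x = red p n (\<lambda>i. c * x i)" unfolding d red_def by (simp add: residue_ring_def)
qed

section \<open>Ring polynomials and integer polynomials\<close>

lemma eval_poly_eq:
  assumes p: "prime p" and x: "x \<in> box p n" and c: "c \<in> exponents n d \<rightarrow> carrier (Fp p)"
  shows "eval_poly p n d c x = poly_fun n d c x mod int p"
proof -
  interpret residues_prime p "Fp p" by unfold_locales (rule p)
  have xi: "x i mod int p = x i" if "i < n" for i using x that unfolding box_iff by simp
  have m: "(\<Otimes>\<^bsub>Fp p\<^esub>i\<in>{..<n}. x i [^]\<^bsub>Fp p\<^esub> e i) = mono_eval n e x mod int p" for e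
  proof -
    have "(\<Otimes>\<^bsub>Fp p\<^esub>i\<in>{..<n}. x i [^]\<^bsub>Fp p\<^esub> e i) = (\<Otimes>\<^bsub>Fp p\<^esub>i\<in>{..<n}. (x i ^ e i) mod int p)"
    proof (rule finprod_cong')
      fix i assume "i \<in> {..<n}"
      thus "x i [^]\<^bsub>Fp p\<^esub> e i = (x i ^ e i) mod int p" using pow_cong[of "x i" "e i"] xi[of i] by simp
    qed (simp_all add: Pi_iff mod_in_carrier)
    also have "\<dots> = mono_eval n e x mod int p" unfolding mono_eval_def by (rule prod_cong) simp
    finally show ?thesis .
  qed
  have "eval_poly p n d c x = (\<Oplus>\<^bsub>Fp p\<^esub>e\<in>exponents n d. (c e * mono_eval n e x) mod int p)"
    unfolding eval_poly_def
  proof (rule finsum_cong')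
    fix e assume "e \<in> exponents n d"
    show "c e \<otimes>\<^bsub>Fp p\<^esub> (\<Otimes>\<^bsub>Fp p\<^esub>i\<in>{..<n}. x i [^]\<^bsub>Fp p\<^esub> e i) = (c e * mono_eval n e x) mod int p"
      unfolding m res_mult_eq by (simp add: mod_mult_right_eq)
  qed (simp_all add: Pi_iff mod_in_carrier)
  also have "\<dots> = poly_fun n d c x mod int p"
    by (rule sum_cong[OF finite_exponents])
  finally show ?thesis .
qed

lemma poly_deg_le_on_imp_intpoly:
  assumes p: "prime p" and S: "S \<subseteq> box p n" and f: "poly_deg_le_on p n d S f"
  obtains F where "intpoly n d F" "\<And>x. x \<in> S \<Longrightarrow> f x = F x mod int p"
proof -
  obtain c where c: "c \<in> exponents n d \<rightarrow> carrier (Fp p)" "\<And>x. x \<in> S \<Longrightarrow> f x = eval_poly p n d c x"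
    using f unfolding poly_deg_le_on_def by blast
  show ?thesis
  proof (rule that)
    show "intpoly n d (poly_fun n d c)" unfolding intpoly_iff by blast
    fix x assume x: "x \<in> S"
    thus "f x = poly_fun n d c x mod int p"
      using c(2)[OF x] eval_poly_eq[OF p _ c(1)] S by auto
  qed
qed

lemma intpoly_imp_poly_deg_le_on:
  assumes p: "prime p" and S: "S \<subseteq> box p n" and F: "intpoly n d F" "\<And>x. x \<in> S \<Longrightarrow> f x = F x mod int p"
  shows "poly_deg_le_on p n d S f"
proof -
  obtain c where c: "F = poly_fun n d c" using F(1) unfolding intpoly_iff by blast
  have p0: "int p > 0" using p prime_gt_0_nat by simp
  define c' where "c' e = c e mod int p" for e
  have c': "c' \<in> exponents n d \<rightarrow> carrier (Fp p)" using p0 by (simp add: c'_def residue_ring_def)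
  have "f x = eval_poly p n d c' x" if x: "x \<in> S" for x
  proof -
    have "[F x = poly_fun n d c' x] (mod int p)"
      unfolding c c'_def by (intro cong_sum cong_mult cong_refl) (simp add: cong_def)
    thus ?thesis using F(2)[OF x] eval_poly_eq[OF p _ c'] S x unfolding cong_def by auto
  qed
  thus ?thesis unfolding poly_deg_le_on_def using c' by blast
qed

text \<open>Lower bounds on dimensions are wanted, and counting provides them: the dimension is the
  least size of a finite generating set, and \<open>k\<close> generators yield at most
  \<open>p ^ k\<close> linear combinations.\<close>

lemma card_le_lin_dim:
  assumes p: "prime p" and W: "lin_subspace p n W"
  shows "card W \<le> p ^ lin_dim p n W"
proof -
  interpret V: vectorspace "Fp p" "Fn p n" by (rule Fp_vectorspace[OF p])
  interpret W: vectorspace "Fp p" "(Fn p n)\<lparr>carrier := W\<rparr>"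
    using V.subspace_is_vs W unfolding lin_subspace_def by blast
  have sub: "W \<subseteq> carrier (Fn p n)"
    using W unfolding lin_subspace_def subspace_def submodule_def by blast
  note p0 = prime_gt_0_nat[OF p]
  have finF: "finite (carrier (Fn p n))" unfolding Fn_simps(1)[OF p] box_def by (intro finite_PiE) auto
  have finW: "finite W" using sub finF finite_subset by blast
  have gen: "W.span W = W"
    using W.in_own_span[of W] W.span_is_subset2[of W] by simp
  have "\<exists>n'. \<exists>A. finite A \<and> card A = n' \<and> A \<subseteq> carrier ((Fn p n)\<lparr>carrier := W\<rparr>) \<and> W.gen_set A"
    using finW gen by (intro exI[of _ "card W"] exI[of _ W]) simp
  from LeastI_ex[OF this] obtain A where A: "finite A" "card A = W.dim" "A \<subseteq> W" "W.span A = W"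
    unfolding W.dim_def by auto
  have "W \<subseteq> (\<lambda>a. W.lincomb a A) ` (A \<rightarrow>\<^sub>E carrier (Fp p))"
  proof
    fix w assume "w \<in> W"
    hence "w \<in> W.span A" using A(4) by simp
    moreover have "W.span A = {W.lincomb a A | a. a \<in> A \<rightarrow> carrier (Fp p)}"
      by (rule W.finite_span) (use A in simp_all)
    ultimately obtain a where a: "a \<in> A \<rightarrow> carrier (Fp p)" "w = W.lincomb a A" by blast
    have "W.lincomb a A = W.lincomb (restrict a A) A"
      unfolding W.lincomb_def
    proof (rule W.finsum_cong')
      show "(\<lambda>v. restrict a A v \<odot>\<^bsub>(Fn p n)\<lparr>carrier := W\<rparr>\<^esub> v) \<in> A \<rightarrow> carrier ((Fn p n)\<lparr>carrier := W\<rparr>)"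
        using a(1) A(3) W.smult_closed by (simp add: Pi_iff subset_iff)
    qed simp_all
    moreover have "restrict a A \<in> A \<rightarrow>\<^sub>E carrier (Fp p)" using a(1) by auto
    ultimately show "w \<in> (\<lambda>a. W.lincomb a A) ` (A \<rightarrow>\<^sub>E carrier (Fp p))" using a(2) by blast
  qed
  moreover have finP: "finite (A \<rightarrow>\<^sub>E carrier (Fp p))"
    using A(1) by (intro finite_PiE) (auto simp: residue_ring_def)
  ultimately have "card W \<le> card ((\<lambda>a. W.lincomb a A) ` (A \<rightarrow>\<^sub>E carrier (Fp p)))" by (intro card_mono) auto
  also have "\<dots> \<le> card (A \<rightarrow>\<^sub>E carrier (Fp p))" by (rule card_image_le[OF finP])
  also have "\<dots> = p ^ card A" using A(1) by (simp add: card_PiE residue_ring_def)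
  finally show ?thesis unfolding A(2) lin_dim_def .
qed

section \<open>Subspaces and cosets pulled back to integer vectors\<close>

definition sub_of :: "nat \<Rightarrow> nat \<Rightarrow> (nat \<Rightarrow> circ) set \<Rightarrow> (nat \<Rightarrow> int) set" where
  "sub_of p n W = {x \<in> box p n. emb p n x \<in> W}"

lemma card_sub_of:
  assumes "p > 0" "W \<subseteq> vecs p n" shows "card (sub_of p n W) = card W"
proof -
  have "emb p n ` sub_of p n W = W"
    using assms(2) unfolding vecs_eq_image[OF assms(1)] sub_of_def by blast
  moreover have "inj_on (emb p n) (sub_of p n W)"
    by (rule inj_on_subset[OF emb_inj[OF assms(1)]]) (auto simp: sub_of_def)
  ultimately show ?thesis using card_image by metis
qed

lemma emb_zero: "emb p n 0 = 0"
  by (rule ext) (simp add: emb_def)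

lemma nsm_apply: "nsm k f i = nsm k (f i)" for f :: "nat \<Rightarrow> circ"
  by (induction k) simp_all

lemma emb_smult: "emb p n (\<lambda>i. int k * x i) = nsm k (emb p n x)"
  by (rule ext) (simp add: emb_def nsm_apply nsm_frac_circ)

lemma lin_subspace_sub_of:
  assumes p: "prime p" and W: "pgroup.sg (vecs p n) W"
  shows "lin_subspace p n (sub_of p n W)"
proof -
  interpret pgroup p "vecs p n" by (rule pgroup_vecs[OF p])
  note p0 = prime_gt_0_nat[OF p]
  interpret V: vectorspace "Fp p" "Fn p n" by (rule Fp_vectorspace[OF p])
  have "submodule (Fp p) (sub_of p n W) (Fn p n)"
  proof
    show "sub_of p n W \<subseteq> carrier (Fn p n)" unfolding Fn_simps[OF p] sub_of_def by blast
    show "\<zero>\<^bsub>Fn p n\<^esub> \<in> sub_of p n W"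
      unfolding Fn_simps[OF p] sub_of_def using red_box[OF p0] emb_red[OF p0] emb_zero sg_zero[OF W] by simp
  next
    fix v w assume "v \<in> sub_of p n W" "w \<in> sub_of p n W"
    thus "v \<oplus>\<^bsub>Fn p n\<^esub> w \<in> sub_of p n W"
      unfolding Fn_simps[OF p] sub_of_def using red_box[OF p0] emb_red[OF p0] emb_add sg_add[OF W] by simp
  next
    fix c v assume c: "c \<in> carrier (Fp p)" and v: "v \<in> sub_of p n W"
    have "c = int (nat c)" using c by (simp add: residue_ring_def)
    hence "emb p n (\<lambda>i. c * v i) = nsm (nat c) (emb p n v)" using emb_smult by metis
    thus "c \<odot>\<^bsub>Fn p n\<^esub> v \<in> sub_of p n W"
      using v unfolding Fn_simps[OF p] sub_of_def using red_box[OF p0] emb_red[OF p0] sg_nsm[OF W] by simp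
  qed
  thus ?thesis unfolding lin_subspace_def subspace_def using Fp_vectorspace[OF p] by blast
qed

lemma coset_eq:
  assumes p: "prime p" and W: "pgroup.sg (vecs p n) W" and a: "a \<in> box p n"
  shows "a <+\<^bsub>Fn p n\<^esub> sub_of p n W = {x \<in> box p n. emb p n x - emb p n a \<in> W}"
proof -
  interpret pgroup p "vecs p n" by (rule pgroup_vecs[OF p])
  note p0 = prime_gt_0_nat[OF p]
  have l: "a <+\<^bsub>Fn p n\<^esub> sub_of p n W = {red p n (a + h) | h. h \<in> sub_of p n W}"
    unfolding a_l_coset_def' Fn_simps(2)[OF p] by blast
  show ?thesis unfolding l
  proof (intro equalityI subsetI)
    fix x assume "x \<in> {red p n (a + h) | h. h \<in> sub_of p n W}"
    then obtain h where "h \<in> sub_of p n W" "x = red p n (a + h)" by blast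
    thus "x \<in> {x \<in> box p n. emb p n x - emb p n a \<in> W}"
      using red_box[OF p0] emb_red[OF p0] emb_add by (simp add: sub_of_def)
  next
    fix x assume x: "x \<in> {x \<in> box p n. emb p n x - emb p n a \<in> W}"
    then obtain h where h: "h \<in> box p n" "emb p n h = emb p n x - emb p n a"
      using sg_subV[OF W] unfolding vecs_eq_image[OF p0] by (metis (no_types, lifting) imageE mem_Collect_eq)
    have "emb p n (red p n (a + h)) = emb p n x" using h emb_red[OF p0] emb_add by simp
    hence "red p n (a + h) = x" using emb_inj[OF p0] red_box[OF p0] x unfolding inj_on_def by blast
    thus "x \<in> {red p n (a + h) | h. h \<in> sub_of p n W}" using h x unfolding sub_of_def by auto
  qed
qed

lemma emb_minus:
  assumes p: "prime p" and xy: "x \<in> box p n" "y \<in> box p n"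
  shows "x \<ominus>\<^bsub>Fn p n\<^esub> y \<in> box p n" "emb p n (x \<ominus>\<^bsub>Fn p n\<^esub> y) = emb p n x - emb p n y"
proof -
  note p0 = prime_gt_0_nat[OF p]
  interpret V: abelian_group "Fn p n"
    using Fp_vectorspace[OF p] unfolding vectorspace_def module_def by blast
  have y: "y \<in> carrier (Fn p n)" using xy Fn_simps(1)[OF p] by simp
  have x: "x \<in> carrier (Fn p n)" using xy Fn_simps(1)[OF p] by simp
  show "x \<ominus>\<^bsub>Fn p n\<^esub> y \<in> box p n"
    using V.minus_closed[OF x y] Fn_simps(1)[OF p] by simp
  have "(x \<ominus>\<^bsub>Fn p n\<^esub> y) \<oplus>\<^bsub>Fn p n\<^esub> y = x"
    unfolding a_minus_def using x y by (simp add: V.a_assoc V.l_neg V.r_zero)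
  hence "emb p n ((x \<ominus>\<^bsub>Fn p n\<^esub> y) + y) = emb p n x"
    unfolding Fn_simps(2)[OF p] using emb_red[OF p0] by metis
  thus "emb p n (x \<ominus>\<^bsub>Fn p n\<^esub> y) = emb p n x - emb p n y"
    unfolding emb_add by (simp add: algebra_simps)
qed

lemma direction_coset:
  assumes p: "prime p" and W: "pgroup.sg (vecs p n) W" and a: "a \<in> box p n"
  shows "direction p n (a <+\<^bsub>Fn p n\<^esub> sub_of p n W) = sub_of p n W"
proof -
  interpret pgroup p "vecs p n" by (rule pgroup_vecs[OF p])
  note p0 = prime_gt_0_nat[OF p]
  let ?A = "{x \<in> box p n. emb p n x - emb p n a \<in> W}"
  have "{x \<ominus>\<^bsub>Fn p n\<^esub> y | x y. x \<in> ?A \<and> y \<in> ?A} = sub_of p n W"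
  proof (intro equalityI subsetI)
    fix z assume "z \<in> {x \<ominus>\<^bsub>Fn p n\<^esub> y | x y. x \<in> ?A \<and> y \<in> ?A}"
    then obtain x y where xy: "x \<in> ?A" "y \<in> ?A" "z = x \<ominus>\<^bsub>Fn p n\<^esub> y" by blast
    have "emb p n x - emb p n y = (emb p n x - emb p n a) - (emb p n y - emb p n a)" by simp
    hence "emb p n x - emb p n y \<in> W" using sg_diff[OF W] xy by (metis (no_types, lifting) mem_Collect_eq)
    thus "z \<in> sub_of p n W" using emb_minus[OF p, of x n y] xy by (simp add: sub_of_def)
  next
    fix z assume z: "z \<in> sub_of p n W"
    define x where "x = red p n (z + a)"
    have "emb p n x = emb p n z + emb p n a" unfolding x_def emb_red[OF p0] emb_add ..
    moreover have xb: "x \<in> box p n" unfolding x_def by (rule red_box[OF p0])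
    ultimately have xA: "x \<in> ?A" "emb p n (x \<ominus>\<^bsub>Fn p n\<^esub> a) = emb p n z"
      using z emb_minus(2)[OF p xb a] by (simp_all add: sub_of_def)
    have aA: "a \<in> ?A" using a sg_zero[OF W] by simp
    have "z = x \<ominus>\<^bsub>Fn p n\<^esub> a"
      using emb_inj[OF p0] xA(2) emb_minus(1)[OF p xb a] z unfolding inj_on_def sub_of_def
      by (metis (no_types, lifting) mem_Collect_eq)
    thus "z \<in> {x \<ominus>\<^bsub>Fn p n\<^esub> y | x y. x \<in> ?A \<and> y \<in> ?A}" using xA(1) aA by blast
  qed
  thus ?thesis unfolding direction_def coset_eq[OF p W a] .
qed

section \<open>The Gowers norm and the partition\<close>

text \<open>Orthogonality: translating by \<open>t\<close> multiplies the sum by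
  \<open>\<chi> t\<close>, so the sum vanishes as soon as some \<open>\<chi> t\<close> differs from
  1.\<close>

lemma (in pgroup) character_sum:
  fixes \<chi> :: "'a \<Rightarrow> complex"
  assumes m: "\<And>x y. x \<in> V \<Longrightarrow> y \<in> V \<Longrightarrow> \<chi> (x + y) = \<chi> x * \<chi> y"
  shows "(\<Sum>v\<in>V. \<chi> v) = (if \<forall>v\<in>V. \<chi> v = 1 then of_nat (card V) else 0)"
proof (cases "\<forall>v\<in>V. \<chi> v = 1")
  case True
  hence "(\<Sum>v\<in>V. \<chi> v) = (\<Sum>v\<in>V. 1)" by (intro sum.cong) auto
  thus ?thesis using True by simp
next
  case False
  then obtain t where t: "t \<in> V" "\<chi> t \<noteq> 1" by blast
  have "(\<Sum>v\<in>V. \<chi> v) = (\<Sum>v\<in>V. \<chi> (t + v))"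
  proof (rule sum.reindex_bij_witness[where i = "\<lambda>v. t + v" and j = "\<lambda>v. v - t"])
    fix v assume "v \<in> V"
    thus "v - t \<in> V" "t + v \<in> V" using t(1) sg_diff[OF sg_V] add_V by blast+
  qed simp_all
  also have "\<dots> = \<chi> t * (\<Sum>v\<in>V. \<chi> v)"
    unfolding sum_distrib_left by (intro sum.cong refl m t)
  finally have "(\<chi> t - 1) * (\<Sum>v\<in>V. \<chi> v) = 0" by (simp add: algebra_simps)
  thus ?thesis using t False by auto
qed

definition omega :: "nat \<Rightarrow> complex" where
  "omega p = exp (2 * pi * \<i> / p)"

lemma omega_powi: "omega p powi a = cis (2 * pi * real_of_int a / real p)"
proof -
  have "omega p powi a = exp (of_int a * (2 * pi * \<i> / p))" unfolding omega_def by (rule exp_power_int)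
  thus ?thesis by (simp add: cis_conv_exp mult_ac)
qed

lemma omega_powi_add: "omega p powi (a + b) = omega p powi a * omega p powi b"
  by (simp add: omega_powi cis_mult add_divide_distrib distrib_left)

lemma omega_powi_eq_1_iff: assumes "p > 0" shows "omega p powi a = 1 \<longleftrightarrow> int p dvd a"
proof
  assume "omega p powi a = 1"
  hence "cos (2 * pi * real_of_int a / real p) = 1" unfolding omega_powi by (metis cis.simps(1) one_complex.simps(1))
  then obtain k :: int where "2 * pi * real_of_int a / real p = real_of_int k * 2 * pi" using cos_one_2pi_int by blast
  hence "real_of_int a = real_of_int (int p * k)" using assms by (simp add: field_simps)
  hence "a = int p * k" by (simp only: of_int_eq_iff)
  thus "int p dvd a" by simp
next
  assume "int p dvd a"
  then obtain k where k: "a = int p * k" by blast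
  have "2 * pi * real_of_int a / real p = 2 * pi * real_of_int k" using assms by (simp add: k)
  thus "omega p powi a = 1" unfolding omega_powi by (simp add: cis_multiple_2pi)
qed

lemma omega_powi_cong: assumes "p > 0" "[a = b] (mod int p)" shows "omega p powi a = omega p powi b"
proof -
  have "omega p powi (a - b) = 1" using assms by (simp add: omega_powi_eq_1_iff cong_iff_dvd_diff)
  moreover have "omega p powi a = omega p powi (a - b) * omega p powi b"
    by (simp add: omega_powi_add[symmetric])
  ultimately show ?thesis by simp
qed

lemma deriv_dir_eq:
  assumes p: "prime p" and G: "class_fun p n G" and g: "\<forall>x\<in>box p n. g x = G x mod int p"
    and y: "y \<in> box p n"
  shows "\<forall>x\<in>box p n. deriv_dir p n y g x = delta y G x mod int p"
proof
  fix x assume x: "x \<in> box p n"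
  note p0 = prime_gt_0_nat[OF p]
  interpret residues_prime p "Fp p" by unfold_locales (rule p)
  have "[G (red p n (x + y)) = G (x + y)] (mod int p)"
    using G red_cong unfolding class_fun_def by blast
  hence "g (red p n (x + y)) = G (x + y) mod int p" using g red_box[OF p0] by (simp add: cong_def)
  moreover have "g x = G x mod int p" using g x by blast
  ultimately show "deriv_dir p n y g x = delta y G x mod int p"
    unfolding deriv_dir_def Fn_simps(2)[OF p] a_minus_def res_add_eq res_neg_eq delta_def
    by (simp add: mod_diff_eq mod_add_eq mod_minus_eq)
qed

lemma sum_lists_Suc:
  fixes h :: "'c list \<Rightarrow> 'd::comm_monoid_add"
  shows "(\<Sum>ys | set ys \<subseteq> A \<and> length ys = Suc k. h ys)
    = (\<Sum>a\<in>A. \<Sum>ys | set ys \<subseteq> A \<and> length ys = k. h (a # ys))"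
proof -
  let ?L = "{ys. set ys \<subseteq> A \<and> length ys = k}"
  have "(\<Sum>ys | set ys \<subseteq> A \<and> length ys = Suc k. h ys) = (\<Sum>z\<in>?L \<times> A. h (snd z # fst z))"
    unfolding lists_length_Suc_eq by (subst sum.reindex) (auto simp: inj_on_def case_prod_beta o_def)
  also have "\<dots> = (\<Sum>ys\<in>?L. \<Sum>a\<in>A. h (a # ys))" by (simp add: sum.cartesian_product case_prod_beta)
  finally show ?thesis by (subst sum.swap)
qed

lemma sum_lists_4:
  fixes h :: "'c list \<Rightarrow> 'd::comm_monoid_add"
  shows "(\<Sum>ys | set ys \<subseteq> A \<and> length ys = 4. h ys) = (\<Sum>a\<in>A. \<Sum>b\<in>A. \<Sum>c\<in>A. \<Sum>d\<in>A. h [a, b, c, d])"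
proof -
  have 4: "(4 :: nat) = Suc (Suc (Suc (Suc 0)))" by simp
  have 0: "{ys. set ys \<subseteq> A \<and> length ys = 0} = {[]}" by auto
  show ?thesis unfolding 4 sum_lists_Suc 0 by simp
qed

lemma delta4_const:
  assumes "dd p 5 F"
  shows "[delta a (delta b (delta c (delta d F))) x = dform F a b c d] (mod int p)"
proof -
  have 5: "(5 :: nat) = Suc (Suc (Suc (Suc (Suc 0))))" by simp
  have "[delta x (delta a (delta b (delta c (delta d F)))) 0 = 0] (mod int p)"
    using assms unfolding 5 by (simp only: dd.simps simp_thms)
  thus ?thesis unfolding dform_def delta_def[of x] by (simp add: cong_iff_dvd_diff)
qed

lemma bij_betw_rep: assumes "p > 0" shows "bij_betw (rep p n) (vecs p n) (box p n)"
proof -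
  have "bij_betw (emb p n) (box p n) (vecs p n)"
    using emb_inj[OF assms] vecs_eq_image[OF assms] by (simp add: bij_betw_def)
  thus ?thesis unfolding rep_def by (rule bij_betw_inv_into)
qed

definition zero_triples :: "nat \<Rightarrow> nat \<Rightarrow> ((nat \<Rightarrow> int) \<Rightarrow> int) \<Rightarrow> nat" where
  "zero_triples p n F = (\<Sum>a\<in>vecs p n. \<Sum>b\<in>vecs p n. \<Sum>c\<in>vecs p n.
     quadrilinear.zT (cform p n F) (vecs p n) a b c)"

text \<open>The fourth derivative does not depend on the base point, so the sum over
  \<open>x\<close> is a factor \<open>p ^ n\<close>. For fixed \<open>a\<close>, \<open>b\<close>,
  \<open>c\<close> the sum over \<open>d\<close> is a character sum, equal to \<open>p ^ n\<close>
  if \<open>T a b c\<close> vanishes identically and to 0 otherwise. The expectation is therefore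
  the density of such triples, and 16 is \<open>2 ^ 4\<close>.\<close>

lemma gowers_norm_eq:
  assumes p: "prime p" and F: "intpoly n 4 F" and f: "\<And>x. x \<in> box p n \<Longrightarrow> f x = F x mod int p"
  shows "gowers_norm p n 4 f = (real (zero_triples p n F) / real (p ^ n) ^ 3) powr (1 / 16)"
proof -
  note p0 = prime_gt_0_nat[OF p]
  have cF: "class_fun p n F" using intpoly_class_fun[OF F] .
  have dF: "dd p 5 F" using intpoly_dd[OF F, of p] by simp
  interpret quadrilinear p "vecs p n" "cform p n F" "frac_circ p 1" by (rule quadrilinear_cform[OF p cF dF])
  let ?B = "box p n" and ?V = "vecs p n"
  \<comment> \<open>\<open>fold\<close> differentiates along \<open>a\<close> innermost, so the form
    comes out with its arguments reversed; symmetry restores the order.\<close>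
  have fold: "omega p powi (fold (deriv_dir p n) [a, b, c, d] f x) = omega p powi (dform F a b c d)"
    if v: "a \<in> ?B" "b \<in> ?B" "c \<in> ?B" "d \<in> ?B" "x \<in> ?B" for a b c d x
  proof -
    have 0: "\<forall>x\<in>?B. f x = F x mod int p" using f by blast
    note 1 = deriv_dir_eq[OF p cF 0 v(1)]
    note 2 = deriv_dir_eq[OF p class_fun_delta[OF cF] 1 v(2)]
    note 3 = deriv_dir_eq[OF p class_fun_delta[OF class_fun_delta[OF cF]] 2 v(3)]
    note 4 = deriv_dir_eq[OF p class_fun_delta[OF class_fun_delta[OF class_fun_delta[OF cF]]] 3 v(4)]
    have "fold (deriv_dir p n) [a, b, c, d] f x = delta d (delta c (delta b (delta a F))) x mod int p"
      using 4 v(5) by simp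
    hence "[fold (deriv_dir p n) [a, b, c, d] f x = delta d (delta c (delta b (delta a F))) x] (mod int p)"
      by (simp add: cong_def)
    also have "[delta d (delta c (delta b (delta a F))) x = dform F d c b a] (mod int p)"
      by (rule delta4_const[OF dF])
    also have "dform F d c b a = dform F a b c d" by (metis dform_12 dform_23 dform_34)
    finally show ?thesis by (rule omega_powi_cong[OF p0])
  qed
  have tr: "(\<Sum>x\<in>?B. h x) = (\<Sum>v\<in>?V. h (rep p n v))" for h :: "_ \<Rightarrow> complex"
    by (rule sum.reindex_bij_betw[OF bij_betw_rep[OF p0], symmetric])
  let ?D = "\<lambda>a b c. dform F (rep p n a) (rep p n b) (rep p n c)"
  have inner: "(\<Sum>d\<in>?V. omega p powi (?D a b c (rep p n d)))
      = of_nat (p ^ n) * of_nat (zT ?V a b c)" if v: "a \<in> ?V" "b \<in> ?V" "c \<in> ?V" for a b c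
  proof -
    let ?\<chi> = "\<lambda>d. omega p powi (?D a b c (rep p n d))"
    have "?\<chi> (x + y) = ?\<chi> x * ?\<chi> y" if "x \<in> ?V" "y \<in> ?V" for x y
    proof -
      have "cform p n F a b c (x + y) = cform p n F a b c x + cform p n F a b c y"
        by (rule T_add4) (use that v in auto)
      hence "[?D a b c (rep p n (x + y))
          = ?D a b c (rep p n x) + ?D a b c (rep p n y)] (mod int p)"
        unfolding cform_def frac_circ_add[symmetric] frac_circ_eq_iff[OF p0] .
      from omega_powi_cong[OF p0 this] show ?thesis unfolding omega_powi_add .
    qed
    hence "(\<Sum>d\<in>?V. ?\<chi> d) = (if \<forall>d\<in>?V. ?\<chi> d = 1 then of_nat (card ?V) else 0)" by (rule character_sum)
    also have "(\<forall>d\<in>?V. ?\<chi> d = 1) \<longleftrightarrow> (\<forall>d\<in>?V. cform p n F a b c d = 0)"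
      unfolding omega_powi_eq_1_iff[OF p0] cform_def frac_circ_eq_0_iff[OF p0] ..
    finally show ?thesis by (simp add: zT_def card_vecs[OF p0])
  qed
  have "(\<Sum>x\<in>?B. \<Sum>ys | set ys \<subseteq> ?B \<and> length ys = 4. omega p powi (fold (deriv_dir p n) ys f x))
      = (\<Sum>x\<in>?B. \<Sum>a\<in>?B. \<Sum>b\<in>?B. \<Sum>c\<in>?B. \<Sum>d\<in>?B. omega p powi (dform F a b c d))"
    unfolding sum_lists_4 by (intro sum.cong refl fold)
  also have "\<dots> = of_nat (p ^ n) * (\<Sum>a\<in>?B. \<Sum>b\<in>?B. \<Sum>c\<in>?B. \<Sum>d\<in>?B. omega p powi (dform F a b c d))"
    by (simp add: card_box)
  also have "(\<Sum>a\<in>?B. \<Sum>b\<in>?B. \<Sum>c\<in>?B. \<Sum>d\<in>?B. omega p powi (dform F a b c d))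
      = (\<Sum>a\<in>?V. \<Sum>b\<in>?V. \<Sum>c\<in>?V. of_nat (p ^ n) * of_nat (zT ?V a b c))"
    unfolding tr by (intro sum.cong refl inner)
  also have "\<dots> = of_nat (p ^ n) * of_nat (zero_triples p n F)"
    unfolding zero_triples_def of_nat_sum sum_distrib_left ..
  finally have S: "(\<Sum>x\<in>?B. \<Sum>ys | set ys \<subseteq> ?B \<and> length ys = 4. omega p powi (fold (deriv_dir p n) ys f x))
      = of_nat (p ^ n) * (of_nat (p ^ n) * of_nat (zero_triples p n F))" .
  define M where "M = real (p ^ n)"
  have M: "M > 0" using p0 by (simp add: M_def)
  have "of_nat (p ^ n) * (of_nat (p ^ n) * of_nat (zero_triples p n F)) / of_nat ((p ^ n) ^ (4 + 1))
      = complex_of_real (M * (M * real (zero_triples p n F)) / M ^ 5)"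
    by (simp add: M_def)
  moreover have "M * (M * real (zero_triples p n F)) / M ^ 5 = real (zero_triples p n F) / M ^ 3"
    using M by (simp add: field_simps eval_nat_numeral)
  ultimately have "cmod (of_nat (p ^ n) * (of_nat (p ^ n) * of_nat (zero_triples p n F)) / of_nat ((p ^ n) ^ (4 + 1)))
      = real (zero_triples p n F) / M ^ 3" using M by (simp add: norm_of_real del: of_real_divide of_real_mult)
  thus ?thesis unfolding gowers_norm_def Fn_simps(1)[OF p] omega_def[symmetric] S card_box M_def by simp
qed

section \<open>Restriction of a quartic to a coset of an isotropic subspace\<close>

primrec ddon :: "nat \<Rightarrow> (nat \<Rightarrow> int) set \<Rightarrow> nat \<Rightarrow> ((nat \<Rightarrow> int) \<Rightarrow> int) \<Rightarrow> bool" where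
  "ddon p Y 0 F \<longleftrightarrow> (\<forall>x. [F x = 0] (mod int p))"
| "ddon p Y (Suc k) F \<longleftrightarrow> (\<forall>y\<in>Y. ddon p Y k (delta y F))"

text \<open>As \<open>\<rho>\<close> is additive modulo \<open>p\<close>, a difference of the
  composition in direction \<open>y\<close> is a difference of \<open>H\<close> in direction
  \<open>\<rho> y\<close>. So only directions in the range of \<open>\<rho>\<close> have to be
  controlled.\<close>

lemma dd_compose:
  assumes \<rho>: "\<And>x y. \<forall>i<n. [\<rho> (x + y) i = \<rho> x i + \<rho> y i] (mod int p)"
  shows "class_fun p n H \<Longrightarrow> ddon p (range \<rho>) k H \<Longrightarrow> dd p k (\<lambda>x. H (a + \<rho> (x - a)))"
proof (induction k arbitrary: H)
  case (Suc k)
  have "dd p k (delta y (\<lambda>x. H (a + \<rho> (x - a))))" for y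
  proof (rule dd_cong)
    show "dd p k (\<lambda>x. delta (\<rho> y) H (a + \<rho> (x - a)))"
      by (rule Suc.IH) (use Suc.prems class_fun_delta in auto)
    fix x
    have xy: "x + y - a = (x - a) + y" by (simp add: algebra_simps)
    have "\<forall>i<n. [(a + \<rho> (x - a) + \<rho> y) i = (a + \<rho> (x + y - a)) i] (mod int p)"
    proof (intro allI impI)
      fix i assume "i < n"
      hence "[\<rho> (x - a) i + \<rho> y i = \<rho> (x - a + y) i] (mod int p)" using \<rho>[of "x - a" y] cong_sym by blast
      from cong_add[OF cong_refl[of "a i"] this]
      show "[(a + \<rho> (x - a) + \<rho> y) i = (a + \<rho> (x + y - a)) i] (mod int p)"
        unfolding xy by (simp only: plus_fun_apply add.assoc)
    qed
    hence "[H (a + \<rho> (x - a) + \<rho> y) = H (a + \<rho> (x + y - a))] (mod int p)"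
      using Suc.prems(1) unfolding class_fun_def by blast
    thus "[delta (\<rho> y) H (a + \<rho> (x - a)) = delta y (\<lambda>x. H (a + \<rho> (x - a))) x] (mod int p)"
      unfolding delta_def by (rule cong_diff[OF _ cong_refl])
  qed
  thus ?case unfolding dd.simps by blast
qed simp

text \<open>\<open>\<pi> v\<close> is the \<open>W\<close>-part of \<open>v\<close> relative to a
  complement; its uniqueness makes \<open>\<pi>\<close> additive and the identity on
  \<open>W\<close>.\<close>

lemma (in pgroup) exists_projection:
  assumes W: "sg W"
  obtains \<pi> where "\<And>v. v \<in> V \<Longrightarrow> \<pi> v \<in> W" "\<And>w. w \<in> W \<Longrightarrow> \<pi> w = w"
    "\<And>u v. u \<in> V \<Longrightarrow> v \<in> V \<Longrightarrow> \<pi> (u + v) = \<pi> u + \<pi> v"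
proof -
  obtain C where C: "sg C" "C \<inter> W = {0}" "ssum C W = V" using exists_complement[OF W] .
  have ex: "\<exists>w. w \<in> W \<and> v - w \<in> C" if "v \<in> V" for v
  proof -
    obtain c w where "c \<in> C" "w \<in> W" "v = c + w" using \<open>v \<in> V\<close> unfolding C(3)[symmetric] ssum_def by blast
    thus ?thesis by (intro exI[of _ w]) simp
  qed
  define \<pi> where "\<pi> v = (SOME w. w \<in> W \<and> v - w \<in> C)" for v
  have \<pi>: "\<pi> v \<in> W" "v - \<pi> v \<in> C" if "v \<in> V" for v
    using someI_ex[OF ex[OF that]] unfolding \<pi>_def by blast+
  have unique: "w = w'" if "w \<in> W" "w' \<in> W" "v - w \<in> C" "v - w' \<in> C" for v w w'
  proof -
    have "(v - w') - (v - w) \<in> C" using that sg_diff[OF C(1)] by blast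
    moreover have "w - w' \<in> W" using that sg_diff[OF W] by blast
    moreover have "(v - w') - (v - w) = w - w'" by simp
    ultimately have "w - w' \<in> C \<inter> W" by simp
    thus ?thesis unfolding C(2) by simp
  qed
  show ?thesis
  proof (rule that)
    show "\<pi> v \<in> W" if "v \<in> V" for v using \<pi>(1)[OF that] .
    show "\<pi> w = w" if "w \<in> W" for w
      using unique[of "\<pi> w" w w] \<pi>[of w] that sg_subV[OF W that] sg_zero[OF C(1)] by simp
    show "\<pi> (u + v) = \<pi> u + \<pi> v" if "u \<in> V" "v \<in> V" for u v
    proof (rule unique[of _ _ "u + v"])
      show "\<pi> (u + v) \<in> W" "u + v - \<pi> (u + v) \<in> C" using \<pi>[OF add_V[OF that]] by blast+
      show "\<pi> u + \<pi> v \<in> W" using \<pi>(1) that sg_add[OF W] by blast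
      have "u + v - (\<pi> u + \<pi> v) = (u - \<pi> u) + (v - \<pi> v)" by simp
      thus "u + v - (\<pi> u + \<pi> v) \<in> C" using \<pi>(2) that sg_add[OF C(1)] by metis
    qed
  qed
qed

lemma emb_diff: "emb p n (x - y) = emb p n x - emb p n y"
  using emb_add[of p n "x - y" y] by simp

text \<open>Composing \<open>F\<close> with a projection onto \<open>W\<close> extends its restriction to the coset to a function on
  the whole space, to which Newton interpolation applies.\<close>

lemma cubic_on_coset:
  assumes p: "prime p" and F: "intpoly n 4 F" and f: "\<And>x. x \<in> box p n \<Longrightarrow> f x = F x mod int p"
    and W: "quadrilinear.isotropic (vecs p n) (cform p n F) W" and a: "a \<in> box p n"
  shows "poly_deg_le_on p n 3 (a <+\<^bsub>Fn p n\<^esub> sub_of p n W) f"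
proof -
  note p0 = prime_gt_0_nat[OF p]
  have cF: "class_fun p n F" using intpoly_class_fun[OF F] .
  have dF: "dd p 5 F" using intpoly_dd[OF F, of p] by simp
  interpret quadrilinear p "vecs p n" "cform p n F" "frac_circ p 1" by (rule quadrilinear_cform[OF p cF dF])
  have sgW: "sg W" and T0: "\<And>a b c d. \<lbrakk>a \<in> W; b \<in> W; c \<in> W; d \<in> W\<rbrakk> \<Longrightarrow> cform p n F a b c d = 0"
    using W unfolding isotropic_def by blast+
  obtain \<pi> where \<pi>: "\<And>v. v \<in> vecs p n \<Longrightarrow> \<pi> v \<in> W" "\<And>w. w \<in> W \<Longrightarrow> \<pi> w = w"
    "\<And>u v. u \<in> vecs p n \<Longrightarrow> v \<in> vecs p n \<Longrightarrow> \<pi> (u + v) = \<pi> u + \<pi> v"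
    using exists_projection[OF sgW] by blast
  define \<rho> where "\<rho> x = rep p n (\<pi> (emb p n x))" for x
  have ev: "emb p n x \<in> vecs p n" for x unfolding vecs_def by blast
  have e\<rho>: "emb p n (\<rho> x) = \<pi> (emb p n x)" for x
    unfolding \<rho>_def by (rule emb_rep[OF p0 sg_subV[OF sgW \<pi>(1)[OF ev]]])
  have \<rho>W: "emb p n (\<rho> x) \<in> W" for x unfolding e\<rho> by (rule \<pi>(1)[OF ev])
  have \<rho>add: "\<forall>i<n. [\<rho> (x + y) i = \<rho> x i + \<rho> y i] (mod int p)" for x y
  proof -
    have "emb p n (\<rho> (x + y)) = emb p n (\<rho> x + \<rho> y)" unfolding emb_add e\<rho> by (rule \<pi>(3)[OF ev ev])
    thus ?thesis unfolding emb_eq_iff[OF p0] by simp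
  qed
  define G where "G = (\<lambda>x. F (a + \<rho> (x - a)))"
  have "class_fun p n G" unfolding class_fun_def
  proof (intro allI impI)
    fix x y assume "\<forall>i<n. [x i = y i] (mod int p)"
    hence "emb p n x = emb p n y" unfolding emb_eq_iff[OF p0] .
    hence "emb p n (x - a) = emb p n (y - a)" unfolding emb_diff by simp
    thus "[G x = G y] (mod int p)" unfolding G_def \<rho>_def by simp
  qed
  \<comment> \<open>All directions are pushed into \<open>W\<close> by \<open>\<rho>\<close>, and
    there the fourth differences of \<open>F\<close> are values of the form on \<open>W\<close>,
    which vanish by isotropy.\<close>
  moreover have "dd p (Suc 3) G" unfolding G_def
  proof (rule dd_compose[OF \<rho>add cF])
    have "[delta y4 (delta y3 (delta y2 (delta y1 F))) x = 0] (mod int p)"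
      if "y1 \<in> range \<rho>" "y2 \<in> range \<rho>" "y3 \<in> range \<rho>" "y4 \<in> range \<rho>" for y1 y2 y3 y4 x
    proof -
      have "emb p n y1 \<in> W" "emb p n y2 \<in> W" "emb p n y3 \<in> W" "emb p n y4 \<in> W" using that \<rho>W by auto
      hence "cform p n F (emb p n y4) (emb p n y3) (emb p n y2) (emb p n y1) = 0" using T0 by blast
      hence "[dform F y4 y3 y2 y1 = 0] (mod int p)"
        unfolding cform_emb[OF p0 cF] frac_circ_eq_0_iff[OF p0] cong_0_iff .
      with delta4_const[OF dF] show ?thesis by (rule cong_trans)
    qed
    moreover have "Suc 3 = Suc (Suc (Suc (Suc 0)))" by simp
    ultimately show "ddon p (range \<rho>) (Suc 3) F" by (simp only: ddon.simps) blast
  qed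
  ultimately obtain H where H: "intpoly n 3 H" "\<And>x. reduced p n x \<Longrightarrow> [G x = H x] (mod int p)"
    using dd_imp_intpoly[OF p] by blast
  show ?thesis
  proof (rule intpoly_imp_poly_deg_le_on[OF p _ H(1)])
    show "a <+\<^bsub>Fn p n\<^esub> sub_of p n W \<subseteq> box p n" unfolding coset_eq[OF p sgW a] by blast
    fix x assume "x \<in> a <+\<^bsub>Fn p n\<^esub> sub_of p n W"
    hence x: "x \<in> box p n" "emb p n x - emb p n a \<in> W" unfolding coset_eq[OF p sgW a] by blast+
    have "emb p n (\<rho> (x - a)) = emb p n (x - a)" unfolding e\<rho> emb_diff by (rule \<pi>(2)[OF x(2)])
    hence "emb p n (a + \<rho> (x - a)) = emb p n x" unfolding emb_add emb_diff by simp
    hence "[G x = F x] (mod int p)" using cF unfolding emb_eq_iff[OF p0] G_def class_fun_def by blast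
    moreover have "[G x = H x] (mod int p)" using H(2) x(1) unfolding box_iff by blast
    ultimately show "f x = H x mod int p" using f[OF x(1)] unfolding cong_def by simp
  qed
qed

section \<open>Numerical bounds and the choice of the isotropic subspace\<close>

lemma zero_triples_bounds:
  assumes p: "prime p" and F: "intpoly n 4 F"
  shows "0 < zero_triples p n F" "zero_triples p n F \<le> (p ^ n) ^ 3"
proof -
  note p0 = prime_gt_0_nat[OF p]
  have cF: "class_fun p n F" using intpoly_class_fun[OF F] .
  have dF: "dd p 5 F" using intpoly_dd[OF F, of p] by simp
  interpret quadrilinear p "vecs p n" "cform p n F" "frac_circ p 1" by (rule quadrilinear_cform[OF p cF dF])
  let ?V = "vecs p n"
  have "cform p n F 0 0 0 d = 0" if "d \<in> ?V" for d using addv_0[OF T_addv1] zero_V that by blast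
  hence 1: "zT ?V 0 0 0 = 1" by (simp add: zT_def)
  have "zT ?V 0 0 0 \<le> (\<Sum>c\<in>?V. zT ?V 0 0 c)" by (rule member_le_sum[OF zero_V _ fin_V]) simp
  also have "\<dots> \<le> (\<Sum>b\<in>?V. \<Sum>c\<in>?V. zT ?V 0 b c)"
    by (rule member_le_sum[where f = "\<lambda>b. \<Sum>c\<in>?V. zT ?V 0 b c", OF zero_V _ fin_V]) simp
  also have "\<dots> \<le> (\<Sum>a\<in>?V. \<Sum>b\<in>?V. \<Sum>c\<in>?V. zT ?V a b c)"
    by (rule member_le_sum[where f = "\<lambda>a. \<Sum>b\<in>?V. \<Sum>c\<in>?V. zT ?V a b c", OF zero_V _ fin_V]) simp
  finally show "0 < zero_triples p n F" using 1 by (simp add: zero_triples_def)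
  have "zero_triples p n F \<le> (\<Sum>a\<in>?V. \<Sum>b\<in>?V. \<Sum>c\<in>?V. 1)"
    unfolding zero_triples_def by (intro sum_mono) (simp add: zT_def)
  also have "\<dots> = (p ^ n) ^ 3" by (simp add: card_vecs[OF p0] power3_eq_cube)
  finally show "zero_triples p n F \<le> (p ^ n) ^ 3" .
qed

text \<open>The leading term of \<open>tri_bound (2 * E)\<close> is \<open>2304 * E ^ 4\<close>,
  with \<open>2304 = 48 * 48\<close>; taking \<open>8 * E ^ 2\<close> such steps five times over
  gives \<open>92160 * E ^ 6\<close>.\<close>

lemma self_bound_le: assumes "E \<ge> 1" shows "5 * self_bound E \<le> 100000 * E ^ 6"
proof -
  have pw: "E ^ i \<le> E ^ 6" if "i \<le> 6" for i using assms that by (intro power_increasing) auto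
  have "5 * self_bound E = 92160 * E ^ 6 + 160 * E ^ 3 + 40 * E ^ 2 + 40 * E ^ 1 + 5 * E ^ 0"
    unfolding self_bound_def step_bound_def tri_bound_def by (simp add: algebra_simps power_numeral_reduce)
  also have "\<dots> \<le> 92160 * E ^ 6 + 160 * E ^ 6 + 40 * E ^ 6 + 40 * E ^ 6 + 5 * E ^ 6"
    by (intro add_mono mult_le_mono2 pw) auto
  also have "\<dots> \<le> 100000 * E ^ 6" by simp
  finally show ?thesis .
qed

lemma exists_isotropic:
  assumes p: "prime p" and F: "intpoly n 4 F" and E: "(p ^ n) ^ 3 \<le> E * zero_triples p n F"
  obtains W k where "quadrilinear.isotropic (vecs p n) (cform p n F) W" "card W = p ^ k"
    "n \<ge> 5 \<longrightarrow> n \<le> 200000 * E ^ 6 * k" "W \<subseteq> vecs p n"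
proof -
  note p0 = prime_gt_0_nat[OF p]
  have cF: "class_fun p n F" using intpoly_class_fun[OF F] .
  have dF: "dd p 5 F" using intpoly_dd[OF F, of p] by simp
  interpret quadrilinear p "vecs p n" "cform p n F" "frac_circ p 1" by (rule quadrilinear_cform[OF p cF dF])
  have E1: "E \<ge> 1" using E p0 by (cases E) auto
  hence E0: "E > 0" by simp
  have bias: "biased E (vecs p n) (vecs p n) (vecs p n) (vecs p n)"
    using E unfolding biased_def zero_triples_def card_vecs[OF p0] by (simp add: power3_eq_cube)
  define L where "L = 5 * self_bound E"
  have L: "L \<le> 100000 * E ^ 6"
    using self_bound_le[OF E1] by (simp add: L_def)
  have L0: "L > 0" by (simp add: L_def self_bound_def)
  \<comment> \<open>\<open>q\<close> inductive steps fit into \<open>n\<close>. For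
    \<open>q \<ge> 1\<close> the bound \<open>n < L * Suc q \<le> L * (2 * q)\<close> turns 100000
    into 200000; for \<open>q = 0\<close> a line is enough, since then \<open>n < L\<close>.\<close>
  define q where "q = n div L"
  have nq: "n < L * Suc q" unfolding q_def using L0 by (simp add: dividend_less_times_div)
  consider "q \<ge> 1" | "q = 0" "n \<ge> 5" | "n < 5" by linarith
  thus ?thesis
  proof cases
    case 1
    have "q * L \<le> n" by (simp add: q_def)
    hence "p ^ (q * (5 * self_bound E)) \<le> card (vecs p n)"
      unfolding card_vecs[OF p0] L_def[symmetric] using p0 by (intro power_increasing) auto
    then obtain W where W: "isotropic W" "card W = p ^ q"
      using isotropic_subspace[OF E0 sg_V bias, of q] by blast
    have "L * Suc q \<le> L * (2 * q)" using 1 by (intro mult_le_mono2) simp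
    hence "n \<le> L * (2 * q)" using nq by linarith
    also have "\<dots> \<le> (100000 * E ^ 6) * (2 * q)" using L by (rule mult_right_mono) simp
    finally have n: "n \<le> 200000 * E ^ 6 * q" by simp
    have "W \<subseteq> vecs p n" using W(1) unfolding isotropic_def sg_def by blast
    with that[OF W] n show ?thesis by blast
  next
    case 2
    hence "p ^ 5 \<le> card (vecs p n)" unfolding card_vecs[OF p0] using p0 by (intro power_increasing) auto
    from isotropic_line[OF sg_V this] obtain W where W: "isotropic W" "card W = p ^ 1"
      unfolding power_one_right by blast
    have "L * Suc q = L" using 2 by simp
    hence n: "n \<le> 200000 * E ^ 6 * 1" using nq L by linarith
    have "W \<subseteq> vecs p n" using W(1) unfolding isotropic_def sg_def by blast
    with that[OF W] n show ?thesis by blast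
  next
    case 3
    have "cform p n F 0 0 0 0 = 0" using addv_0[OF T_addv1] zero_V by blast
    hence "isotropic {0}" using sg_zero_set by (simp add: isotropic_def)
    moreover have "card {0 :: nat \<Rightarrow> circ} = p ^ 0" by simp
    ultimately show ?thesis using that[of "{0}" 0] 3 zero_V by simp
  qed
qed

text \<open>The codimension per dimension is of order \<open>E ^ 6\<close> and \<open>E\<close> of
  order \<open>1 / \<delta> ^ 16\<close>, whence the exponent 96. Expanding the square of
  \<open>x - 96\<close> gives \<open>96 * x \<le> x\<^sup>2 / 2 + 4608\<close>, and
  \<open>1 / 2 \<le> ln p\<close> absorbs the quadratic term into the power of \<open>p\<close>. The
  factor 64 is the sixth power of the 2 in the bound on \<open>E\<close>.\<close>

lemma numeric_bound:
  fixes \<delta> :: real and E n k p :: nat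
  assumes \<delta>: "0 < \<delta>" "\<delta> \<le> 1" and E: "real E \<le> 2 / \<delta> ^ 16" and n: "n \<le> 200000 * E ^ 6 * k" and p: "p \<ge> 2"
  shows "1 / (200000 * 64 * exp 4608) * (real n / real p powr (ln (1 / \<delta>))\<^sup>2) \<le> real k"
proof -
  define x where "x = ln (1 / \<delta>)"
  have \<delta>x: "1 / \<delta> = exp x" using \<delta> by (simp add: x_def)
  have "exp (1 / 2 :: real) \<le> real p" using exp_half_le2 p by linarith
  hence "ln (exp (1 / 2)) \<le> ln (real p)" using p by (subst ln_le_cancel_iff) auto
  hence lnp: "1 / 2 \<le> ln (real p)" by simp
  have "96 * x \<le> x\<^sup>2 / 2 + 4608" using zero_le_power2[of "x - 96"] by (simp add: power2_diff)
  also have "x\<^sup>2 / 2 \<le> x\<^sup>2 * ln (real p)" using mult_left_mono[OF lnp, of "x\<^sup>2"] by simp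
  finally have "exp (96 * x) \<le> exp (x\<^sup>2 * ln (real p) + 4608)" by simp
  hence ex: "exp (96 * x) \<le> real p powr x\<^sup>2 * exp 4608" using p by (simp add: powr_def exp_add)
  have "real E \<le> 2 * exp x ^ 16" using E unfolding \<delta>x[symmetric] by (simp add: power_one_over)
  hence "real E ^ 6 \<le> (2 * exp x ^ 16) ^ 6" by (intro power_mono) auto
  also have "\<dots> = 64 * exp (96 * x)"
    by (simp add: power_mult_distrib power_mult[symmetric] exp_of_nat_mult[symmetric])
  finally have E6: "real E ^ 6 \<le> 64 * (real p powr x\<^sup>2 * exp 4608)" using ex by simp
  have "real n \<le> real (200000 * E ^ 6 * k)" using n by (simp only: of_nat_le_iff)
  also have "\<dots> = 200000 * real E ^ 6 * real k" by simp
  also have "\<dots> \<le> 200000 * (64 * (real p powr x\<^sup>2 * exp 4608)) * real k"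
    using E6 by (intro mult_right_mono mult_left_mono) auto
  finally have "real n \<le> (200000 * 64 * exp 4608) * real k * real p powr x\<^sup>2" by (simp add: mult_ac)
  moreover have "real p powr x\<^sup>2 > 0" using p by simp
  ultimately have A: "real n / real p powr x\<^sup>2 \<le> (200000 * 64 * exp 4608) * real k" by (simp add: pos_divide_le_eq)
  define K :: real where "K = 200000 * 64 * exp 4608"
  have K: "K > 0" by (simp add: K_def)
  have "1 / K * (real n / real p powr x\<^sup>2) \<le> 1 / K * (K * real k)"
    using A K unfolding K_def[symmetric] by (intro mult_left_mono) auto
  also have "\<dots> = real k" using K by simp
  finally show ?thesis unfolding x_def[symmetric] K_def .
qed

section \<open>The partition into cosets\<close>

lemma sub_of_vecs: "p > 0 \<Longrightarrow> sub_of p n (vecs p n) = box p n"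
  unfolding sub_of_def vecs_def by blast

lemma partition_cosets:
  assumes p: "prime p" and W: "pgroup.sg (vecs p n) W"
  shows "partition_on (box p n) ((\<lambda>a. a <+\<^bsub>Fn p n\<^esub> sub_of p n W) ` box p n)"
proof -
  interpret pgroup p "vecs p n" by (rule pgroup_vecs[OF p])
  let ?c = "\<lambda>a. a <+\<^bsub>Fn p n\<^esub> sub_of p n W"
  have self: "a \<in> ?c a" if "a \<in> box p n" for a
    unfolding coset_eq[OF p W that] using that sg_zero[OF W] by simp
  have sub: "?c a \<subseteq> box p n" if "a \<in> box p n" for a unfolding coset_eq[OF p W that] by blast
  have eq: "?c a \<subseteq> ?c b" if "a \<in> box p n" "b \<in> box p n" "x \<in> ?c a" "x \<in> ?c b" for a b x
  proof
    fix y assume "y \<in> ?c a"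
    hence y: "y \<in> box p n" "emb p n y - emb p n a \<in> W" unfolding coset_eq[OF p W that(1)] by blast+
    have x: "emb p n x - emb p n a \<in> W" "emb p n x - emb p n b \<in> W"
      using that(3,4) unfolding coset_eq[OF p W that(1)] coset_eq[OF p W that(2)] by blast+
    have "(emb p n y - emb p n a) - (emb p n x - emb p n a) + (emb p n x - emb p n b) \<in> W"
      using sg_add[OF W sg_diff[OF W y(2) x(1)] x(2)] .
    moreover have "(emb p n y - emb p n a) - (emb p n x - emb p n a) + (emb p n x - emb p n b) = emb p n y - emb p n b"
      by simp
    ultimately show "y \<in> ?c b" unfolding coset_eq[OF p W that(2)] using y(1) by simp
  qed
  show ?thesis
  proof (rule partition_onI)
    show "\<Union> (?c ` box p n) = box p n" using self sub by blast
    show "{} \<notin> ?c ` box p n" using self by blast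
    show "disjnt q q'" if q: "q \<in> ?c ` box p n" "q' \<in> ?c ` box p n" "q \<noteq> q'" for q q'
    proof (rule ccontr)
      assume "\<not> disjnt q q'"
      then obtain x where x: "x \<in> q" "x \<in> q'" unfolding disjnt_def by blast
      obtain a b where ab: "a \<in> box p n" "b \<in> box p n" "q = ?c a" "q' = ?c b" using q(1,2) by blast
      have "q = q'" using eq[OF ab(1,2)] eq[OF ab(2,1)] x unfolding ab(3,4) by blast
      thus False using q(3) by blast
    qed
  qed
qed

theorem theorem4:
  shows "\<exists>(C::real) (c::real) (N::nat). C > 0 \<and> c > 0 \<and>
    (\<forall>(p::nat) (n::nat) (f :: (nat \<Rightarrow> int) \<Rightarrow> int) (\<delta>::real).
       prime p \<longrightarrow> poly_deg_le_on p n 4 (carrier (Fn p n)) f \<longrightarrow> gowers_norm p n 4 f = \<delta> \<longrightarrow>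
       (\<exists>V \<V>. lin_subspace p n V \<and>
          real (lin_dim p n V) \<ge> real n - C * ln (1 / \<delta>) \<and>
          partition_on V \<V> \<and>
          (\<forall>A\<in>\<V>. affine_subspace p n A \<and>
             (n \<ge> N \<longrightarrow>
                real (affine_dim p n A) \<ge> c * (real n / real p powr (ln (1 / \<delta>))\<^sup>2)) \<and>
             poly_deg_le_on p n 3 A f)))"
proof (rule exI[of _ 1], rule exI[of _ "1 / (200000 * 64 * exp 4608)"], rule exI[of _ 5], intro conjI allI impI)
  fix p n :: nat and f :: "(nat \<Rightarrow> int) \<Rightarrow> int" and \<delta> :: real
  assume p: "prime p" and f: "poly_deg_le_on p n 4 (carrier (Fn p n)) f" and \<delta>: "gowers_norm p n 4 f = \<delta>"
  \<comment> \<open>The witness \<open>N = 5\<close> reflects the Chevalley-Warning theorem: in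
    fewer than five dimensions a quartic form may have no nontrivial zero. \<open>C = 1\<close>
    works because \<open>V\<close> is the whole space and \<open>ln (1 / \<delta>)\<close> is
    nonnegative.\<close>
  let ?c = "1 / (200000 * 64 * exp 4608) :: real"
  have p0: "p > 0" and p2: "p \<ge> 2" using p prime_gt_0_nat prime_ge_2_nat by auto
  obtain F where F: "intpoly n 4 F" and fF: "\<And>x. x \<in> box p n \<Longrightarrow> f x = F x mod int p"
    using poly_deg_le_on_imp_intpoly[OF p order_refl] f unfolding Fn_simps(1)[OF p] by blast
  define M where "M = real (p ^ n) ^ 3"
  have M0: "M > 0" using p0 by (simp add: M_def)
  define Z where "Z = real (zero_triples p n F)"
  have Z: "0 < Z" "Z \<le> M"
    using zero_triples_bounds[OF p F] unfolding Z_def M_def by (simp_all flip: of_nat_power of_nat_le_iff)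
  have d: "\<delta> = (Z / M) powr (1 / 16)" using gowers_norm_eq[OF p F fF] \<delta> unfolding Z_def M_def by simp
  have ZM: "0 < Z / M" "Z / M \<le> 1" using Z M0 by simp_all
  have d0: "0 < \<delta>" unfolding d using Z M0 by simp
  have d1: "\<delta> \<le> 1" unfolding d using ZM by (intro powr_le1) auto
  have "\<delta> ^ 16 = ((Z / M) powr (1 / 16)) powr (real 16)"
    unfolding d by (rule powr_realpow[symmetric]) (use Z M0 in simp)
  also have "\<dots> = Z / M" unfolding powr_powr using Z M0 by simp
  finally have d16: "\<delta> ^ 16 = Z / M" .
  \<comment> \<open>The bias is counted in natural numbers, so the inverse density is rounded up; as
    it is at least 1, this at most doubles it.\<close>
  define E where "E = nat \<lceil>M / Z\<rceil>"
  have MZ: "1 \<le> M / Z" using Z by simp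
  have E1: "M / Z \<le> real E" unfolding E_def by linarith
  have E2: "real E \<le> 2 / \<delta> ^ 16"
  proof -
    have "real E \<le> M / Z + 1" unfolding E_def using MZ by linarith
    also have "\<dots> \<le> 2 * (M / Z)" using MZ by linarith
    also have "\<dots> = 2 / \<delta> ^ 16" unfolding d16 by simp
    finally show ?thesis .
  qed
  have "M \<le> real E * Z" using E1 Z by (simp add: pos_divide_le_eq)
  hence "real ((p ^ n) ^ 3) \<le> real (E * zero_triples p n F)" unfolding M_def Z_def by simp
  hence "(p ^ n) ^ 3 \<le> E * zero_triples p n F" by (simp only: of_nat_le_iff)
  then obtain W k where W: "quadrilinear.isotropic (vecs p n) (cform p n F) W" "card W = p ^ k"
    "n \<ge> 5 \<longrightarrow> n \<le> 200000 * E ^ 6 * k" "W \<subseteq> vecs p n"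
    using exists_isotropic[OF p F] by blast
  have cF: "class_fun p n F" using intpoly_class_fun[OF F] .
  have dF: "dd p 5 F" using intpoly_dd[OF F, of p] by simp
  interpret quadrilinear p "vecs p n" "cform p n F" "frac_circ p 1" by (rule quadrilinear_cform[OF p cF dF])
  have sgW: "sg W" using W(1) unfolding isotropic_def by blast
  have dim: "k \<le> lin_dim p n (sub_of p n U)" if "sg U" "card U = p ^ k" for U k
  proof -
    have "U \<subseteq> vecs p n" using that(1) unfolding sg_def by blast
    hence "p ^ k \<le> p ^ lin_dim p n (sub_of p n U)"
      using card_le_lin_dim[OF p lin_subspace_sub_of[OF p that(1)]] card_sub_of[OF p0] that(2) by simp
    thus ?thesis using p_gt1 power_le_imp_le_exp by blast
  qed
  let ?P = "(\<lambda>a. a <+\<^bsub>Fn p n\<^esub> sub_of p n W) ` box p n"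
  have sp: "lin_subspace p n (box p n)" "n \<le> lin_dim p n (box p n)"
    using lin_subspace_sub_of[OF p sg_V] dim[OF sg_V card_vecs[OF p0]] unfolding sub_of_vecs[OF p0] by blast+
  have "real n - 1 * ln (1 / \<delta>) \<le> real (lin_dim p n (box p n))"
  proof -
    have "0 \<le> ln (1 / \<delta>)" using d0 d1 by (intro ln_ge_zero) simp
    thus ?thesis using sp(2) by linarith
  qed
  moreover have "affine_subspace p n A \<and>
      (n \<ge> 5 \<longrightarrow> real (affine_dim p n A) \<ge> ?c * (real n / real p powr (ln (1 / \<delta>))\<^sup>2)) \<and> poly_deg_le_on p n 3 A f"
    if "A \<in> ?P" for A
  proof -
    obtain a where a: "a \<in> box p n" "A = a <+\<^bsub>Fn p n\<^esub> sub_of p n W" using \<open>A \<in> ?P\<close> by blast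
    have "affine_subspace p n A"
      unfolding affine_subspace_def Fn_simps(1)[OF p] using a lin_subspace_sub_of[OF p sgW] by blast
    moreover have "?c * (real n / real p powr (ln (1 / \<delta>))\<^sup>2) \<le> real (affine_dim p n A)" if "n \<ge> 5"
    proof -
      have "?c * (real n / real p powr (ln (1 / \<delta>))\<^sup>2) \<le> real k"
        using W(3) that by (intro numeric_bound[OF d0 d1 E2 _ p2]) blast
      also have "\<dots> \<le> real (affine_dim p n A)"
        unfolding affine_dim_def a(2) direction_coset[OF p sgW a(1)] using dim[OF sgW W(2)] by simp
      finally show ?thesis .
    qed
    moreover have "poly_deg_le_on p n 3 A f" unfolding a(2) by (rule cubic_on_coset[OF p F fF W(1) a(1)])
    ultimately show ?thesis by blast
  qed
  ultimately show "\<exists>V \<V>. lin_subspace p n V \<and> real (lin_dim p n V) \<ge> real n - 1 * ln (1 / \<delta>) \<and> partition_on V \<V> \<and>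
      (\<forall>A\<in>\<V>. affine_subspace p n A \<and>
        (n \<ge> 5 \<longrightarrow> real (affine_dim p n A) \<ge> ?c * (real n / real p powr (ln (1 / \<delta>))\<^sup>2)) \<and> poly_deg_le_on p n 3 A f)"
    using sp(1) partition_cosets[OF p sgW] by blast
qed simp_all

end
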